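(* Let $0\le a<b\le\infty$, $0<r\le q<p<1$, and let $u,v,w$ be weights on $(a,b)$ such that $0<\mathcal{W}(x)<\infty$ for all $x\in(a,b)$. Then there is a constant $C\in(0,\infty)$ such that $$\bigg(\int_a^b \bigg(\int_a^t f(s)^r v(s)\, ds \bigg)^{\frac{q}{r}} u(t)\, dt \bigg)^{\frac{1}{q}} \leq C\bigg(\int_a^b \bigg(\int_a^t f(s)\, ds \bigg)^{p} w(t)\, dt\bigg)^{\frac{1}{p}}$$ holds for all non-negative measurable functions $f$ on $(a,b)$ if and only if $\max\{\mathcal{C}_5,\mathcal{C}_6\}<\infty$, where $$\mathcal{C}_5 := \bigg(\int_a^{b} \mathcal{W}(x)^{-\frac{p}{p-q}} w(x) \bigg( \int_x^{b} \bigg( \int_t^{b} u \bigg)^{\frac{q}{1-q}} u(t) V_r(x,t)^{\frac{q}{1-q}} dt \bigg)^{\frac{p(1-q)}{p-q}} dx \bigg)^{\frac{p-q}{pq}} + \mathcal{W}(a)^{-\frac{1}{p}} \bigg( \int_a^{b} \bigg( \int_t^{b} u \bigg)^{\frac{q}{1-q}} u(t) V_r(a, t)^{\frac{q}{1-q}} dt \bigg)^{\frac{1-q}{q}}$$ and $$\mathcal{C}_6 := \bigg(\int_a^{b} \bigg(\int_x^{b} u\bigg)^{\frac{q}{p-q}} u(x) \bigg(\int_a^x \mathcal{W}(t)^{-\frac{p}{p-r}} w(t) V_r(t, x)^{\frac{pr}{p-r}} dt \bigg)^{\frac{q(p-r)}{r(p-q)}} dx\bigg)^{\frac{p-q}{pq}}.$$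 Moreover, the best (least) constant $C$ in the inequality satisfies $C\approx \mathcal{C}_5+\mathcal{C}_6$, where the multiplicative constants depend only on $p,q,r$.
   Context: A weight on $(a,b)$ is a measurable function that is positive and finite a.e. on $(a,b)$. For $x\in[a,b]$, $\mathcal{W}(x):=\int_x^b w(t)\,dt$ (so $\mathcal{W}(a)$ may be $\infty$). For $a\le x<y\le b$ and $0<r<1$, $V_r(x,y):=\big(\int_x^y v^{\frac{1}{1-r}}\big)^{\frac{1-r}{r}}$. Arguments and differentials in integrals are omitted when clear, e.g. $\int_t^b u=\int_t^b u(s)\,ds$. $A\approx B$ means $c^{-1}B\le A\le cB$ for some constant $c\in(0,\infty)$ (with the stated dependence). All quantities take values in $[0,\infty]$, with conventions $1/(\pm\infty)=0$, $0/0=0$, $0\cdot(\pm\infty)=0$. *)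

theory Defs
  imports "HOL-Analysis.Analysis"
begin

(* Real powers on [0, \<infinity>].  For negative exponents 1/\<infinity> = 0 and 1/0 = \<infinity>; the latter is never
   used below under the hypothesis that the tails of w are positive.  The product on ennreal already
   satisfies 0 * \<infinity> = 0. *)
definition epow :: "ennreal \<Rightarrow> real \<Rightarrow> ennreal" where
  "epow x s =
     (if s = 0 then 1
      else if x = 0 then (if 0 < s then 0 else \<infinity>)
      else if x = \<infinity> then (if 0 < s then \<infinity> else 0)
      else ennreal (enn2real x powr s))"

definition eint :: "ereal \<Rightarrow> ereal \<Rightarrow> (real \<Rightarrow> ennreal) \<Rightarrow> ennreal" where
  "eint x y g = (\<integral>\<^sup>+t\<in>einterval x y. g t \<partial>lebesgue)"

definition weight_on :: "ereal \<Rightarrow> ereal \<Rightarrow> (real \<Rightarrow> ennreal) \<Rightarrow> bool" where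
  "weight_on a b w \<longleftrightarrow>
     w \<in> borel_measurable (lebesgue_on (einterval a b)) \<and>
     (AE x in lebesgue_on (einterval a b). 0 < w x \<and> w x < \<infinity>)"

definition tail :: "ereal \<Rightarrow> (real \<Rightarrow> ennreal) \<Rightarrow> ereal \<Rightarrow> ennreal" where
  "tail b w x = eint x b w"

definition Vr :: "real \<Rightarrow> (real \<Rightarrow> ennreal) \<Rightarrow> ereal \<Rightarrow> ereal \<Rightarrow> ennreal" where
  "Vr r v x y = epow (eint x y (\<lambda>s. epow (v s) (1 / (1 - r)))) ((1 - r) / r)"

definition hardy_ineq ::
  "real \<Rightarrow> real \<Rightarrow> real \<Rightarrow> ereal \<Rightarrow> ereal \<Rightarrow> (real \<Rightarrow> ennreal) \<Rightarrow> (real \<Rightarrow> ennreal) \<Rightarrow>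
   (real \<Rightarrow> ennreal) \<Rightarrow> ennreal \<Rightarrow> bool" where
  "hardy_ineq p q r a b u v w C \<longleftrightarrow>
     (\<forall>f :: real \<Rightarrow> ennreal. f \<in> borel_measurable (lebesgue_on (einterval a b)) \<longrightarrow>
        epow (eint a b (\<lambda>t. epow (eint a t (\<lambda>s. epow (f s) r * v s)) (q / r) * u t)) (1 / q)
        \<le> C * epow (eint a b (\<lambda>t. epow (eint a t f) p * w t)) (1 / p))"

(* The infimum of the empty set in ennreal is \<infinity>, so this is \<infinity> if no finite constant works. *)
definition best_const ::
  "real \<Rightarrow> real \<Rightarrow> real \<Rightarrow> ereal \<Rightarrow> ereal \<Rightarrow> (real \<Rightarrow> ennreal) \<Rightarrow> (real \<Rightarrow> ennreal) \<Rightarrow>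
   (real \<Rightarrow> ennreal) \<Rightarrow> ennreal" where
  "best_const p q r a b u v w = Inf {C. 0 < C \<and> C < \<infinity> \<and> hardy_ineq p q r a b u v w C}"

definition C5 ::
  "real \<Rightarrow> real \<Rightarrow> real \<Rightarrow> ereal \<Rightarrow> ereal \<Rightarrow> (real \<Rightarrow> ennreal) \<Rightarrow> (real \<Rightarrow> ennreal) \<Rightarrow>
   (real \<Rightarrow> ennreal) \<Rightarrow> ennreal" where
  "C5 p q r a b u v w =
     epow (eint a b (\<lambda>x.
         epow (tail b w x) (- p / (p - q)) * w x *
         epow (eint x b (\<lambda>t. epow (tail b u t) (q / (1 - q)) * u t * epow (Vr r v x t) (q / (1 - q))))
              (p * (1 - q) / (p - q))))
       ((p - q) / (p * q))
     + epow (tail b w a) (- 1 / p) *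
       epow (eint a b (\<lambda>t. epow (tail b u t) (q / (1 - q)) * u t * epow (Vr r v a t) (q / (1 - q))))
         ((1 - q) / q)"

definition C6 ::
  "real \<Rightarrow> real \<Rightarrow> real \<Rightarrow> ereal \<Rightarrow> ereal \<Rightarrow> (real \<Rightarrow> ennreal) \<Rightarrow> (real \<Rightarrow> ennreal) \<Rightarrow>
   (real \<Rightarrow> ennreal) \<Rightarrow> ennreal" where
  "C6 p q r a b u v w =
     epow (eint a b (\<lambda>x.
         epow (tail b u x) (q / (p - q)) * u x *
         epow (eint a x (\<lambda>t. epow (tail b w t) (- p / (p - r)) * w t * epow (Vr r v t x) (p * r / (p - r))))
              (q * (p - r) / (r * (p - q)))))
       ((p - q) / (p * q))"

end

theory Submission
  imports Defs
begin

text \<open>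
  Write \<open>\<sigma> = v\<^sup>1\<^sup>/\<^sup>(\<^sup>1\<^sup>-\<^sup>r\<^sup>)\<close>, \<open>d\<nu> = \<sigma> dx\<close>, \<open>d\<mu> = u dx\<close>, \<open>f = g \<sigma>\<close>; then \<open>v\<close> disappears and
  \<open>V\<^sub>r(x,t)\<close> is a power of \<open>\<nu>(x,t)\<close>. Cut \<open>(a,b)\<close> into blocks \<open>A k\<close> on which \<open>2\<^sup>-\<^sup>k\<^sup>-\<^sup>1 < \<W> \<le> 2\<^sup>-\<^sup>k\<close>. Since
  \<open>p < 1\<close>, the right-hand side is comparable with \<open>\<Sum>\<^sub>k 2\<^sup>-\<^sup>k G\<^sub>k\<^sup>p\<close>, where \<open>G\<^sub>k = \<integral>\<^bsub>A k\<^esub> g d\<nu>\<close>. The left-hand side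
  splits into a local part, a Hardy inequality inside each block with \<open>\<integral> g d\<nu>\<close> prescribed, and a
  global part, in which \<open>\<integral>\<^bsub>A j\<^esub> g\<^sup>r d\<nu>\<close> may be replaced by its maximal value \<open>G\<^sub>j\<^sup>r \<nu>(A j)\<^sup>1\<^sup>-\<^sup>r\<close>, which turns it into a
  discrete Hardy inequality. Both are instances of one Maz'ya--Rozin type characterisation
  (\<open>hardy_sufficient\<close>, \<open>hardy_necessary\<close>) of
  \<open>\<integral> (\<integral>\<^bsub>y<t\<^esub> g(y)\<^sup>\<rho> d\<nu>)\<^sup>\<kappa>\<^sup>/\<^sup>\<rho> d\<mu>(t) \<le> K (\<integral> g d\<nu>)\<^sup>\<kappa>\<close>, \<open>\<rho> \<le> \<kappa> < 1\<close>, for arbitrary \<open>\<sigma>\<close>-finite measures on a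
  linear order: over the reals with \<open>(\<rho>,\<kappa>) = (r,q)\<close> and over the integers with
  \<open>(\<rho>,\<kappa>) = (r/p,q/p)\<close>. Summing the local conditions yields the first term of \<open>C5\<close>, the discrete
  condition yields \<open>C6\<close>: the weights \<open>2\<^sup>k\<^sup>\<alpha>\<close> grow geometrically, so a sum over later blocks may be replaced
  by its first term. The second term of \<open>C5\<close> accounts for the first block when \<open>\<W>(a) < \<infinity>\<close>; it also
  supplies the boundary term at \<open>a\<close> that \<open>C6\<close> lacks.
\<close>

section \<open>Real powers of extended non-negative numbers\<close>

text \<open>Up to constants the right-hand side does not see where inside a block the mass of g
  sits; this freedom permits extremising g block by block. For necessity, superadditivity of
  x^(q/r), valid because r \<le> q, lets test functions on different blocks be combined without
  interference, and duality of sequences at exponent q/p produces the power p/(p-q) seen in both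
  conditions. Two obstacles shape the details. At atoms no identity d(H^e) = e H^(e-1) dH is
  available; it is replaced by one-sided inequalities with dyadic constants. Moreover every quantity
  may be infinite: cancelling a common factor is preceded by truncation or by restriction to finite
  measure, and finiteness of the block masses is not assumed but deduced from finiteness of
  \<open>S5'\<close>.\<close>

lemma epow_0_right [simp]: "epow x 0 = 1"
  by (simp add: epow_def)

lemma epow_1_right [simp]: "epow x 1 = x"
  by (cases x) (auto simp: epow_def)

lemma epow_zero: "0 < s \<Longrightarrow> epow 0 s = 0"
  by (simp add: epow_def)

lemma epow_top: "0 < s \<Longrightarrow> epow top s = top"
  by (simp add: epow_def)

lemma epow_top_neg: "s < 0 \<Longrightarrow> epow top s = 0"
  by (simp add: epow_def)

lemma epow_zero_neg: "s < 0 \<Longrightarrow> epow 0 s = top"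
  by (simp add: epow_def)

lemma epow_ennreal: "0 < y \<Longrightarrow> epow (ennreal y) s = ennreal (y powr s)"
  by (auto simp: epow_def)

lemma epow_1_left [simp]: "epow 1 s = 1"
  using epow_ennreal[of 1 s] by simp

lemma ennreal_cases_epow [case_names zero top pos]:
  fixes x :: ennreal
  obtains "x = 0" | "x = top" | y where "0 < y" "x = ennreal y"
  by (metis ennreal_0 ennreal_cases infinity_ennreal_def less_eq_real_def)

lemma epow_mono:
  assumes "x \<le> y" "0 \<le> s"
  shows "epow x s \<le> epow y s"
proof (cases "s = 0")
  case False
  then have s: "0 < s" using assms by simp
  show ?thesis
    using assms s
    by (cases x rule: ennreal_cases_epow; cases y rule: ennreal_cases_epow)
       (auto simp: epow_zero epow_top epow_ennreal top_unique intro!: ennreal_leI powr_mono2)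
qed simp

lemma epow_antimono:
  assumes "x \<le> y" "s \<le> 0"
  shows "epow y s \<le> epow x s"
proof (cases "s = 0")
  case False
  then have s: "s < 0" using assms by simp
  show ?thesis
    using assms s
    by (cases x rule: ennreal_cases_epow; cases y rule: ennreal_cases_epow)
       (auto simp: epow_zero_neg epow_top_neg epow_ennreal top_unique intro!: ennreal_leI powr_mono2')
qed simp

text \<open>The sign restriction is forced by 0 * \<infinity> = 0: for s = -1, x = 0, y =
  \<infinity> the left side is \<infinity> and the right side 0.\<close>

lemma epow_mult:
  assumes "0 \<le> s"
  shows "epow (x * y) s = epow x s * epow y s"
proof (cases "s = 0")
  case False
  then have s: "0 < s" using assms by simp
  show ?thesis
    using s
    by (cases x rule: ennreal_cases_epow; cases y rule: ennreal_cases_epow)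
       (auto simp: epow_zero epow_top epow_ennreal powr_mult ennreal_mult_top ennreal_top_mult
             ennreal_mult[symmetric])
qed simp

text \<open>The conventions at 0 and \<infinity> are closed under composition, so exponents of
  either sign multiply without side conditions. All later exponent bookkeeping relies on
  this.\<close>

lemma epow_epow: "epow (epow x s) t = epow x (s * t)"
  by (cases x rule: ennreal_cases_epow; cases "s = 0"; cases "t = 0"; cases "s < 0"; cases "t < 0")
     (auto simp: epow_zero epow_top epow_zero_neg epow_top_neg epow_ennreal powr_powr
        mult_neg_neg mult_pos_neg mult_neg_pos)

text \<open>With opposite signs the law fails at 0 and \<infinity>: s = 1, t = -1 gives 1 against 0
  * \<infinity> = 0. Hence the variant \<open>epow_add'\<close> for positive finite bases.\<close>

lemma epow_add:
  assumes "0 \<le> s" "0 \<le> t"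
  shows "epow x (s + t) = epow x s * epow x t"
proof (cases "s = 0 \<or> t = 0")
  case False
  then have "0 < s" "0 < t" using assms by auto
  then show ?thesis
    by (cases x rule: ennreal_cases_epow)
       (auto simp: epow_zero epow_top epow_ennreal powr_add ennreal_mult)
qed auto

lemma epow_add':
  assumes "0 < x" "x < top"
  shows "epow x (s + t) = epow x s * epow x t"
  using assms
  by (cases x rule: ennreal_cases_epow) (auto simp: epow_ennreal powr_add ennreal_mult)

lemma epow_eq_0_iff: "0 < s \<Longrightarrow> epow x s = 0 \<longleftrightarrow> x = 0"
  by (cases x rule: ennreal_cases_epow) (auto simp: epow_zero epow_top epow_ennreal)

lemma epow_eq_top_iff: "0 < s \<Longrightarrow> epow x s = top \<longleftrightarrow> x = top"
  by (cases x rule: ennreal_cases_epow) (auto simp: epow_zero epow_top epow_ennreal)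

lemma epow_less_top: "0 \<le> s \<Longrightarrow> x < top \<Longrightarrow> epow x s < top"
  by (cases "s = 0"; cases x rule: ennreal_cases_epow) (auto simp: epow_zero epow_ennreal)

lemma epow_pos_finite: "0 < x \<Longrightarrow> x < top \<Longrightarrow> 0 < epow x s \<and> epow x s < top"
  by (cases x rule: ennreal_cases_epow) (auto simp: epow_ennreal)

text \<open>The sum is at most twice the larger summand. The crude constant 2^s serves the convex
  and the concave range alike.\<close>

lemma epow_add_le:
  assumes "0 \<le> s"
  shows "epow (x + y) s \<le> ennreal (2 powr s) * (epow x s + epow y s)"
proof -
  have *: "epow (x + y) s \<le> ennreal (2 powr s) * (epow x s + epow y s)" if "x \<le> y" for x y
  proof -
    have "epow (x + y) s \<le> epow (2 * y) s"
      using that assms by (intro epow_mono) (auto simp: mult_2 intro: add_right_mono)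
    also have "\<dots> = ennreal (2 powr s) * epow y s"
      using epow_ennreal[of 2 s] by (simp add: epow_mult[OF assms])
    also have "\<dots> \<le> ennreal (2 powr s) * (epow x s + epow y s)"
      by (intro mult_left_mono) auto
    finally show ?thesis .
  qed
  show ?thesis
    using *[of x y] *[of y x] by (cases "x \<le> y") (auto simp: add.commute)
qed

lemma epow_le_iff:
  assumes "0 < s"
  shows "epow x s \<le> y \<longleftrightarrow> x \<le> epow y (1 / s)"
proof
  assume "epow x s \<le> y"
  then have "epow (epow x s) (1 / s) \<le> epow y (1 / s)"
    using assms by (intro epow_mono) auto
  then show "x \<le> epow y (1 / s)" using assms by (simp add: epow_epow)
next
  assume "x \<le> epow y (1 / s)"
  then have "epow x s \<le> epow (epow y (1 / s)) s"
    using assms by (intro epow_mono) auto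
  then show "epow x s \<le> y" using assms by (simp add: epow_epow)
qed

text \<open>For s > 0 the power is an order isomorphism of [0, \<infinity>]. Nonemptiness of
  \<open>I\<close> guards s = 0, where the power is 1 but an empty supremum is 0.\<close>

lemma epow_SUP:
  assumes "0 \<le> s" "I \<noteq> {}"
  shows "epow (SUP i\<in>I. f i) s = (SUP i\<in>I. epow (f i) s)"
proof (cases "s = 0")
  case True
  then show ?thesis using assms by simp
next
  case False
  then have s: "0 < s" using assms by simp
  show ?thesis
  proof (rule antisym)
    have "f i \<le> epow (SUP i\<in>I. epow (f i) s) (1 / s)" if "i \<in> I" for i
      using that by (subst epow_le_iff[symmetric, OF s]) (rule SUP_upper)
    then show "epow (SUP i\<in>I. f i) s \<le> (SUP i\<in>I. epow (f i) s)"
      unfolding epow_le_iff[OF s] by (intro SUP_least)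
    show "(SUP i\<in>I. epow (f i) s) \<le> epow (SUP i\<in>I. f i) s"
      using s by (intro SUP_least epow_mono SUP_upper) auto
  qed
qed

lemma measurable_epow [measurable]:
  assumes [measurable]: "f \<in> borel_measurable M"
  shows "(\<lambda>x. epow (f x) s) \<in> borel_measurable M"
  unfolding epow_def by measurable

text \<open>Write x^s = x * x^(s-1) and bound the second factor by the corresponding power of the
  whole sum.\<close>

lemma epow_superadditive:
  assumes "1 \<le> s"
  shows "(\<integral>\<^sup>+k. epow (x k) s \<partial>count_space A) \<le> epow (\<integral>\<^sup>+k. x k \<partial>count_space A) s"
proof -
  let ?S = "\<integral>\<^sup>+k. x k \<partial>count_space A"
  have le: "x k \<le> ?S" if "k \<in> A" for k
    using nn_integral_ge_point[OF that] .
  have "(\<integral>\<^sup>+k. epow (x k) s \<partial>count_space A) = (\<integral>\<^sup>+k. x k * epow (x k) (s - 1) \<partial>count_space A)"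
    using assms epow_add[of 1 "s - 1"] by (intro nn_integral_cong) simp
  also have "\<dots> \<le> (\<integral>\<^sup>+k. x k * epow ?S (s - 1) \<partial>count_space A)"
    using assms le by (intro nn_integral_mono mult_left_mono epow_mono) auto
  also have "\<dots> = ?S * epow ?S (s - 1)"
    by (rule nn_integral_multc) auto
  also have "\<dots> = epow ?S s"
    using assms epow_add[of 1 "s - 1" ?S] by simp
  finally show ?thesis .
qed

lemma epow_subadditive:
  assumes "0 < s" "s \<le> 1"
  shows "epow (\<integral>\<^sup>+k. x k \<partial>count_space A) s \<le> (\<integral>\<^sup>+k. epow (x k) s \<partial>count_space A)"
  using epow_superadditive[where s = "1 / s" and x = "\<lambda>k. epow (x k) s" and A = A] assms
  by (simp add: epow_epow epow_le_iff)

section \<open>Young's and Hoelder's inequalities\<close>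

lemma epow_Young:
  assumes "0 \<le> l" "l \<le> 1"
  shows "epow x l * epow y (1 - l) \<le> ennreal l * x + ennreal (1 - l) * y"
proof (cases "l = 0 \<or> l = 1")
  case False
  then have l: "0 < l" "l < 1" using assms by auto
  show ?thesis
  proof (cases "x = 0 \<or> y = 0 \<or> x = top \<or> y = top")
    case True
    then show ?thesis using l
      by (auto simp: epow_zero epow_top ennreal_mult_top ennreal_top_mult)
  next
    case False
    then obtain u v where uv: "0 < u" "x = ennreal u" "0 < v" "y = ennreal v"
      by (metis ennreal_cases_epow)
    have "u powr l * v powr (1 - l) \<le> l * u + (1 - l) * v"
      using Youngs_inequality_0[of l "1 - l" u v] l uv by simp
    then show ?thesis
      using uv l by (auto simp: epow_ennreal ennreal_mult[symmetric] ennreal_plus[symmetric]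
          simp del: ennreal_plus intro!: ennreal_leI)
  qed
qed auto

lemma nn_integral_Holder:
  assumes l: "0 \<le> l" "l \<le> 1"
    and [measurable]: "f \<in> borel_measurable M" "g \<in> borel_measurable M"
  shows "(\<integral>\<^sup>+x. epow (f x) l * epow (g x) (1 - l) \<partial>M)
    \<le> epow (\<integral>\<^sup>+x. f x \<partial>M) l * epow (\<integral>\<^sup>+x. g x \<partial>M) (1 - l)"
proof (cases "l = 0 \<or> l = 1")
  case True
  then show ?thesis by auto
next
  case False
  then have l: "0 < l" "l < 1" using l by auto
  let ?F = "\<integral>\<^sup>+x. f x \<partial>M" and ?G = "\<integral>\<^sup>+x. g x \<partial>M"
  have null: "(\<integral>\<^sup>+x. epow (f x) l * epow (g x) (1 - l) \<partial>M) = 0" if "?F = 0 \<or> ?G = 0"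
  proof -
    have "(AE x in M. f x = 0) \<or> (AE x in M. g x = 0)"
      using that by (simp add: nn_integral_0_iff_AE)
    then have "AE x in M. epow (f x) l * epow (g x) (1 - l) = 0"
      using l by (auto simp: epow_zero elim!: eventually_mono)
    then show ?thesis by (simp add: nn_integral_0_iff_AE)
  qed
  show ?thesis
  proof (cases "?F = 0 \<or> ?G = 0 \<or> ?F = top \<or> ?G = top")
    case True
    then show ?thesis using l null
      by (cases "?F = 0 \<or> ?G = 0") (auto simp: epow_top epow_eq_0_iff ennreal_mult_top ennreal_top_mult)
  next
    case False
    then obtain A B where AB: "0 < A" "?F = ennreal A" "0 < B" "?G = ennreal B"
      by (metis ennreal_cases_epow)
    let ?a = "ennreal (1 / A)" and ?b = "ennreal (1 / B)"
    have "(\<integral>\<^sup>+x. epow (?a * f x) l * epow (?b * g x) (1 - l) \<partial>M)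
      \<le> (\<integral>\<^sup>+x. ennreal l * (?a * f x) + ennreal (1 - l) * (?b * g x) \<partial>M)"
      using l by (intro nn_integral_mono epow_Young) auto
    also have "\<dots> = ennreal l * (?a * ?F) + ennreal (1 - l) * (?b * ?G)"
      by (simp add: nn_integral_add nn_integral_cmult)
    also have "\<dots> = 1"
      using AB l by (simp add: ennreal_mult[symmetric] ennreal_plus[symmetric] del: ennreal_plus)
    finally have le1: "(\<integral>\<^sup>+x. epow (?a * f x) l * epow (?b * g x) (1 - l) \<partial>M) \<le> 1" .
    have "epow (f x) l * epow (g x) (1 - l)
      = (epow ?F l * epow ?G (1 - l)) * (epow (?a * f x) l * epow (?b * g x) (1 - l))" for x
    proof -
      have a: "epow ?F l * epow (?a * f x) l = epow (f x) l"
        using AB l by (simp add: epow_mult[symmetric] mult.assoc[symmetric] ennreal_mult[symmetric])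
      have b: "epow ?G (1 - l) * epow (?b * g x) (1 - l) = epow (g x) (1 - l)"
        using AB l by (simp add: epow_mult[symmetric] mult.assoc[symmetric] ennreal_mult[symmetric])
      have c: "(A1 * B1) * (A2 * B2) = (A1 * A2) * (B1 * B2)" for A1 A2 B1 B2 :: ennreal
        by (simp add: ac_simps)
      show ?thesis by (subst c) (simp only: a b)
    qed
    then have "(\<integral>\<^sup>+x. epow (f x) l * epow (g x) (1 - l) \<partial>M)
      = (epow ?F l * epow ?G (1 - l)) * (\<integral>\<^sup>+x. epow (?a * f x) l * epow (?b * g x) (1 - l) \<partial>M)"
      by (subst nn_integral_cmult[symmetric]) auto
    also have "\<dots> \<le> (epow ?F l * epow ?G (1 - l)) * 1"
      using le1 by (intro mult_left_mono) auto
    finally show ?thesis by simp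
  qed
qed

text \<open>Two-term Hoelder with weights l and 1-l, then again inside the second factor with the
  renormalised weights m/(1-l) and 1 - m/(1-l). The middle exponent may vanish; in
  \<open>hardy_sufficient\<close> this is the case \<rho> = \<kappa>.\<close>

lemma nn_integral_Holder3:
  assumes l: "0 < l" "0 \<le> m" "l + m < 1"
    and [measurable]: "f \<in> borel_measurable M" "g \<in> borel_measurable M" "h \<in> borel_measurable M"
  shows "(\<integral>\<^sup>+x. epow (f x) l * epow (g x) m * epow (h x) (1 - l - m) \<partial>M)
    \<le> epow (\<integral>\<^sup>+x. f x \<partial>M) l * epow (\<integral>\<^sup>+x. g x \<partial>M) m * epow (\<integral>\<^sup>+x. h x \<partial>M) (1 - l - m)"
proof -
  let ?G = "\<lambda>x. epow (g x) (m / (1 - l)) * epow (h x) (1 - m / (1 - l))"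
  have m: "0 \<le> m / (1 - l)" "m / (1 - l) \<le> 1" using l by (auto simp: field_simps)
  have e: "(1 - m / (1 - l)) * (1 - l) = 1 - l - m" using l by (simp add: field_simps)
  have eq: "epow (A * B) (1 - l) = epow A (1 - l) * epow B (1 - l)" for A B
    using l by (intro epow_mult) auto
  have "(\<integral>\<^sup>+x. epow (f x) l * epow (g x) m * epow (h x) (1 - l - m) \<partial>M)
     = (\<integral>\<^sup>+x. epow (f x) l * epow (?G x) (1 - l) \<partial>M)"
    using l by (intro nn_integral_cong) (simp add: eq epow_epow e mult.assoc)
  also have "\<dots> \<le> epow (\<integral>\<^sup>+x. f x \<partial>M) l * epow (\<integral>\<^sup>+x. ?G x \<partial>M) (1 - l)"
    using l by (intro nn_integral_Holder) auto
  also have "\<dots> \<le> epow (\<integral>\<^sup>+x. f x \<partial>M) l *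
     epow (epow (\<integral>\<^sup>+x. g x \<partial>M) (m / (1 - l)) * epow (\<integral>\<^sup>+x. h x \<partial>M) (1 - m / (1 - l))) (1 - l)"
    using l m by (intro mult_left_mono epow_mono nn_integral_Holder) auto
  also have "\<dots> = epow (\<integral>\<^sup>+x. f x \<partial>M) l * epow (\<integral>\<^sup>+x. g x \<partial>M) m * epow (\<integral>\<^sup>+x. h x \<partial>M) (1 - l - m)"
    using l by (simp add: eq epow_epow e mult.assoc)
  finally show ?thesis .
qed

section \<open>Distribution of a measure along its own tails\<close>

text \<open>The countably many open rays generate the topology; this makes the integers an
  admissible underlying order for \<open>measure_pair\<close>.\<close>

instance int :: second_countable_topology
proof
  show "\<exists>B::int set set. countable B \<and> open = generate_topology B"
    by (intro exI[of _ "range lessThan \<union> range greaterThan"]) (auto simp: open_int_def)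
qed

text \<open>For an atomless \<open>M\<close> the tail function \<open>N x = M {..x}\<close> pushes \<open>M\<close> forward to Lebesgue measure. This
  one-sided version survives atoms, so that the real line and the integers can be treated alike; up to
  constants it replaces integration of powers by the fundamental theorem of calculus.\<close>

definition dist_le :: "'a measure \<Rightarrow> ('a \<Rightarrow> ennreal) \<Rightarrow> bool" where
  "dist_le M N \<longleftrightarrow> N \<in> borel_measurable M \<and> (\<forall>y. emeasure M {x \<in> space M. N x \<le> y} \<le> y)"

lemma dist_leD:
  assumes "dist_le M N"
  shows "N \<in> borel_measurable M" "emeasure M {x \<in> space M. N x \<le> y} \<le> y"
  using assms by (auto simp: dist_le_def)

lemma dist_le_AE: 
  assumes "dist_le M N" shows "AE x in M. N x \<noteq> 0"
proof -
  note [measurable] = dist_leD(1)[OF assms]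
  show ?thesis
    using dist_leD(2)[OF assms, of 0] by (intro AE_I[where N = "{x \<in> space M. N x \<le> 0}"]) auto
qed

lemma ennreal_half: "x / 2 + x / 2 = (x :: ennreal)"
proof -
  have "x / 2 + x / 2 = x * 2 / 2" by (simp add: mult_2[symmetric] ennreal_times_divide mult.commute)
  then show ?thesis by (simp add: mult_divide_eq_ennreal)
qed

lemma le_suminf_ennreal: "f n \<le> (\<Sum>n. f n :: ennreal)"
  using sum_le_suminf[of f "{n}"] by simp

text \<open>With T the mass of \<open>A\<close>, the set where N \<le> T/2 has mass at most T/2, so
  mass at least T/2 of \<open>A\<close> lies where N > T/2; there the integrand is at least (T/2)^a.
  Without atoms the constant would be a+1.\<close>

lemma dist_le_power:
  assumes d: "dist_le M N" and a: "0 \<le> a" and A [measurable]: "A \<in> sets M"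
  shows "epow (emeasure M A) (a + 1) \<le> ennreal (2 powr (a + 1)) * (\<integral>\<^sup>+x\<in>A. epow (N x) a \<partial>M)"
proof -
  note [measurable] = dist_leD(1)[OF d]
  define T where "T = emeasure M A"
  \<comment> \<open>For infinite T any positive finite level works: removing mass at most 1 leaves
    infinite mass.\<close>
  define y where "y = (if T = top then 1 else T / 2)"
  let ?S = "{x \<in> space M. N x \<le> y}"
  have S: "emeasure M ?S \<le> y" by (rule dist_leD(2)[OF d])
  have AS: "A \<inter> ?S \<union> (A - ?S) = A" by auto
  have "T \<le> emeasure M (A \<inter> ?S) + emeasure M (A - ?S)"
    unfolding T_def by (subst AS[symmetric], rule emeasure_subadditive) auto
  also have "emeasure M (A \<inter> ?S) \<le> emeasure M ?S" by (intro emeasure_mono) auto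
  finally have T: "T \<le> y + emeasure M (A - ?S)"
    using S by (meson add_right_mono order_trans)
  have D: "T / 2 \<le> emeasure M (A - ?S)"
  proof (cases "T = top")
    case True
    then show ?thesis using T by (auto simp: y_def top_unique)
  next
    case False
    then have "T / 2 < top" unfolding less_top[symmetric] by (simp add: ennreal_divide_eq_top_iff)
    moreover have "T / 2 + T / 2 \<le> T / 2 + emeasure M (A - ?S)"
      using T False by (simp add: y_def ennreal_half)
    ultimately show ?thesis unfolding ennreal_add_left_cancel_le by auto
  qed
  have "epow T (a + 1) = ennreal (2 powr (a + 1)) * epow (T / 2) (a + 1)"
  proof -
    have "epow T (a + 1) = epow (2 * (T / 2)) (a + 1)"
      by (simp add: mult_2 ennreal_half)
    also have "\<dots> = epow (ennreal 2) (a + 1) * epow (T / 2) (a + 1)"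
      using a by (subst epow_mult) auto
    finally show ?thesis by (subst (asm) epow_ennreal) auto
  qed
  also have "epow (T / 2) (a + 1) \<le> epow y a * emeasure M (A - ?S)"
  proof (cases "T = top")
    case True
    then show ?thesis using D by (simp add: y_def top_unique ennreal_top_divide ennreal_mult_top)
  next
    case False
    then show ?thesis using D a
      by (simp add: y_def epow_add mult_left_mono)
  qed
  also have "epow y a * emeasure M (A - ?S) = (\<integral>\<^sup>+x\<in>A - ?S. epow y a \<partial>M)"
    by (simp add: nn_integral_cmult_indicator)
  also have "\<dots> \<le> (\<integral>\<^sup>+x\<in>A. epow (N x) a \<partial>M)"
    using a sets.sets_into_space[OF A]
    by (intro nn_integral_mono) (auto simp: indicator_def intro!: epow_mono)
  finally show ?thesis unfolding T_def by (simp add: mult_left_mono)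
qed

lemma ex_dyadic: 
  assumes "1 \<le> (x::real)"
  shows "\<exists>n::nat. 2 ^ n \<le> x \<and> x < 2 ^ (n + 1)"
proof -
  define n where "n = nat \<lfloor>log 2 x\<rfloor>"
  have l: "0 \<le> log 2 x" using assms by simp
  have "real n \<le> log 2 x" "log 2 x < real (n + 1)"
    using l unfolding n_def by (auto, linarith+)
  then have "2 powr real n \<le> x" "x < 2 powr real (n + 1)"
    using assms by (simp_all add: le_log_iff log_less_iff)
  then show ?thesis by (auto simp: powr_realpow powr_add intro!: exI[of _ n])
qed

text \<open>The sum of 2^(-d n) over n \<ge> 0, for d > 0.\<close>

definition geom_const :: "real \<Rightarrow> real" where
  "geom_const d = 1 / (1 - 2 powr (- d))"

lemma geom_const_pos: "0 < d \<Longrightarrow> 0 < geom_const d"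
  using powr_less_mono[of "- d" 0 2] by (simp add: geom_const_def)

lemma suminf_geom:
  assumes "0 < d"
  shows "(\<Sum>n. ennreal (2 powr (- d * real n))) = ennreal (geom_const d)"
proof -
  have l: "2 powr (- d) < (1::real)" using assms powr_less_mono[of "- d" 0 2] by simp
  have "2 powr (- d * real n) = (2 powr (- d)) ^ n" for n :: nat
    by (subst powr_realpow[symmetric]) (simp_all add: powr_powr)
  moreover have "(\<lambda>n. (2 powr (- d)) ^ n) sums geom_const d"
    unfolding geom_const_def using l by (intro geometric_sums) auto
  ultimately have "(\<lambda>n. 2 powr (- d * real n)) sums geom_const d" by simp
  then show ?thesis by (intro suminf_ennreal_eq) auto
qed

text \<open>Counterpart of the integral of x^(-b) over (0,T). On the layer between T 2^(-n-1) and T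
  2^(-n) the integrand is controlled by the lower end and the mass by the upper end; the resulting
  series is geometric because b < 1.\<close>

lemma dist_le_singular_le:
  assumes d: "dist_le M N" and b: "0 \<le> b" "b < 1" and T: "T < top"
  shows "(\<integral>\<^sup>+x\<in>{x \<in> space M. N x \<le> T}. epow (N x) (- b) \<partial>M)
    \<le> ennreal (2 powr b * geom_const (1 - b)) * epow T (1 - b)"
proof -
  note [measurable] = dist_leD(1)[OF d]
  \<comment> \<open>At N = 0 the integrand is infinite for b > 0, so this set has to be
    null.\<close>
  have null: "AE x in M. N x \<noteq> 0"
    by (rule dist_le_AE[OF d])
  show ?thesis
  proof (cases "T = 0")
    case True
    then have "(\<integral>\<^sup>+x\<in>{x \<in> space M. N x \<le> T}. epow (N x) (- b) \<partial>M) = 0"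
      using null by (subst nn_integral_0_iff_AE) (auto elim!: eventually_mono)
    then show ?thesis by simp
  next
    case False
    then obtain t where t: "0 < t" "T = ennreal t" using T by (metis ennreal_cases_epow less_irrefl)
    let ?c = "\<lambda>n::nat. t * 2 powr (- real n)"
    have "(\<integral>\<^sup>+x\<in>{x \<in> space M. N x \<le> T}. epow (N x) (- b) \<partial>M)
      \<le> (\<integral>\<^sup>+x. (\<Sum>n. ennreal (?c (n + 1) powr (- b)) * indicator {x \<in> space M. N x \<le> ennreal (?c n)} x) \<partial>M)"
    proof (intro nn_integral_mono_AE, use null in \<open>rule eventually_mono\<close>)
      fix x assume "N x \<noteq> 0"
      show "epow (N x) (- b) * indicator {x \<in> space M. N x \<le> T} x
        \<le> (\<Sum>n. ennreal (?c (n + 1) powr (- b)) * indicator {x \<in> space M. N x \<le> ennreal (?c n)} x)"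
      proof (cases "x \<in> space M \<and> N x \<le> T")
        case True
        then obtain z where z: "0 < z" "N x = ennreal z" "z \<le> t"
          using \<open>N x \<noteq> 0\<close> t by (cases "N x" rule: ennreal_cases_epow) (auto simp: top_unique)
        obtain n :: nat where n: "2 ^ n \<le> t / z" "t / z < 2 ^ (n + 1)"
          using ex_dyadic[of "t / z"] z by auto
        have n1: "z \<le> ?c n" and n2: "?c (n + 1) \<le> z"
          using n z by (auto simp: powr_minus powr_realpow powr_add powr_diff field_simps)
        have "epow (N x) (- b) * indicator {x \<in> space M. N x \<le> T} x
          \<le> ennreal (?c (n + 1) powr (- b)) * indicator {x \<in> space M. N x \<le> ennreal (?c n)} x"
          using True z n1 n2 t b by (auto simp: epow_ennreal intro!: ennreal_leI powr_mono2')
        also have "\<dots> \<le> (\<Sum>n. ennreal (?c (n + 1) powr (- b)) * indicator {x \<in> space M. N x \<le> ennreal (?c n)} x)"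
          by (rule le_suminf_ennreal[where f = "\<lambda>n. ennreal (?c (n + 1) powr (- b)) * indicator {x \<in> space M. N x \<le> ennreal (?c n)} x"])
        finally show ?thesis .
      qed auto
    qed
    also have "\<dots> = (\<Sum>n. ennreal (?c (n + 1) powr (- b)) * emeasure M {x \<in> space M. N x \<le> ennreal (?c n)})"
      by (subst nn_integral_suminf) (auto simp: nn_integral_cmult_indicator)
    also have "\<dots> \<le> (\<Sum>n. ennreal (?c (n + 1) powr (- b)) * ennreal (?c n))"
      by (intro suminf_le mult_left_mono dist_leD(2)[OF d]) auto
    also have "\<dots> = (\<Sum>n. ennreal (2 powr b * t powr (1 - b)) * ennreal (2 powr (- (1 - b) * real n)))"
    proof (intro suminf_cong)
      fix n
      have 1: "?c (n + 1) powr (- b) * ?c n = 2 powr b * t powr (1 - b) * 2 powr (- (1 - b) * real n)"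
      proof -
        have 1: "?c (n + 1) powr (- b) = t powr (- b) * 2 powr ((real n + 1) * b)"
          using t by (simp add: powr_mult powr_powr algebra_simps)
        have 2: "t powr (- b) * t = t powr (1 - b)"
          using t powr_mult_base[of t "- b"] by (simp add: mult.commute)
        have 3: "2 powr ((real n + 1) * b) * 2 powr (- real n) = 2 powr b * 2 powr (- (1 - b) * real n)"
          by (simp add: powr_add[symmetric] algebra_simps)
        have eq: "a * x * (t * y) = (a * t) * (x * y)" for a x y :: real
          by simp
        show ?thesis by (subst 1, subst eq, subst 2, subst 3) (simp only: ac_simps)
      qed
      then show "ennreal (?c (n + 1) powr (- b)) * ennreal (?c n)
        = ennreal (2 powr b * t powr (1 - b)) * ennreal (2 powr (- (1 - b) * real n))"
        using t by (simp only: ennreal_mult[symmetric] powr_ge_zero mult_nonneg_nonneg less_imp_le)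
    qed
    also have "\<dots> = ennreal (2 powr b * t powr (1 - b)) * ennreal (geom_const (1 - b))"
      using b by (subst ennreal_suminf_cmult, subst suminf_geom) auto
    also have "\<dots> = ennreal (2 powr b * geom_const (1 - b)) * epow T (1 - b)"
      using b t geom_const_pos[of "1 - b"]
      by (simp add: epow_ennreal ennreal_mult[symmetric] mult.assoc mult.commute[of "t powr (1 - b)"])
    finally show ?thesis .
  qed
qed

text \<open>Dyadic layers upwards from T, summable because b > 1. Points with N = \<infinity>
  contribute nothing, by \<infinity>^(-b) = 0; for T = 0 the right side is infinite.\<close>

lemma dist_le_singular_ge:
  assumes d: "dist_le M N" and b: "1 < b"
  shows "(\<integral>\<^sup>+x\<in>{x \<in> space M. T \<le> N x}. epow (N x) (- b) \<partial>M)
    \<le> ennreal (2 * geom_const (b - 1)) * epow T (1 - b)"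
proof (cases T rule: ennreal_cases_epow)
  case zero
  then show ?thesis using b geom_const_pos[of "b - 1"] by (simp add: epow_zero_neg ennreal_mult_top)
next
  case top
  then have "(\<integral>\<^sup>+x\<in>{x \<in> space M. T \<le> N x}. epow (N x) (- b) \<partial>M) = (\<integral>\<^sup>+x. 0 \<partial>M)"
    using b by (intro nn_integral_cong) (auto simp: indicator_def top_unique epow_top_neg)
  then show ?thesis by simp
next
  case (pos t)
  note [measurable] = dist_leD(1)[OF d]
  let ?c = "\<lambda>n::nat. t * 2 powr (real n)"
  have "(\<integral>\<^sup>+x\<in>{x \<in> space M. T \<le> N x}. epow (N x) (- b) \<partial>M)
    \<le> (\<integral>\<^sup>+x. (\<Sum>n. ennreal (?c n powr (- b)) * indicator {x \<in> space M. N x \<le> ennreal (?c (n + 1))} x) \<partial>M)"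
  proof (intro nn_integral_mono)
    fix x assume x: "x \<in> space M"
    show "epow (N x) (- b) * indicator {x \<in> space M. T \<le> N x} x
      \<le> (\<Sum>n. ennreal (?c n powr (- b)) * indicator {x \<in> space M. N x \<le> ennreal (?c (n + 1))} x)"
    proof (cases "T \<le> N x \<and> N x < top")
      case True
      then obtain z where z: "0 < z" "N x = ennreal z" "t \<le> z"
        using pos by (cases "N x" rule: ennreal_cases_epow) auto
      obtain n :: nat where n: "2 ^ n \<le> z / t" "z / t < 2 ^ (n + 1)"
        using ex_dyadic[of "z / t"] z pos by auto
      have n1: "z \<le> ?c (n + 1)" and n2: "?c n \<le> z"
        using n z pos by (auto simp: powr_realpow powr_add field_simps)
      have "epow (N x) (- b) * indicator {x \<in> space M. T \<le> N x} x
        \<le> ennreal (?c n powr (- b)) * indicator {x \<in> space M. N x \<le> ennreal (?c (n + 1))} x"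
        using True z n1 n2 pos b x by (auto simp: epow_ennreal indicator_def intro!: ennreal_leI powr_mono2')
      also have "\<dots> \<le> (\<Sum>n. ennreal (?c n powr (- b)) * indicator {x \<in> space M. N x \<le> ennreal (?c (n + 1))} x)"
        by (rule le_suminf_ennreal[where f = "\<lambda>n. ennreal (?c n powr (- b)) * indicator {x \<in> space M. N x \<le> ennreal (?c (n + 1))} x"])
      finally show ?thesis .
    next
      case False
      then show ?thesis using b by (auto simp: indicator_def epow_top_neg less_top[symmetric])
    qed
  qed
  also have "\<dots> = (\<Sum>n. ennreal (?c n powr (- b)) * emeasure M {x \<in> space M. N x \<le> ennreal (?c (n + 1))})"
    by (subst nn_integral_suminf) (auto simp: nn_integral_cmult_indicator)
  also have "\<dots> \<le> (\<Sum>n. ennreal (?c n powr (- b)) * ennreal (?c (n + 1)))"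
    by (intro suminf_le mult_left_mono dist_leD(2)[OF d]) auto
  also have "\<dots> = (\<Sum>n. ennreal (2 * t powr (1 - b)) * ennreal (2 powr (- (b - 1) * real n)))"
  proof (intro suminf_cong)
    fix n
    have "?c n powr (- b) * ?c (n + 1) = 2 * t powr (1 - b) * 2 powr (- (b - 1) * real n)"
    proof -
      have 1: "?c n powr (- b) = t powr (- b) * 2 powr (- real n * b)"
        using pos by (simp add: powr_mult powr_powr algebra_simps)
      have 2: "t powr (- b) * t = t powr (1 - b)"
        using pos powr_mult_base[of t "- b"] by (simp add: mult.commute)
      have 3: "2 powr (- real n * b) * 2 powr (real (n + 1)) = 2 * 2 powr (- (b - 1) * real n)"
        using powr_mult_base[of 2 "- (b - 1) * real n"]
        by (simp add: powr_add[symmetric] algebra_simps)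
      have eq: "a * x * (t * y) = (a * t) * (x * y)" for a x y :: real
        by simp
      show ?thesis by (subst 1, subst eq, subst 2, subst 3) (simp only: ac_simps)
    qed
    then show "ennreal (?c n powr (- b)) * ennreal (?c (n + 1))
      = ennreal (2 * t powr (1 - b)) * ennreal (2 powr (- (b - 1) * real n))"
      using pos by (simp only: ennreal_mult[symmetric] powr_ge_zero mult_nonneg_nonneg less_imp_le zero_le_numeral)
  qed
  also have "\<dots> = ennreal (2 * t powr (1 - b)) * ennreal (geom_const (b - 1))"
    using b by (subst ennreal_suminf_cmult, subst suminf_geom) auto
  also have "\<dots> = ennreal (2 * geom_const (b - 1)) * epow T (1 - b)"
    using b pos geom_const_pos[of "b - 1"]
    by (simp add: epow_ennreal ennreal_mult[symmetric] mult.assoc mult.commute[of "t powr (1 - b)"])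
  finally show ?thesis .
qed

section \<open>Countable cofinal sets and monotone functions on linear orders\<close>

text \<open>Along an enumeration, every finite union of a chain equals one of its members;
  continuity from below does the rest.\<close>

lemma emeasure_UN_chain_le:
  assumes "countable C" and S: "\<And>x. x \<in> C \<Longrightarrow> S x \<in> sets M" "\<And>x. x \<in> C \<Longrightarrow> emeasure M (S x) \<le> y"
    and chain: "\<And>x z. x \<in> C \<Longrightarrow> z \<in> C \<Longrightarrow> S x \<subseteq> S z \<or> S z \<subseteq> S x"
  shows "emeasure M (\<Union>x\<in>C. S x) \<le> y"
proof (cases "C = {}")
  case False
  define c where "c = from_nat_into C"
  have c: "range c = C" unfolding c_def using False \<open>countable C\<close> by (rule range_from_nat_into)
  have fin: "\<exists>j\<le>n. (\<Union>i\<le>n. S (c i)) = S (c j)" for n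
  proof (induction n)
    case (Suc n)
    then obtain j where j: "j \<le> n" "(\<Union>i\<le>n. S (c i)) = S (c j)" by blast
    have "(\<Union>i\<le>Suc n. S (c i)) = S (c j) \<union> S (c (Suc n))"
      using j by (simp add: atMost_Suc Un_commute)
    moreover have "S (c j) \<subseteq> S (c (Suc n)) \<or> S (c (Suc n)) \<subseteq> S (c j)"
      using c by (intro chain) auto
    ultimately show ?case using j(1) by (metis Un_absorb1 Un_absorb2 le_Suc_eq le_refl)
  qed simp
  have [measurable]: "S (c i) \<in> sets M" for i using S(1) c by auto
  have "(\<Union>x\<in>C. S x) = (\<Union>n. \<Union>i\<le>n. S (c i))" using c by auto
  then have "emeasure M (\<Union>x\<in>C. S x) = (SUP n. emeasure M (\<Union>i\<le>n. S (c i)))"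
    by (simp, intro SUP_emeasure_incseq[symmetric]) (auto simp: incseq_def, meson atMost_iff order_trans)
  also have "\<dots> \<le> y"
  proof (rule SUP_least)
    fix n
    obtain j where "(\<Union>i\<le>n. S (c i)) = S (c j)" using fin[of n] by blast
    then show "emeasure M (\<Union>i\<le>n. S (c i)) \<le> y" using S(2) c by auto
  qed
  finally show ?thesis .
qed simp

text \<open>A maximum is cofinal alone. Without one, the open rays below points of D cover D, and
  Lindelof makes the cover countable.\<close>

lemma ex_countable_cofinal:
  fixes D :: "'a :: {linorder_topology, second_countable_topology} set"
  shows "\<exists>C\<subseteq>D. countable C \<and> D \<subseteq> (\<Union>x\<in>C. {..x})"
proof (cases "\<exists>m\<in>D. \<forall>x\<in>D. x \<le> m")
  case True
  then obtain m where "m \<in> D" "\<forall>x\<in>D. x \<le> m" by blast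
  then show ?thesis by (intro exI[of _ "{m}"]) auto
next
  case False
  have op: "open S" if "S \<in> lessThan ` D" for S using that by auto
  obtain F where F: "F \<subseteq> lessThan ` D" "countable F" "\<Union>F = \<Union>(lessThan ` D)"
    by (rule Lindelof[OF op])
  then obtain C where C: "C \<subseteq> D" "countable C" "F = lessThan ` C"
    by (metis countable_subset_image)
  have "D \<subseteq> \<Union>(lessThan ` D)" using False by (force simp: not_le)
  also have "\<dots> = (\<Union>x\<in>C. {..<x})" using C F by simp
  also have "\<dots> \<subseteq> (\<Union>x\<in>C. {..x})" by (intro UN_mono) auto
  finally show ?thesis using C by blast
qed

lemma ex_countable_coinitial:
  fixes D :: "'a :: {linorder_topology, second_countable_topology} set"
  shows "\<exists>C\<subseteq>D. countable C \<and> D \<subseteq> (\<Union>x\<in>C. {x..})"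
proof (cases "\<exists>m\<in>D. \<forall>x\<in>D. m \<le> x")
  case True
  then obtain m where "m \<in> D" "\<forall>x\<in>D. m \<le> x" by blast
  then show ?thesis by (intro exI[of _ "{m}"]) auto
next
  case False
  have op: "open S" if "S \<in> greaterThan ` D" for S using that by auto
  obtain F where F: "F \<subseteq> greaterThan ` D" "countable F" "\<Union>F = \<Union>(greaterThan ` D)"
    by (rule Lindelof[OF op])
  then obtain C where C: "C \<subseteq> D" "countable C" "F = greaterThan ` C"
    by (metis countable_subset_image)
  have "D \<subseteq> \<Union>(greaterThan ` D)" using False by (force simp: not_le)
  also have "\<dots> = (\<Union>x\<in>C. {x<..})" using C F by simp
  also have "\<dots> \<subseteq> (\<Union>x\<in>C. {x..})" by (intro UN_mono) auto
  finally show ?thesis using C by blast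
qed

text \<open>A downset is the union of the closed rays at a countable cofinal subset. This yields
  measurability of monotone functions on the reals and on the integers at once.\<close>

lemma downset_borel:
  fixes D :: "'a :: {linorder_topology, second_countable_topology} set"
  assumes "\<And>x y. x \<in> D \<Longrightarrow> y \<le> x \<Longrightarrow> y \<in> D"
  shows "D \<in> sets borel"
proof -
  obtain C where C: "C \<subseteq> D" "countable C" "D \<subseteq> (\<Union>x\<in>C. {..x})"
    using ex_countable_cofinal[of D] by blast
  then have "D = (\<Union>x\<in>C. {..x})" using assms by auto
  moreover have "(\<Union>x\<in>C. {..x}) \<in> sets borel"
    using C by (intro sets.countable_UN') auto
  ultimately show ?thesis by simp
qed

lemma mono_borel_measurable:
  fixes f :: "'a :: {linorder_topology, second_countable_topology} \<Rightarrow> ennreal"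
  assumes "mono f"
  shows "f \<in> borel_measurable borel"
proof (rule borel_measurableI_le)
  show "{x \<in> space borel. f x \<le> y} \<in> sets borel" for y
    by (rule downset_borel) (use assms in \<open>auto simp: mono_def intro: order_trans\<close>)
qed

lemma antimono_borel_measurable:
  fixes f :: "'a :: {linorder_topology, second_countable_topology} \<Rightarrow> ennreal"
  assumes "antimono f"
  shows "f \<in> borel_measurable borel"
proof (rule borel_measurableI_ge)
  show "{x \<in> space borel. y \<le> f x} \<in> sets borel" for y
    by (rule downset_borel) (use assms in \<open>auto simp: antimono_def intro: order_trans\<close>)
qed

lemma space_UNIV_of_borel: "sets borel \<subseteq> sets M \<Longrightarrow> space M = UNIV"
  using sets.top[of borel] sets.sets_into_space[of UNIV M] by (auto simp: subset_iff)

lemma borel_measurable_subalgebra':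
  assumes "f \<in> borel_measurable borel" "sets borel \<subseteq> sets M"
  shows "f \<in> borel_measurable M"
  using assms space_UNIV_of_borel[OF assms(2)] by (auto simp: measurable_def)

text \<open>The sublevel set is a downset, hence a countable union of nested rays, and each of these
  has mass at most y because its endpoint lies in the sublevel set.\<close>

lemma dist_le_atMost:
  fixes M :: "'a :: {linorder_topology, second_countable_topology} measure"
  assumes M: "sets borel \<subseteq> sets M"
  shows "dist_le M (\<lambda>x. emeasure M {..x})"
proof -
  have sets: "{..x} \<in> sets M" for x using M by auto
  have mono: "mono (\<lambda>x. emeasure M {..x})"
    by (auto simp: mono_def intro!: emeasure_mono sets)
  have "emeasure M {x \<in> space M. emeasure M {..x} \<le> y} \<le> y" for y
  proof -
    let ?D = "{x \<in> space M. emeasure M {..x} \<le> y}"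
    obtain C where C: "C \<subseteq> ?D" "countable C" "?D \<subseteq> (\<Union>x\<in>C. {..x})"
      using ex_countable_cofinal[of ?D] by blast
    have "emeasure M ?D \<le> emeasure M (\<Union>x\<in>C. {..x})"
      using C by (intro emeasure_mono sets.countable_UN') (auto intro: sets)
    also have "\<dots> \<le> y"
      using C by (intro emeasure_UN_chain_le) (auto intro: sets)
    finally show ?thesis .
  qed
  then show ?thesis
    unfolding dist_le_def
    using borel_measurable_subalgebra'[OF mono_borel_measurable[OF mono] M] by auto
qed

lemma dist_le_atLeast:
  fixes M :: "'a :: {linorder_topology, second_countable_topology} measure"
  assumes M: "sets borel \<subseteq> sets M"
  shows "dist_le M (\<lambda>x. emeasure M {x..})"
proof -
  have sets: "{x..} \<in> sets M" for x using M by auto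
  have mono: "antimono (\<lambda>x. emeasure M {x..})"
    by (auto simp: antimono_def intro!: emeasure_mono sets)
  have "emeasure M {x \<in> space M. emeasure M {x..} \<le> y} \<le> y" for y
  proof -
    let ?D = "{x \<in> space M. emeasure M {x..} \<le> y}"
    obtain C where C: "C \<subseteq> ?D" "countable C" "?D \<subseteq> (\<Union>x\<in>C. {x..})"
      using ex_countable_coinitial[of ?D] by blast
    have "emeasure M ?D \<le> emeasure M (\<Union>x\<in>C. {x..})"
      using C by (intro emeasure_mono sets.countable_UN') (auto intro: sets)
    also have "\<dots> \<le> y"
      using C by (intro emeasure_UN_chain_le) (auto intro: sets)
    finally show ?thesis .
  qed
  then show ?thesis
    unfolding dist_le_def
    using borel_measurable_subalgebra'[OF antimono_borel_measurable[OF mono] M] by auto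
qed

section \<open>A pair of measures on a linear order\<close>

text \<open>Tonelli for the indicator of a relation. The relation is a parameter because integration
  by parts needs the strict order between \<nu> and \<mu>, while averaging over \<nu> alone needs
  the weak one.\<close>

lemma nn_integral_rel_swap:
  assumes "sigma_finite_measure A" "sigma_finite_measure B"
    and R: "{p \<in> space (A \<Otimes>\<^sub>M B). R (fst p) (snd p)} \<in> sets (A \<Otimes>\<^sub>M B)"
    and [measurable]: "h \<in> borel_measurable A" "k \<in> borel_measurable B"
  shows "(\<integral>\<^sup>+t. k t * (\<integral>\<^sup>+y\<in>{y. R y t}. h y \<partial>A) \<partial>B) = (\<integral>\<^sup>+y. h y * (\<integral>\<^sup>+t\<in>{t. R y t}. k t \<partial>B) \<partial>A)"
proof -
  interpret A: sigma_finite_measure A by fact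
  interpret B: sigma_finite_measure B by fact
  interpret pair_sigma_finite A B ..
  let ?S = "{p \<in> space (A \<Otimes>\<^sub>M B). R (fst p) (snd p)}"
  note [measurable] = R
  have m: "(\<lambda>p. h (fst p) * k (snd p) * indicator ?S p) \<in> borel_measurable (A \<Otimes>\<^sub>M B)"
    by measurable
  have "(\<integral>\<^sup>+t. k t * (\<integral>\<^sup>+y\<in>{y. R y t}. h y \<partial>A) \<partial>B) = (\<integral>\<^sup>+t. (\<integral>\<^sup>+y. h y * k t * indicator ?S (y, t) \<partial>A) \<partial>B)"
  proof (intro nn_integral_cong)
    fix t assume t: "t \<in> space B"
    have "(\<integral>\<^sup>+y\<in>{y. R y t}. h y \<partial>A) = (\<integral>\<^sup>+y. h y * indicator ?S (y, t) \<partial>A)"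
      using t by (intro nn_integral_cong) (auto simp: indicator_def space_pair_measure)
    moreover have "(\<lambda>y. h y * indicator ?S (y, t)) \<in> borel_measurable A"
      using t by measurable
    ultimately show "k t * (\<integral>\<^sup>+y\<in>{y. R y t}. h y \<partial>A) = (\<integral>\<^sup>+y. h y * k t * indicator ?S (y, t) \<partial>A)"
      by (simp add: nn_integral_cmult[symmetric] ac_simps)
  qed
  also have "\<dots> = (\<integral>\<^sup>+y. (\<integral>\<^sup>+t. h y * k t * indicator ?S (y, t) \<partial>B) \<partial>A)"
    using Fubini'[of "\<lambda>y t. h y * k t * indicator ?S (y, t)"] m by (simp add: case_prod_unfold)
  also have "\<dots> = (\<integral>\<^sup>+y. h y * (\<integral>\<^sup>+t\<in>{t. R y t}. k t \<partial>B) \<partial>A)"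
  proof (intro nn_integral_cong)
    fix y assume y: "y \<in> space A"
    have "(\<integral>\<^sup>+t\<in>{t. R y t}. k t \<partial>B) = (\<integral>\<^sup>+t. k t * indicator ?S (y, t) \<partial>B)"
      using y by (intro nn_integral_cong) (auto simp: indicator_def space_pair_measure)
    moreover have "(\<lambda>t. k t * indicator ?S (y, t)) \<in> borel_measurable B"
      using y by measurable
    ultimately show "(\<integral>\<^sup>+t. h y * k t * indicator ?S (y, t) \<partial>B) = h y * (\<integral>\<^sup>+t\<in>{t. R y t}. k t \<partial>B)"
      by (simp add: nn_integral_cmult[symmetric] ac_simps)
  qed
  finally show ?thesis .
qed

text \<open>Borel sets are only required to be contained in the common \<sigma>-algebra: this admits
  the Lebesgue measurable sets as well as all subsets of the integers.\<close>

locale measure_pair =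
  fixes \<mu> \<nu> :: "'a :: {linorder_topology, second_countable_topology} measure"
  assumes sf_\<mu>: "sigma_finite_measure \<mu>" and sf_\<nu>: "sigma_finite_measure \<nu>"
    and sets_eq: "sets \<mu> = sets \<nu>" and borel: "sets borel \<subseteq> sets \<nu>"
begin

text \<open>c and o stand for closed and open rays. The difference matters at atoms: closed rays
  satisfy \<open>dist_le\<close>, while the Hardy operator and its adjoint produce open
  ones.\<close>

definition "Nc y = emeasure \<nu> {..y}"
definition "No t = emeasure \<nu> {..<t}"
definition "Uc t = emeasure \<mu> {t..}"
definition "Uo y = emeasure \<mu> {y<..}"

text \<open>The Maz'ya--Rozin functional. For k = \<kappa> and th =
  \<kappa>(1-\<rho>)/(\<rho>(1-\<kappa>)) its (1-\<kappa>)-th power is comparable with the best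
  constant K of the two-measure inequality.\<close>

definition hardy_char :: "real \<Rightarrow> real \<Rightarrow> ennreal" where
  "hardy_char k th = (\<integral>\<^sup>+t. epow (Uc t) (k / (1 - k)) * epow (No t) th \<partial>\<mu>)"

lemma borel': "sets borel \<subseteq> sets \<mu>" using borel sets_eq by simp

lemma space_pair [simp]: "space \<mu> = UNIV" "space \<nu> = UNIV"
  using space_UNIV_of_borel[OF borel] space_UNIV_of_borel[OF borel'] by auto

lemma UNIV_sets [simp, measurable]: "UNIV \<in> sets \<mu>" "UNIV \<in> sets \<nu>"
  using sets.top[of \<mu>] sets.top[of \<nu>] by auto

lemma borel_in_sets: 
  "A \<in> sets borel \<Longrightarrow> A \<in> sets \<mu>" "A \<in> sets borel \<Longrightarrow> A \<in> sets \<nu>"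
  using borel borel' by auto

lemma sets_Iic [measurable, simp]: 
  "{..y} \<in> sets \<nu>" "{..<y} \<in> sets \<nu>" "{y..} \<in> sets \<nu>" "{y<..} \<in> sets \<nu>"
  "{..y} \<in> sets \<mu>" "{..<y} \<in> sets \<mu>" "{y..} \<in> sets \<mu>" "{y<..} \<in> sets \<mu>"
  by (auto intro!: borel_in_sets)

lemma measurable_change:
  "f \<in> borel_measurable \<nu> \<Longrightarrow> f \<in> borel_measurable \<mu>"
  by (simp add: measurable_cong_sets[OF sets_eq refl])

lemma measurable_mono: "mono f \<Longrightarrow> f \<in> borel_measurable \<nu>" for f :: "'a \<Rightarrow> ennreal"
  by (intro borel_measurable_subalgebra'[OF mono_borel_measurable borel])

lemma measurable_antimono: "antimono f \<Longrightarrow> f \<in> borel_measurable \<nu>" for f :: "'a \<Rightarrow> ennreal"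
  by (intro borel_measurable_subalgebra'[OF antimono_borel_measurable borel])

lemma mono_Nc: "mono Nc" and mono_No: "mono No" and antimono_Uc: "antimono Uc" and antimono_Uo: "antimono Uo"
  by (auto simp: mono_def antimono_def Nc_def No_def Uc_def Uo_def intro!: emeasure_mono)

lemma measurable_NU [measurable]:
  "Nc \<in> borel_measurable \<nu>" "No \<in> borel_measurable \<nu>" "Uc \<in> borel_measurable \<nu>" "Uo \<in> borel_measurable \<nu>"
  "Nc \<in> borel_measurable \<mu>" "No \<in> borel_measurable \<mu>" "Uc \<in> borel_measurable \<mu>" "Uo \<in> borel_measurable \<mu>"
  using measurable_mono[OF mono_Nc] measurable_mono[OF mono_No]
    measurable_antimono[OF antimono_Uc] measurable_antimono[OF antimono_Uo]
  by (auto intro: measurable_change)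

lemma dist_le_Nc: "dist_le \<nu> Nc" unfolding Nc_def[abs_def] by (rule dist_le_atMost[OF borel])
lemma dist_le_Uc: "dist_le \<mu> Uc" unfolding Uc_def[abs_def] by (rule dist_le_atLeast[OF borel'])

lemma id_measurable: "(\<lambda>x. x) \<in> borel_measurable \<nu>" "(\<lambda>x. x) \<in> borel_measurable \<mu>"
  using borel borel' by (auto simp: measurable_def)

lemma swap_less:
  assumes "h \<in> borel_measurable \<nu>" "k \<in> borel_measurable \<mu>"
  shows "(\<integral>\<^sup>+t. k t * (\<integral>\<^sup>+y\<in>{..<t}. h y \<partial>\<nu>) \<partial>\<mu>) = (\<integral>\<^sup>+y. h y * (\<integral>\<^sup>+t\<in>{y<..}. k t \<partial>\<mu>) \<partial>\<nu>)"
proof -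
  have "fst \<in> borel_measurable (\<nu> \<Otimes>\<^sub>M \<mu>)" "snd \<in> borel_measurable (\<nu> \<Otimes>\<^sub>M \<mu>)"
    using measurable_compose[OF measurable_fst id_measurable(1)] measurable_compose[OF measurable_snd id_measurable(2)] by auto
  from borel_measurable_less[OF this] show ?thesis
    using nn_integral_rel_swap[OF sf_\<nu> sf_\<mu> _ assms, of "(<)"]
    by (simp add: lessThan_def greaterThan_def)
qed

lemma swap_le:
  assumes "h \<in> borel_measurable \<nu>" "k \<in> borel_measurable \<nu>"
  shows "(\<integral>\<^sup>+t. k t * (\<integral>\<^sup>+y\<in>{..t}. h y \<partial>\<nu>) \<partial>\<nu>) = (\<integral>\<^sup>+y. h y * (\<integral>\<^sup>+t\<in>{y..}. k t \<partial>\<nu>) \<partial>\<nu>)"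
proof -
  have "fst \<in> borel_measurable (\<nu> \<Otimes>\<^sub>M \<nu>)" "snd \<in> borel_measurable (\<nu> \<Otimes>\<^sub>M \<nu>)"
    using measurable_compose[OF measurable_fst id_measurable(1)] measurable_compose[OF measurable_snd id_measurable(1)] by auto
  from borel_measurable_le[OF this] show ?thesis
    using nn_integral_rel_swap[OF sf_\<nu> sf_\<nu> _ assms, of "(\<le>)"]
    by (simp add: atMost_def atLeast_def)
qed

lemma measurable_int_atMost [measurable]:
  "(\<lambda>t. \<integral>\<^sup>+y\<in>{..t}. h y \<partial>\<nu>) \<in> borel_measurable \<nu>"
  by (intro measurable_mono) (auto simp: mono_def intro!: nn_integral_mono split: split_indicator)

lemma measurable_int_lessThan [measurable]:
  "(\<lambda>t. \<integral>\<^sup>+y\<in>{..<t}. h y \<partial>\<nu>) \<in> borel_measurable \<nu>"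
  by (intro measurable_mono) (auto simp: mono_def intro!: nn_integral_mono split: split_indicator)

lemma measurable_int_greaterThan [measurable]:
  "(\<lambda>y. \<integral>\<^sup>+t\<in>{y<..}. k t \<partial>\<mu>) \<in> borel_measurable \<nu>"
  by (intro measurable_antimono) (auto simp: antimono_def intro!: nn_integral_mono split: split_indicator)

text \<open>Under the measure h d\<nu> the running integral of h is itself the closed tail function,
  so \<open>dist_le_power\<close> applies and takes the place of integrating d(H^e).\<close>

lemma power_lessThan:
  assumes [measurable]: "h \<in> borel_measurable \<nu>" and e: "1 \<le> e"
  shows "epow (\<integral>\<^sup>+y\<in>{..<t}. h y \<partial>\<nu>) e
    \<le> ennreal (2 powr e) * (\<integral>\<^sup>+y\<in>{..<t}. h y * epow (\<integral>\<^sup>+z\<in>{..y}. h z \<partial>\<nu>) (e - 1) \<partial>\<nu>)"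
proof -
  let ?M = "density \<nu> h"
  have b: "sets borel \<subseteq> sets ?M" using borel by simp
  have m: "emeasure ?M {..y} = (\<integral>\<^sup>+z\<in>{..y}. h z \<partial>\<nu>)" for y
    by (simp add: emeasure_density)
  have [measurable]: "(\<lambda>y. \<integral>\<^sup>+z\<in>{..y}. h z \<partial>\<nu>) \<in> borel_measurable \<nu>"
    by (rule measurable_int_atMost)
  have "epow (emeasure ?M {..<t}) (e - 1 + 1)
    \<le> ennreal (2 powr (e - 1 + 1)) * (\<integral>\<^sup>+y\<in>{..<t}. epow (emeasure ?M {..y}) (e - 1) \<partial>?M)"
    using e by (intro dist_le_power[OF dist_le_atMost[OF b]]) auto
  also have "(\<integral>\<^sup>+y\<in>{..<t}. epow (emeasure ?M {..y}) (e - 1) \<partial>?M)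
    = (\<integral>\<^sup>+y. h y * (epow (\<integral>\<^sup>+z\<in>{..y}. h z \<partial>\<nu>) (e - 1) * indicator {..<t} y) \<partial>\<nu>)"
    unfolding m by (rule nn_integral_density) measurable
  also have "emeasure ?M {..<t} = (\<integral>\<^sup>+y\<in>{..<t}. h y \<partial>\<nu>)"
    by (simp add: emeasure_density)
  finally show ?thesis by (simp add: mult.assoc)
qed

text \<open>Integration by parts: \<open>dist_le_power\<close> for \<mu> opens up the power of
  \<open>Uo\<close>, and exchanging the integrals turns an integral against \<nu> into the
  functional, the exponent of \<nu> being raised by one.\<close>

lemma hardy_char_Fubini:
  assumes k: "0 < k" "k < 1" and b: "0 \<le> b"
  shows "(\<integral>\<^sup>+y. epow (Uo y) (1 / (1 - k)) * epow (Nc y) b \<partial>\<nu>) \<le> ennreal (2 powr (1 / (1 - k))) * hardy_char k (b + 1)"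
proof -
  let ?e = "k / (1 - k)"
  have e: "0 \<le> ?e" "1 / (1 - k) = ?e + 1" using k by (auto simp: field_simps)
  let ?G = "\<lambda>y. \<integral>\<^sup>+t\<in>{y<..}. epow (Uc t) ?e \<partial>\<mu>"
  have [measurable]: "?G \<in> borel_measurable \<nu>" by (rule measurable_int_greaterThan)
  have "(\<integral>\<^sup>+y. epow (Uo y) (1 / (1 - k)) * epow (Nc y) b \<partial>\<nu>)
    \<le> (\<integral>\<^sup>+y. (ennreal (2 powr (?e + 1)) * ?G y) * epow (Nc y) b \<partial>\<nu>)"
    using e dist_le_power[OF dist_le_Uc, of ?e] unfolding Uo_def
    by (intro nn_integral_mono mult_right_mono) auto
  also have "\<dots> = ennreal (2 powr (?e + 1)) * (\<integral>\<^sup>+y. epow (Nc y) b * ?G y \<partial>\<nu>)"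
    by (simp add: nn_integral_cmult mult.assoc mult.commute[of "?G _"])
  also have "(\<integral>\<^sup>+y. epow (Nc y) b * ?G y \<partial>\<nu>)
    = (\<integral>\<^sup>+t. epow (Uc t) ?e * (\<integral>\<^sup>+y\<in>{..<t}. epow (Nc y) b \<partial>\<nu>) \<partial>\<mu>)"
    by (rule swap_less[symmetric]) auto
  also have "\<dots> \<le> hardy_char k (b + 1)"
    unfolding hardy_char_def
  proof (intro nn_integral_mono mult_left_mono)
    fix t
    \<comment> \<open>For y < t the closed ray at y lies in the open ray at t, so passing from
      \<open>Nc\<close> to \<open>No\<close> costs nothing even at atoms.\<close>
    have "(\<integral>\<^sup>+y\<in>{..<t}. epow (Nc y) b \<partial>\<nu>) \<le> (\<integral>\<^sup>+y\<in>{..<t}. epow (No t) b \<partial>\<nu>)"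
      unfolding Nc_def No_def using b
      by (intro nn_integral_mono) (auto split: split_indicator intro!: epow_mono emeasure_mono)
    also have "\<dots> = epow (No t) (b + 1)"
      using b by (simp add: nn_integral_cmult_indicator epow_add No_def)
    finally show "(\<integral>\<^sup>+y\<in>{..<t}. epow (Nc y) b \<partial>\<nu>) \<le> epow (No t) (b + 1)" .
  qed auto
  finally show ?thesis using e by (simp add: mult_left_mono)
qed

end

section \<open>The weighted Hardy inequality for two measures\<close>

text \<open>The factors stem, in order, from \<open>power_lessThan\<close>, from the bound on the
  running integral \<open>H\<close>, from the integral of the second Hoelder factor, and from
  \<open>hardy_char_Fubini\<close>, whose constant leaves 2 after taking the power
  1-\<kappa>.\<close>

definition hardy_const :: "real \<Rightarrow> real \<Rightarrow> real" where
  "hardy_const \<rho> \<kappa> = 2 powr (\<kappa> / \<rho>) * (2 powr (1/2) * geom_const (1/2)) powr ((1 - \<rho>) * (\<kappa> / \<rho> - 1))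
     * (2 * geom_const ((1 - \<rho>) / (2 * \<rho>))) powr (\<kappa> - \<rho>) * 2"

lemma hardy_const_pos: "0 < \<rho> \<Longrightarrow> \<rho> < 1 \<Longrightarrow> 0 < hardy_const \<rho> \<kappa>"
  using geom_const_pos[of "(1 - \<rho>) / (2 * \<rho>)"] geom_const_pos[of "1 / 2"]
  unfolding hardy_const_def by (intro mult_pos_pos) auto

context measure_pair
begin

text \<open>\<open>G\<^sup>\<kappa>\<^sup>/\<^sup>\<rho>\<close>, for \<open>G(t) = \<integral>\<^bsub>y<t\<^esub> g\<^sup>\<rho> d\<nu>\<close>, is integrated by parts, one factor \<open>g\<^sup>\<rho>\<close> being kept. The remaining power
  of \<open>G\<close> is bounded by \<open>G \<le> c X\<^sup>\<rho> \<nu>{..y}\<^sup>(\<^sup>1\<^sup>-\<^sup>\<rho>\<^sup>)\<^sup>/\<^sup>2\<close> with \<open>X(y) = \<integral>\<^bsub>z\<le>y\<^esub> g \<nu>{..z}\<^sup>\<epsilon> d\<nu>\<close>; the choice of \<open>\<epsilon>\<close> makes the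
  complementary weight \<open>\<nu>{..z}\<^sup>-\<^sup>1\<^sup>/\<^sup>2\<close>, which is integrable near 0. The three-term Hoelder inequality with exponents \<open>1/\<rho>\<close>,
  \<open>1/(\<kappa>-\<rho>)\<close>, \<open>1/(1-\<kappa>)\<close> finishes.\<close>

lemma hardy_sufficient:
  assumes \<rho>: "0 < \<rho>" "\<rho> \<le> \<kappa>" "\<kappa> < 1" and g [measurable]: "g \<in> borel_measurable \<nu>"
    and th: "\<theta> = \<kappa> * (1 - \<rho>) / (\<rho> * (1 - \<kappa>))"
  shows "(\<integral>\<^sup>+t. epow (\<integral>\<^sup>+y\<in>{..<t}. epow (g y) \<rho> \<partial>\<nu>) (\<kappa> / \<rho>) \<partial>\<mu>)
    \<le> ennreal (hardy_const \<rho> \<kappa>) * epow (\<integral>\<^sup>+y. g y \<partial>\<nu>) \<kappa> * epow (hardy_char \<kappa> \<theta>) (1 - \<kappa>)"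
proof -
  let ?LHS = "\<integral>\<^sup>+t. epow (\<integral>\<^sup>+y\<in>{..<t}. epow (g y) \<rho> \<partial>\<nu>) (\<kappa> / \<rho>) \<partial>\<mu>"
  define E where "E = hardy_char \<kappa> \<theta>"
  define G where "G = (\<integral>\<^sup>+y. g y \<partial>\<nu>)"
  define \<epsilon> where "\<epsilon> = (1 - \<rho>) / (2 * \<rho>)"
  \<comment> \<open>This is \<theta>-1, the exponent of \<nu> that remains once the functional has
    been integrated by parts.\<close>
  define \<beta> where "\<beta> = (\<kappa> - \<rho>) / (\<rho> * (1 - \<kappa>))"
  have \<rho>1: "\<rho> < 1" using \<rho> by simp
  have \<epsilon>: "0 < \<epsilon>" and \<beta>: "0 \<le> \<beta>" using \<rho> by (auto simp: \<epsilon>_def \<beta>_def)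
  have \<theta>: "\<theta> = \<beta> + 1" using \<rho> by (simp add: th \<beta>_def field_simps)
  have \<theta>0: "0 < \<theta>" using \<beta> \<theta> by simp
  have const0: "0 < hardy_const \<rho> \<kappa>"
    by (rule hardy_const_pos[OF \<rho>(1) \<rho>1])
  show ?thesis
  \<comment> \<open>For G = 0 the right side is 0 even if the functional is infinite, so the left
    side has to be shown to vanish.\<close>
  proof (cases "G = 0 \<or> E = top")
    case True
    show ?thesis
    proof (cases "G = 0")
      case True
      then have "AE y in \<nu>. g y = 0" unfolding G_def by (simp add: nn_integral_0_iff_AE)
      then have "(\<integral>\<^sup>+y\<in>{..<t}. epow (g y) \<rho> \<partial>\<nu>) = 0" for t
        using \<rho> by (subst nn_integral_0_iff_AE) (auto simp: epow_zero elim!: eventually_mono)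
      then have "?LHS = 0" using \<rho> by (simp add: epow_zero)
      then show ?thesis by simp
    next
      case False
      with True have "E = top" by simp
      then show ?thesis
        using False \<rho> const0 unfolding G_def[symmetric] E_def[symmetric]
        by (simp add: epow_top ennreal_mult_top epow_eq_0_iff)
    qed
  next
    case False
    then have E: "E < top" by (simp add: less_top)
    let ?h = "\<lambda>y. epow (g y) \<rho>"
    define H where "H y = (\<integral>\<^sup>+z\<in>{..y}. epow (g z) \<rho> \<partial>\<nu>)" for y
    define X where "X y = (\<integral>\<^sup>+z\<in>{..y}. g z * epow (Nc z) \<epsilon> \<partial>\<nu>)" for y
    have [measurable]: "H \<in> borel_measurable \<nu>" "X \<in> borel_measurable \<nu>"
      unfolding H_def X_def by (rule measurable_int_atMost)+
    define C1 where "C1 = 2 powr (\<kappa> / \<rho>)"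
    define C2 where "C2 = 2 powr (1/2) * geom_const (1/2)"
    define C3 where "C3 = 2 * geom_const \<epsilon>"
    define e where "e = \<kappa> / \<rho> - 1"
    have e: "0 \<le> e" and \<rho>e: "\<rho> * e = \<kappa> - \<rho>" using \<rho> by (simp_all add: e_def field_simps)
    have C: "0 < C1" "0 < C2" "0 < C3" using \<epsilon> by (simp_all add: C1_def C2_def C3_def geom_const_pos)

    have "?LHS \<le> (\<integral>\<^sup>+t. ennreal C1 * (\<integral>\<^sup>+y\<in>{..<t}. ?h y * epow (H y) e \<partial>\<nu>) \<partial>\<mu>)"
      unfolding H_def C1_def e_def using \<rho> by (intro nn_integral_mono power_lessThan) auto
    also have "\<dots> = ennreal C1 * (\<integral>\<^sup>+t. 1 * (\<integral>\<^sup>+y\<in>{..<t}. ?h y * epow (H y) e \<partial>\<nu>) \<partial>\<mu>)"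
      by (subst nn_integral_cmult) (auto intro: measurable_change[OF measurable_int_lessThan])
    also have "(\<integral>\<^sup>+t. 1 * (\<integral>\<^sup>+y\<in>{..<t}. ?h y * epow (H y) e \<partial>\<nu>) \<partial>\<mu>)
      = (\<integral>\<^sup>+y. ?h y * epow (H y) e * (\<integral>\<^sup>+t\<in>{y<..}. 1 \<partial>\<mu>) \<partial>\<nu>)"
      by (rule swap_less) auto
    also have "\<dots> = (\<integral>\<^sup>+y. ?h y * epow (H y) e * Uo y \<partial>\<nu>)"
      by (simp add: Uo_def)
    finally have A: "?LHS \<le> ennreal C1 * (\<integral>\<^sup>+y. ?h y * epow (H y) e * Uo y \<partial>\<nu>)" .

    have null: "AE y in \<nu>. Nc y \<noteq> 0"
      by (rule dist_le_AE[OF dist_le_Nc])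
    \<comment> \<open>A finite functional forbids \<mu>-mass to the right of a point with infinite
      \<nu>{..y}. Such points drop out through the factor \<open>Uo\<close>; elsewhere powers of
      \<open>Nc\<close> of either sign may be combined.\<close>
    have Uo0: "Uo y = 0" if "Nc y = top" for y
    proof -
      have "AE t in \<mu>. epow (Uc t) (\<kappa> / (1 - \<kappa>)) * epow (No t) \<theta> \<noteq> \<infinity>"
        using E unfolding E_def hardy_char_def
        by (intro nn_integral_PInf_AE) (auto simp: less_top)
      moreover have "AE t in \<mu>. Uc t \<noteq> 0"
        by (rule dist_le_AE[OF dist_le_Uc])
      ultimately have "AE t in \<mu>. t \<notin> {y<..}"
      proof eventually_elim
        case (elim t)
        show ?case
        proof
          assume "t \<in> {y<..}"
          then have "Nc y \<le> No t" unfolding Nc_def No_def by (intro emeasure_mono) auto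
          then have "No t = top" using that by (simp add: top_unique)
          moreover have "epow (Uc t) (\<kappa> / (1 - \<kappa>)) \<noteq> 0"
            using elim \<rho> by (subst epow_eq_0_iff) auto
          ultimately show False
            using elim \<theta>0 by (simp add: epow_top ennreal_mult_top)
        qed
      qed
      then show ?thesis unfolding Uo_def by (subst (asm) AE_iff_measurable[of "{y<..}"]) auto
    qed

    have H_le: "H y \<le> epow (X y) \<rho> * epow (ennreal C2 * epow (Nc y) (1/2)) (1 - \<rho>)" if "Nc y < top" for y
    proof -
      let ?ex = "- (1 / 2 :: real)"
      have "H y = (\<integral>\<^sup>+z. epow (g z * epow (Nc z) \<epsilon> * indicator {..y} z) \<rho>
          * epow (epow (Nc z) ?ex * indicator {x \<in> space \<nu>. Nc x \<le> Nc y} z) (1 - \<rho>) \<partial>\<nu>)"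
        unfolding H_def
      proof (intro nn_integral_cong_AE, use null in \<open>rule eventually_mono\<close>)
        fix z assume z: "Nc z \<noteq> 0"
        show "epow (g z) \<rho> * indicator {..y} z = epow (g z * epow (Nc z) \<epsilon> * indicator {..y} z) \<rho>
          * epow (epow (Nc z) ?ex * indicator {x \<in> space \<nu>. Nc x \<le> Nc y} z) (1 - \<rho>)"
        proof (cases "z \<le> y")
          case True
          then have le: "Nc z \<le> Nc y" using mono_Nc by (simp add: mono_def)
          then have fin: "0 < Nc z" "Nc z < top" using z that by (auto simp: zero_less_iff_neq_zero)
          have "epow (epow (Nc z) \<epsilon>) \<rho> * epow (epow (Nc z) ?ex) (1 - \<rho>) = epow (Nc z) (\<epsilon> * \<rho> + ?ex * (1 - \<rho>))"
            by (simp only: epow_epow epow_add'[OF fin])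
          also have "\<epsilon> * \<rho> + ?ex * (1 - \<rho>) = 0" using \<rho> by (simp add: \<epsilon>_def field_simps)
          finally have eq1: "epow (epow (Nc z) \<epsilon>) \<rho> * epow (epow (Nc z) ?ex) (1 - \<rho>) = 1" by simp
          then show ?thesis
            using True le \<rho> by (simp add: epow_mult mult.assoc eq1)
        qed (use \<rho> in \<open>simp add: epow_zero\<close>)
      qed
      also have "\<dots> \<le> epow (\<integral>\<^sup>+z. g z * epow (Nc z) \<epsilon> * indicator {..y} z \<partial>\<nu>) \<rho>
          * epow (\<integral>\<^sup>+z. epow (Nc z) ?ex * indicator {x \<in> space \<nu>. Nc x \<le> Nc y} z \<partial>\<nu>) (1 - \<rho>)"
        using \<rho> by (intro nn_integral_Holder) auto
      also have "\<dots> \<le> epow (X y) \<rho> * epow (ennreal C2 * epow (Nc y) (1/2)) (1 - \<rho>)"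
        unfolding X_def C2_def using dist_le_singular_le[OF dist_le_Nc, of "1/2" "Nc y"] that \<rho>1
        by (intro mult_left_mono epow_mono) auto
      finally show ?thesis .
    qed

    define C4 where "C4 = C2 powr ((1 - \<rho>) * e)"
    \<comment> \<open>The powers of \<open>Nc\<close> are dictated by integrability:
      \<open>?Y\<close> integrates to at most a multiple of G, \<open>?Z\<close> to at most a
      multiple of the functional. Under the weights \<kappa>-\<rho> and 1-\<kappa> they combine to
      the power (1-\<rho>)e/2 that \<open>H_le\<close> supplies.\<close>
    let ?Y = "\<lambda>y. X y * epow (Nc y) (- 1 - \<epsilon>)"
    let ?Z = "\<lambda>y. epow (Uo y) (1 / (1 - \<kappa>)) * epow (Nc y) \<beta>"
    have pt: "?h y * epow (H y) e * Uo y \<le> ennreal C4 * (epow (g y) \<rho> * epow (?Y y) (\<kappa> - \<rho>) * epow (?Z y) (1 - \<rho> - (\<kappa> - \<rho>)))"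
      if "Nc y \<noteq> 0" for y
    proof (cases "Nc y = top")
      case True
      then show ?thesis using Uo0[OF True] by simp
    next
      case False
      then have N: "0 < Nc y" "Nc y < top" using that by (auto simp: zero_less_iff_neq_zero less_top)
      have "epow (H y) e \<le> epow (epow (X y) \<rho> * epow (ennreal C2 * epow (Nc y) (1/2)) (1 - \<rho>)) e"
        using e by (intro epow_mono H_le N)
      also have "\<dots> = epow (X y) (\<kappa> - \<rho>) * (ennreal C4 * epow (Nc y) ((1 - \<rho>) * e / 2))"
        using \<rho> e C by (simp add: epow_mult epow_epow epow_ennreal C4_def powr_powr \<rho>e ac_simps)
      finally have 1: "epow (H y) e \<le> epow (X y) (\<kappa> - \<rho>) * (ennreal C4 * epow (Nc y) ((1 - \<rho>) * e / 2))" .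
      have 2: "epow (?Y y) (\<kappa> - \<rho>) = epow (X y) (\<kappa> - \<rho>) * epow (Nc y) ((- 1 - \<epsilon>) * (\<kappa> - \<rho>))"
        using \<rho> by (simp add: epow_mult epow_epow)
      have 3: "epow (?Z y) (1 - \<rho> - (\<kappa> - \<rho>)) = Uo y * epow (Nc y) (\<beta> * (1 - \<kappa>))"
        using \<rho> by (simp add: epow_mult epow_epow)
      have "(- 1 - \<epsilon>) * (\<kappa> - \<rho>) + \<beta> * (1 - \<kappa>) = (1 - \<rho>) * e / 2"
        using \<rho> by (simp add: \<epsilon>_def \<beta>_def e_def divide_simps) (simp add: algebra_simps)
      then have 4: "epow (Nc y) ((- 1 - \<epsilon>) * (\<kappa> - \<rho>)) * epow (Nc y) (\<beta> * (1 - \<kappa>)) = epow (Nc y) ((1 - \<rho>) * e / 2)"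
        by (simp only: epow_add'[OF N, symmetric])
      have "?h y * epow (H y) e * Uo y \<le> ?h y * (epow (X y) (\<kappa> - \<rho>) * (ennreal C4 * epow (Nc y) ((1 - \<rho>) * e / 2))) * Uo y"
        using 1 by (intro mult_mono) auto
      also have "\<dots> = ennreal C4 * (epow (g y) \<rho> * epow (?Y y) (\<kappa> - \<rho>) * epow (?Z y) (1 - \<rho> - (\<kappa> - \<rho>)))"
        unfolding 2 3 4[symmetric] by (simp only: ac_simps)
      finally show ?thesis .
    qed
    \<comment> \<open>After exchanging the order, the integral of N^(-1-\<epsilon>) over the ray
      from z on is of order N(z)^(-\<epsilon>) and cancels the N^\<epsilon> inside
      \<open>X\<close>.\<close>
    have Y: "(\<integral>\<^sup>+y. ?Y y \<partial>\<nu>) \<le> ennreal C3 * G"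
    proof -
      have "(\<integral>\<^sup>+y. ?Y y \<partial>\<nu>) = (\<integral>\<^sup>+x. epow (Nc x) (- 1 - \<epsilon>) * (\<integral>\<^sup>+z\<in>{..x}. g z * epow (Nc z) \<epsilon> \<partial>\<nu>) \<partial>\<nu>)"
        unfolding X_def by (simp add: mult.commute)
      also have "\<dots> = (\<integral>\<^sup>+z. (g z * epow (Nc z) \<epsilon>) * (\<integral>\<^sup>+x\<in>{z..}. epow (Nc x) (- 1 - \<epsilon>) \<partial>\<nu>) \<partial>\<nu>)"
        by (rule swap_le) auto
      also have "\<dots> \<le> (\<integral>\<^sup>+z. ennreal C3 * g z \<partial>\<nu>)"
      proof (intro nn_integral_mono_AE, use null in \<open>rule eventually_mono\<close>)
        fix z assume "Nc z \<noteq> 0"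
        have "(\<integral>\<^sup>+x\<in>{z..}. epow (Nc x) (- 1 - \<epsilon>) \<partial>\<nu>)
          \<le> (\<integral>\<^sup>+x\<in>{x \<in> space \<nu>. Nc z \<le> Nc x}. epow (Nc x) (- (1 + \<epsilon>)) \<partial>\<nu>)"
          using mono_Nc by (intro nn_integral_mono) (auto simp: mono_def split: split_indicator)
        also have "\<dots> \<le> ennreal C3 * epow (Nc z) (- \<epsilon>)"
          using dist_le_singular_ge[OF dist_le_Nc, of "1 + \<epsilon>" "Nc z"] \<epsilon> by (simp add: C3_def)
        finally have "g z * epow (Nc z) \<epsilon> * (\<integral>\<^sup>+x\<in>{z..}. epow (Nc x) (- 1 - \<epsilon>) \<partial>\<nu>)
          \<le> g z * epow (Nc z) \<epsilon> * (ennreal C3 * epow (Nc z) (- \<epsilon>))"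
          by (intro mult_left_mono) auto
        also have "\<dots> = ennreal C3 * g z * (epow (Nc z) \<epsilon> * epow (Nc z) (- \<epsilon>))"
          by (simp only: ac_simps)
        also have "\<dots> \<le> ennreal C3 * g z * 1"
        proof (intro mult_left_mono)
          show "epow (Nc z) \<epsilon> * epow (Nc z) (- \<epsilon>) \<le> 1"
          proof (cases "Nc z = top")
            case True
            then show ?thesis using \<epsilon> by (simp add: epow_top_neg)
          next
            case False
            then show ?thesis using \<open>Nc z \<noteq> 0\<close> epow_add'[of "Nc z" \<epsilon> "- \<epsilon>"]
              by (simp add: zero_less_iff_neq_zero less_top)
          qed
        qed auto
        finally show "g z * epow (Nc z) \<epsilon> * (\<integral>\<^sup>+x\<in>{z..}. epow (Nc x) (- 1 - \<epsilon>) \<partial>\<nu>) \<le> ennreal C3 * g z"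
          by simp
      qed
      also have "\<dots> = ennreal C3 * G" unfolding G_def by (simp add: nn_integral_cmult)
      finally show ?thesis .
    qed
    have Z: "(\<integral>\<^sup>+y. ?Z y \<partial>\<nu>) \<le> ennreal (2 powr (1 / (1 - \<kappa>))) * E"
      using hardy_char_Fubini[of \<kappa> \<beta>] \<rho> \<beta> by (simp add: E_def \<theta>)
    have "(\<integral>\<^sup>+y. ?h y * epow (H y) e * Uo y \<partial>\<nu>)
      \<le> (\<integral>\<^sup>+y. ennreal C4 * (epow (g y) \<rho> * epow (?Y y) (\<kappa> - \<rho>) * epow (?Z y) (1 - \<rho> - (\<kappa> - \<rho>))) \<partial>\<nu>)"
      using null pt by (intro nn_integral_mono_AE) (auto elim!: eventually_mono)
    also have "\<dots> = ennreal C4 * (\<integral>\<^sup>+y. epow (g y) \<rho> * epow (?Y y) (\<kappa> - \<rho>) * epow (?Z y) (1 - \<rho> - (\<kappa> - \<rho>)) \<partial>\<nu>)"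
      by (rule nn_integral_cmult) measurable
    also have "(\<integral>\<^sup>+y. epow (g y) \<rho> * epow (?Y y) (\<kappa> - \<rho>) * epow (?Z y) (1 - \<rho> - (\<kappa> - \<rho>)) \<partial>\<nu>)
      \<le> epow G \<rho> * epow (\<integral>\<^sup>+y. ?Y y \<partial>\<nu>) (\<kappa> - \<rho>) * epow (\<integral>\<^sup>+y. ?Z y \<partial>\<nu>) (1 - \<rho> - (\<kappa> - \<rho>))"
      unfolding G_def using \<rho> by (intro nn_integral_Holder3) auto
    also have "\<dots> \<le> epow G \<rho> * epow (ennreal C3 * G) (\<kappa> - \<rho>)
        * epow (ennreal (2 powr (1 / (1 - \<kappa>))) * E) (1 - \<rho> - (\<kappa> - \<rho>))"
      using \<rho> Y Z by (intro mult_mono epow_mono) auto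
    also have "\<dots> = ennreal (C3 powr (\<kappa> - \<rho>) * 2) * epow G \<kappa> * epow E (1 - \<kappa>)"
    proof -
      have "epow (ennreal C3 * G) (\<kappa> - \<rho>) = ennreal (C3 powr (\<kappa> - \<rho>)) * epow G (\<kappa> - \<rho>)"
        using C \<rho> by (simp add: epow_mult epow_ennreal)
      moreover have "epow (ennreal (2 powr (1 / (1 - \<kappa>))) * E) (1 - \<rho> - (\<kappa> - \<rho>)) = 2 * epow E (1 - \<kappa>)"
        using \<rho> by (simp add: epow_mult epow_ennreal powr_powr)
      moreover have "epow G \<kappa> = epow G \<rho> * epow G (\<kappa> - \<rho>)"
        using \<rho> epow_add[of \<rho> "\<kappa> - \<rho>" G] by simp
      moreover have "ennreal (C3 powr (\<kappa> - \<rho>) * 2) = ennreal (C3 powr (\<kappa> - \<rho>)) * 2"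
        by (simp add: ennreal_mult)
      ultimately show ?thesis by (simp only: ac_simps)
    qed
    finally have B: "(\<integral>\<^sup>+y. ?h y * epow (H y) e * Uo y \<partial>\<nu>)
      \<le> ennreal C4 * (ennreal (C3 powr (\<kappa> - \<rho>) * 2) * epow G \<kappa> * epow E (1 - \<kappa>))"
      by (simp add: mult_left_mono)
    have "?LHS \<le> ennreal C1 * (ennreal C4 * (ennreal (C3 powr (\<kappa> - \<rho>) * 2) * epow G \<kappa> * epow E (1 - \<kappa>)))"
      by (rule order_trans[OF A]) (intro mult_left_mono B, simp)
    also have "\<dots> = ennreal (C1 * C4 * (C3 powr (\<kappa> - \<rho>) * 2)) * epow G \<kappa> * epow E (1 - \<kappa>)"
      using C by (simp add: ennreal_mult mult.assoc C4_def)
    also have "C1 * C4 * (C3 powr (\<kappa> - \<rho>) * 2) = hardy_const \<rho> \<kappa>"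
      by (simp add: hardy_const_def C1_def C2_def C3_def C4_def e_def \<epsilon>_def)
    finally show ?thesis unfolding G_def E_def .
  qed
qed

text \<open>The test function is the one for which Hoelder's inequality in \<open>hardy_sufficient\<close> is an
  equality up to constants.\<close>

lemma hardy_necessary_finite:
  assumes \<rho>: "0 < \<rho>" "\<rho> \<le> \<kappa>" "\<kappa> < 1" and th: "\<theta> = \<kappa> * (1 - \<rho>) / (\<rho> * (1 - \<kappa>))"
    and fin: "emeasure \<mu> UNIV < top" "emeasure \<nu> UNIV < top"
    and K: "\<And>g. g \<in> borel_measurable \<nu> \<Longrightarrow> (\<integral>\<^sup>+y. g y \<partial>\<nu>) < top \<Longrightarrow>
      (\<integral>\<^sup>+t. epow (\<integral>\<^sup>+y\<in>{..<t}. epow (g y) \<rho> \<partial>\<nu>) (\<kappa> / \<rho>) \<partial>\<mu>) \<le> K * epow (\<integral>\<^sup>+y. g y \<partial>\<nu>) \<kappa>"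
  shows "epow (hardy_char \<kappa> \<theta>) (1 - \<kappa>) \<le> ennreal (2 powr (\<theta> + \<kappa> / (1 - \<kappa>))) * K"
proof -
  define E where "E = hardy_char \<kappa> \<theta>"
  define \<beta> where "\<beta> = (\<kappa> - \<rho>) / (\<rho> * (1 - \<kappa>))"
  have \<beta>: "0 \<le> \<beta>" using \<rho> by (auto simp: \<beta>_def)
  have \<theta>: "\<theta> = \<beta> + 1" using \<rho> by (simp add: th \<beta>_def field_simps)
  have \<theta>': "(\<beta> * \<rho> + 1) * (\<kappa> / \<rho>) = \<theta>"
    using \<rho> by (simp add: th \<beta>_def divide_simps)
  define g where "g y = epow (Uo y) (1 / (1 - \<kappa>)) * epow (Nc y) \<beta>" for y
  have [measurable]: "g \<in> borel_measurable \<nu>" unfolding g_def[abs_def] by measurable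
  \<comment> \<open>Finite total masses make E finite, so that g is admissible in \<open>K\<close>
    and E^\<kappa> can be cancelled at the end.\<close>
  have Efin: "E < top"
  proof -
    have "E \<le> (\<integral>\<^sup>+t. epow (emeasure \<mu> UNIV) (\<kappa> / (1 - \<kappa>)) * epow (emeasure \<nu> UNIV) \<theta> \<partial>\<mu>)"
      unfolding E_def hardy_char_def Uc_def No_def using \<rho> \<beta> \<theta>
      by (intro nn_integral_mono mult_mono epow_mono emeasure_mono) auto
    also have "\<dots> < top"
      using fin \<rho> \<beta> \<theta> by (simp add: ennreal_mult_less_top epow_less_top)
    finally show ?thesis .
  qed
  have G: "(\<integral>\<^sup>+y. g y \<partial>\<nu>) \<le> ennreal (2 powr (1 / (1 - \<kappa>))) * E"
    using hardy_char_Fubini[of \<kappa> \<beta>] \<rho> \<beta> by (simp add: E_def \<theta> g_def)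
  have pt: "epow (Uc t) (\<kappa> / (1 - \<kappa>)) * epow (No t) \<theta>
      \<le> ennreal (2 powr \<theta>) * epow (\<integral>\<^sup>+y\<in>{..<t}. epow (g y) \<rho> \<partial>\<nu>) (\<kappa> / \<rho>)" for t
  proof -
    let ?c = "\<beta> * \<rho> + 1"
    have "epow (Uc t) (\<rho> / (1 - \<kappa>)) * epow (No t) ?c
      \<le> epow (Uc t) (\<rho> / (1 - \<kappa>)) * (ennreal (2 powr ?c) * (\<integral>\<^sup>+y\<in>{..<t}. epow (Nc y) (\<beta> * \<rho>) \<partial>\<nu>))"
      using dist_le_power[OF dist_le_Nc, of "\<beta> * \<rho>" "{..<t}"] \<beta> \<rho>
      by (intro mult_left_mono) (auto simp: No_def)
    also have "\<dots> = ennreal (2 powr ?c) * (\<integral>\<^sup>+y\<in>{..<t}. epow (Uc t) (\<rho> / (1 - \<kappa>)) * epow (Nc y) (\<beta> * \<rho>) \<partial>\<nu>)"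
      by (simp add: nn_integral_cmult mult.assoc) (simp only: mult.left_commute)
    also have "\<dots> \<le> ennreal (2 powr ?c) * (\<integral>\<^sup>+y\<in>{..<t}. epow (g y) \<rho> \<partial>\<nu>)"
    proof (intro mult_left_mono nn_integral_mono)
      fix y
      show "epow (Uc t) (\<rho> / (1 - \<kappa>)) * epow (Nc y) (\<beta> * \<rho>) * indicator {..<t} y \<le> epow (g y) \<rho> * indicator {..<t} y"
      proof (cases "y < t")
        case True
        then have "Uc t \<le> Uo y" unfolding Uc_def Uo_def by (intro emeasure_mono) auto
        then have "epow (Uc t) (\<rho> / (1 - \<kappa>)) \<le> epow (Uo y) (\<rho> / (1 - \<kappa>))"
          using \<rho> by (intro epow_mono) auto
        then show ?thesis
          using \<rho> by (auto simp: g_def epow_mult epow_epow intro!: mult_right_mono)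
      qed simp
    qed auto
    finally have "epow (epow (Uc t) (\<rho> / (1 - \<kappa>)) * epow (No t) ?c) (\<kappa> / \<rho>)
      \<le> epow (ennreal (2 powr ?c) * (\<integral>\<^sup>+y\<in>{..<t}. epow (g y) \<rho> \<partial>\<nu>)) (\<kappa> / \<rho>)"
      using \<rho> by (intro epow_mono) auto
    then show ?thesis
      using \<rho> \<theta>' by (simp add: epow_mult epow_epow epow_ennreal powr_powr)
  qed
  have "E \<le> (\<integral>\<^sup>+t. ennreal (2 powr \<theta>) * epow (\<integral>\<^sup>+y\<in>{..<t}. epow (g y) \<rho> \<partial>\<nu>) (\<kappa> / \<rho>) \<partial>\<mu>)"
    unfolding E_def hardy_char_def by (intro nn_integral_mono pt)
  also have "\<dots> = ennreal (2 powr \<theta>) * (\<integral>\<^sup>+t. epow (\<integral>\<^sup>+y\<in>{..<t}. epow (g y) \<rho> \<partial>\<nu>) (\<kappa> / \<rho>) \<partial>\<mu>)"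
    by (intro nn_integral_cmult measurable_epow measurable_change[OF measurable_int_lessThan])
  also have "\<dots> \<le> ennreal (2 powr \<theta>) * (K * epow (\<integral>\<^sup>+y. g y \<partial>\<nu>) \<kappa>)"
    using G Efin by (intro mult_left_mono K) (auto intro: order_le_less_trans simp: ennreal_mult_less_top)
  also have "\<dots> \<le> ennreal (2 powr \<theta>) * (K * epow (ennreal (2 powr (1 / (1 - \<kappa>))) * E) \<kappa>)"
    using G \<rho> by (intro mult_left_mono epow_mono) auto
  also have "\<dots> = (ennreal (2 powr (\<theta> + \<kappa> / (1 - \<kappa>))) * K) * epow E \<kappa>"
    using \<rho> by (simp add: epow_mult epow_ennreal powr_powr powr_add ennreal_mult ac_simps)
  finally have main: "E \<le> (ennreal (2 powr (\<theta> + \<kappa> / (1 - \<kappa>))) * K) * epow E \<kappa>" .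
  show ?thesis
  proof (cases "E = 0")
    case True
    then show ?thesis using \<rho> by (simp add: E_def[symmetric] epow_zero)
  next
    case False
    then have E: "0 < epow E \<kappa>" "epow E \<kappa> < top"
      using Efin epow_pos_finite[of E \<kappa>] by (auto simp: zero_less_iff_neq_zero)
    have "E = epow E (1 - \<kappa>) * epow E \<kappa>"
      using \<rho> epow_add[of "1 - \<kappa>" \<kappa> E] by simp
    then have "epow E (1 - \<kappa>) * epow E \<kappa> \<le> (ennreal (2 powr (\<theta> + \<kappa> / (1 - \<kappa>))) * K) * epow E \<kappa>"
      using main by simp
    then show ?thesis
      using E unfolding E_def[symmetric] by (simp add: ennreal_mult_le_mult_iff mult.commute[of _ "epow E \<kappa>"])
  qed
qed

text \<open>Both measures are restricted to a common exhaustion by sets of finite measure. The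
  inequality is inherited with the same K, and the functionals increase to the full one.\<close>

lemma hardy_necessary:
  assumes \<rho>: "0 < \<rho>" "\<rho> \<le> \<kappa>" "\<kappa> < 1" and th: "\<theta> = \<kappa> * (1 - \<rho>) / (\<rho> * (1 - \<kappa>))"
    and K: "\<And>g. g \<in> borel_measurable \<nu> \<Longrightarrow> (\<integral>\<^sup>+y. g y \<partial>\<nu>) < top \<Longrightarrow>
      (\<integral>\<^sup>+t. epow (\<integral>\<^sup>+y\<in>{..<t}. epow (g y) \<rho> \<partial>\<nu>) (\<kappa> / \<rho>) \<partial>\<mu>) \<le> K * epow (\<integral>\<^sup>+y. g y \<partial>\<nu>) \<kappa>"
  shows "epow (hardy_char \<kappa> \<theta>) (1 - \<kappa>) \<le> ennreal (2 powr (\<theta> + \<kappa> / (1 - \<kappa>))) * K"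
proof -
  obtain A where A: "range A \<subseteq> sets \<mu>" "(\<Union>i. A i) = space \<mu>" "\<And>i. emeasure \<mu> (A i) \<noteq> \<infinity>" "incseq A"
    using sigma_finite_measure.sigma_finite_incseq[OF sf_\<mu>] by blast
  obtain B where B: "range B \<subseteq> sets \<nu>" "(\<Union>i. B i) = space \<nu>" "\<And>i. emeasure \<nu> (B i) \<noteq> \<infinity>" "incseq B"
    using sigma_finite_measure.sigma_finite_incseq[OF sf_\<nu>] by blast
  define D where "D i = A i \<inter> B i" for i
  have D\<nu> [measurable]: "D i \<in> sets \<nu>" for i using A B sets_eq by (auto simp: D_def)
  have D\<mu> [measurable]: "D i \<in> sets \<mu>" for i using D\<nu> sets_eq by simp
  have incD: "incseq D" using A(4) B(4) by (force simp: D_def incseq_def) 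
  have UD: "(\<Union>i. D i) = UNIV"
  proof -
    have "\<exists>i. x \<in> D i" for x
    proof -
      have "x \<in> (\<Union>i. A i)" "x \<in> (\<Union>i. B i)" unfolding A(2) B(2) by simp_all
      then obtain i j where "x \<in> A i" "x \<in> B j" by blast
      then have "x \<in> A (max i j)" "x \<in> B (max i j)"
        using incseqD[OF A(4), of i "max i j"] incseqD[OF B(4), of j "max i j"] by auto
      then show ?thesis by (auto simp: D_def)
    qed
    then show ?thesis by auto
  qed
  define m where "m i = density \<mu> (indicator (D i))" for i
  define n where "n i = density \<nu> (indicator (D i))" for i
  have fin: "emeasure (m i) UNIV < top" "emeasure (n i) UNIV < top" for i
  proof -
    have "emeasure (m i) UNIV = emeasure \<mu> (D i)" "emeasure (n i) UNIV = emeasure \<nu> (D i)"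
      using sets.top[of \<mu>] sets.top[of \<nu>] by (simp_all add: m_def n_def emeasure_density)
    moreover have "emeasure \<mu> (D i) \<le> emeasure \<mu> (A i)" "emeasure \<nu> (D i) \<le> emeasure \<nu> (B i)"
      using A(1) B(1) by (auto simp: D_def intro!: emeasure_mono)
    ultimately show "emeasure (m i) UNIV < top" "emeasure (n i) UNIV < top"
      using A(3)[of i] B(3)[of i] by (auto simp: less_top[symmetric] top_unique)
  qed
  have mp: "measure_pair (m i) (n i)" for i
  proof
    show "\<exists>A. countable A \<and> A \<subseteq> sets (m i) \<and> \<Union> A = space (m i) \<and> (\<forall>a\<in>A. emeasure (m i) a \<noteq> \<infinity>)"
      using fin[of i] sets.top[of \<mu>] by (intro exI[of _ "{UNIV}"]) (auto simp: m_def)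
    show "\<exists>A. countable A \<and> A \<subseteq> sets (n i) \<and> \<Union> A = space (n i) \<and> (\<forall>a\<in>A. emeasure (n i) a \<noteq> \<infinity>)"
      using fin[of i] sets.top[of \<nu>] by (intro exI[of _ "{UNIV}"]) (auto simp: n_def)
    show "sets (m i) = sets (n i)" using sets_eq by (simp add: m_def n_def)
    show "sets borel \<subseteq> sets (n i)" using borel by (simp add: n_def)
  qed
  \<comment> \<open>The integrand of the functional of the restricted pair, relative to the full
    \<mu>. The tails are restricted as well, hence \<open>F i\<close> increases with i.\<close>
  define F where "F i t = indicator (D i) t * (epow (emeasure \<mu> (D i \<inter> {t..})) (\<kappa> / (1 - \<kappa>)) * epow (emeasure \<nu> (D i \<inter> {..<t})) \<theta>)" for i t
  have char: "measure_pair.hardy_char (m i) (n i) \<kappa> \<theta> = (\<integral>\<^sup>+t. F i t \<partial>\<mu>)" for i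
  proof -
    have 1: "emeasure (m i) {t..} = emeasure \<mu> (D i \<inter> {t..})" for t
      by (simp add: m_def emeasure_restricted)
    have 2: "emeasure (n i) {..<t} = emeasure \<nu> (D i \<inter> {..<t})" for t
      by (simp add: n_def emeasure_restricted)
    have [measurable]: "measure_pair.Uc (m i) \<in> borel_measurable \<mu>" "measure_pair.No (n i) \<in> borel_measurable \<mu>"
      using measure_pair.measurable_NU[OF mp[of i]] by (auto simp: m_def n_def)
    have "measure_pair.hardy_char (m i) (n i) \<kappa> \<theta> = (\<integral>\<^sup>+t. epow (measure_pair.Uc (m i) t) (\<kappa> / (1 - \<kappa>)) * epow (measure_pair.No (n i) t) \<theta> \<partial>m i)"
      by (rule measure_pair.hardy_char_def[OF mp])
    also have "\<dots> = (\<integral>\<^sup>+t. indicator (D i) t * (epow (measure_pair.Uc (m i) t) (\<kappa> / (1 - \<kappa>)) * epow (measure_pair.No (n i) t) \<theta>) \<partial>\<mu>)"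
      unfolding m_def[of i] by (rule nn_integral_density) (simp_all add: m_def[symmetric])
    finally show ?thesis
      unfolding measure_pair.Uc_def[OF mp] measure_pair.No_def[OF mp] 1 2 F_def .
  qed
  have le: "epow (\<integral>\<^sup>+t. F i t \<partial>\<mu>) (1 - \<kappa>) \<le> ennreal (2 powr (\<theta> + \<kappa> / (1 - \<kappa>))) * K" for i
    unfolding char[symmetric]
  proof (rule measure_pair.hardy_necessary_finite[OF mp \<rho> th fin])
    fix g assume "g \<in> borel_measurable (n i)" and G: "(\<integral>\<^sup>+y. g y \<partial>n i) < top"
    then have [measurable]: "g \<in> borel_measurable \<nu>" by (simp add: n_def)
    let ?g = "\<lambda>y. indicator (D i) y * g y"
    have 1: "(\<integral>\<^sup>+y. g y \<partial>n i) = (\<integral>\<^sup>+y. ?g y \<partial>\<nu>)"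
      unfolding n_def by (rule nn_integral_density) measurable
    have 2: "(\<integral>\<^sup>+y\<in>{..<t}. epow (g y) \<rho> \<partial>n i) = (\<integral>\<^sup>+y\<in>{..<t}. epow (?g y) \<rho> \<partial>\<nu>)" for t
    proof -
      have "(\<integral>\<^sup>+y\<in>{..<t}. epow (g y) \<rho> \<partial>n i) = (\<integral>\<^sup>+y. indicator (D i) y * (epow (g y) \<rho> * indicator {..<t} y) \<partial>\<nu>)"
        unfolding n_def by (rule nn_integral_density) measurable
      also have "\<dots> = (\<integral>\<^sup>+y\<in>{..<t}. epow (?g y) \<rho> \<partial>\<nu>)"
        using \<rho> by (intro nn_integral_cong) (auto simp: epow_zero split: split_indicator)
      finally show ?thesis .
    qed
    let ?I = "\<lambda>t. epow (\<integral>\<^sup>+y\<in>{..<t}. epow (?g y) \<rho> \<partial>\<nu>) (\<kappa> / \<rho>)"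
    have I [measurable]: "?I \<in> borel_measurable \<mu>"
      by (intro measurable_epow measurable_change[OF measurable_int_lessThan])
    have "(\<integral>\<^sup>+t. ?I t \<partial>m i) = (\<integral>\<^sup>+t. indicator (D i) t * ?I t \<partial>\<mu>)"
      unfolding m_def by (rule nn_integral_density) (use I in auto)
    also have "\<dots> \<le> (\<integral>\<^sup>+t. ?I t \<partial>\<mu>)"
      by (intro nn_integral_mono) (auto split: split_indicator)
    also have "\<dots> \<le> K * epow (\<integral>\<^sup>+y. ?g y \<partial>\<nu>) \<kappa>"
      using G 1 by (intro K) auto
    finally show "(\<integral>\<^sup>+t. epow (\<integral>\<^sup>+y\<in>{..<t}. epow (g y) \<rho> \<partial>n i) (\<kappa> / \<rho>) \<partial>m i) \<le> K * epow (\<integral>\<^sup>+y. g y \<partial>n i) \<kappa>"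
      unfolding 1 2 .
  qed
  have th0: "0 \<le> \<theta>" using \<rho> by (simp add: th)
  have incF: "F i t \<le> F j t" if "i \<le> j" for i j t
  proof -
    have "D i \<subseteq> D j" using incD that by (auto simp: incseq_def)
    then show ?thesis
      unfolding F_def using \<rho> th0
      by (intro mult_mono epow_mono emeasure_mono) (auto split: split_indicator)
  qed
  have supF: "epow (Uc t) (\<kappa> / (1 - \<kappa>)) * epow (No t) \<theta> = (SUP i. F i t)" for t
  proof -
    have s1: "Uc t = (SUP i. emeasure \<mu> (D i \<inter> {t..}))"
    proof -
      have "{t..} = (\<Union>i. D i \<inter> {t..})" using UD by auto
      then show ?thesis unfolding Uc_def using incD
        by (subst SUP_emeasure_incseq) (auto simp: incseq_def)
    qed
    have s2: "No t = (SUP i. emeasure \<nu> (D i \<inter> {..<t}))"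
    proof -
      have "{..<t} = (\<Union>i. D i \<inter> {..<t})" using UD by auto
      then show ?thesis unfolding No_def using incD
        by (subst SUP_emeasure_incseq) (auto simp: incseq_def)
    qed
    obtain i0 where i0: "t \<in> D i0" using UD by auto
    have "epow (Uc t) (\<kappa> / (1 - \<kappa>)) * epow (No t) \<theta>
      = (SUP j. SUP i. epow (emeasure \<mu> (D i \<inter> {t..})) (\<kappa> / (1 - \<kappa>)) * epow (emeasure \<nu> (D j \<inter> {..<t})) \<theta>)"
      using \<rho> th0 unfolding s1 s2 by (simp add: epow_SUP SUP_mult_right_ennreal SUP_mult_left_ennreal)
    also have "\<dots> \<le> (SUP i. F i t)"
    proof (intro SUP_least)
      fix j i
      \<comment> \<open>One index catches two independent suprema; taking it beyond
        \<open>i0\<close> as well makes the indicator in \<open>F\<close> equal to 1 at t.\<close>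
      define l where "l = max i0 (max i j)"
      have l: "D i0 \<subseteq> D l" "D i \<subseteq> D l" "D j \<subseteq> D l" using incD by (auto simp: l_def incseq_def)
      have "epow (emeasure \<mu> (D i \<inter> {t..})) (\<kappa> / (1 - \<kappa>)) * epow (emeasure \<nu> (D j \<inter> {..<t})) \<theta> \<le> F l t"
        using l i0 \<rho> th0 unfolding F_def by (auto simp: indicator_def intro!: mult_mono epow_mono emeasure_mono)
      also have "\<dots> \<le> (SUP i. F i t)" by (rule SUP_upper) simp
      finally show "epow (emeasure \<mu> (D i \<inter> {t..})) (\<kappa> / (1 - \<kappa>)) * epow (emeasure \<nu> (D j \<inter> {..<t})) \<theta> \<le> (SUP i. F i t)" .
    qed
    finally have le: "epow (Uc t) (\<kappa> / (1 - \<kappa>)) * epow (No t) \<theta> \<le> (SUP i. F i t)" .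
    have "(SUP i. F i t) \<le> epow (Uc t) (\<kappa> / (1 - \<kappa>)) * epow (No t) \<theta>"
      unfolding F_def Uc_def No_def using \<rho> th0
      by (intro SUP_least) (auto simp: indicator_def intro!: mult_mono epow_mono emeasure_mono)
    with le show ?thesis by (rule antisym)
  qed
  have mF: "F i \<in> borel_measurable \<mu>" for i
  proof -
    have "(\<lambda>t. emeasure \<mu> (D i \<inter> {t..})) \<in> borel_measurable \<mu>"
      by (rule measurable_change, rule measurable_antimono) (auto simp: antimono_def intro!: emeasure_mono)
    moreover have "(\<lambda>t. emeasure \<nu> (D i \<inter> {..<t})) \<in> borel_measurable \<mu>"
      by (rule measurable_change, rule measurable_mono) (auto simp: mono_def intro!: emeasure_mono)
    ultimately show ?thesis unfolding F_def[abs_def] by measurable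
  qed
  have "hardy_char \<kappa> \<theta> = (SUP i. \<integral>\<^sup>+t. F i t \<partial>\<mu>)"
    unfolding hardy_char_def supF
    by (rule nn_integral_monotone_convergence_SUP) (auto simp: incseq_def le_fun_def incF mF)
  then have "epow (hardy_char \<kappa> \<theta>) (1 - \<kappa>) = (SUP i. epow (\<integral>\<^sup>+t. F i t \<partial>\<mu>) (1 - \<kappa>))"
    using \<rho> by (simp add: epow_SUP)
  also have "\<dots> \<le> ennreal (2 powr (\<theta> + \<kappa> / (1 - \<kappa>))) * K"
    by (intro SUP_least le)
  finally show ?thesis .
qed

end

section \<open>Sums over the integers\<close>

abbreviation isum :: "(int \<Rightarrow> ennreal) \<Rightarrow> ennreal" where
  "isum f \<equiv> (\<integral>\<^sup>+k. f k \<partial>count_space UNIV)"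

text \<open>Bookkeeping of levels: \<open>pw (- 1) k\<close> is the upper bound of the tail of w on
  block k.\<close>

definition pw :: "real \<Rightarrow> int \<Rightarrow> ennreal" where
  "pw a k = ennreal (2 powr (a * real_of_int k))"

lemma pw_pos [simp]: "0 < pw a k" "pw a k \<noteq> 0" and pw_fin [simp]: "pw a k < top" "pw a k \<noteq> top"
  by (auto simp: pw_def)

lemma pw_mult: "pw a k * pw b k = pw (a + b) k"
  by (simp add: pw_def ennreal_mult[symmetric] powr_add[symmetric] distrib_right)

lemma pw_mult_assoc: "pw a k * (pw b k * x) = pw (a + b) k * x"
  by (simp add: mult.assoc[symmetric] pw_mult)

lemma pw_add: "pw a (j + k) = pw a j * pw a k"
  by (simp add: pw_def ennreal_mult[symmetric] powr_add[symmetric] distrib_left)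

lemma pw_0 [simp]: "pw 0 k = 1" "pw a 0 = 1"
  by (simp_all add: pw_def)

lemma epow_pw: "epow (pw a k) s = pw (a * s) k"
  by (simp add: pw_def epow_ennreal powr_powr ac_simps)

lemma isum_mono: "(\<And>k. f k \<le> g k) \<Longrightarrow> isum f \<le> isum g"
  by (intro nn_integral_mono) auto

lemma le_isum: "f k \<le> isum f"
  by (rule nn_integral_ge_point) simp

lemma isum_cmult: "isum (\<lambda>k. c * f k) = c * isum f"
  by (rule nn_integral_cmult) auto

lemma isum_add: "isum (\<lambda>k. f k + g k) = isum f + isum g"
  by (rule nn_integral_add) auto

lemma isum_swap: "isum (\<lambda>j. isum (\<lambda>k. f j k)) = isum (\<lambda>k. isum (\<lambda>j. f j k))"
  using nn_integral_count_space_nn_integral[of UNIV "\<lambda>i x. f x i" "count_space UNIV"] by simp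

lemma isum_set: "(\<integral>\<^sup>+k\<in>A. f k \<partial>count_space (UNIV :: int set)) = (\<integral>\<^sup>+k. f k \<partial>count_space A)"
  by (simp add: nn_integral_count_space_indicator)

lemma isum_geom_atLeast:
  assumes "0 < d"
  shows "(\<integral>\<^sup>+j\<in>{k..}. pw (- d) (j - k) \<partial>count_space (UNIV :: int set)) = ennreal (geom_const d)"
proof -
  have b: "bij_betw (\<lambda>n. k + int n) UNIV {k..}"
    by (rule bij_betw_byWitness[where f' = "\<lambda>j. nat (j - k)"]) auto
  have "(\<integral>\<^sup>+j\<in>{k..}. pw (- d) (j - k) \<partial>count_space (UNIV :: int set)) = (\<integral>\<^sup>+n. pw (- d) (int n) \<partial>count_space (UNIV :: nat set))"
    unfolding isum_set nn_integral_bij_count_space[OF b, symmetric] by simp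
  also have "\<dots> = ennreal (geom_const d)"
    using suminf_geom[OF assms] by (simp add: nn_integral_count_space_nat pw_def)
  finally show ?thesis .
qed

lemma isum_geom_atMost:
  assumes "0 < d"
  shows "(\<integral>\<^sup>+k\<in>{..j}. pw (- d) (j - k) \<partial>count_space (UNIV :: int set)) = ennreal (geom_const d)"
proof -
  have b: "bij_betw (\<lambda>n. j - int n) UNIV {..j}"
    by (rule bij_betw_byWitness[where f' = "\<lambda>k. nat (j - k)"]) auto
  have "(\<integral>\<^sup>+k\<in>{..j}. pw (- d) (j - k) \<partial>count_space (UNIV :: int set)) = (\<integral>\<^sup>+n. pw (- d) (int n) \<partial>count_space (UNIV :: nat set))"
    unfolding isum_set nn_integral_bij_count_space[OF b, symmetric] by simp
  also have "\<dots> = ennreal (geom_const d)"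
    using suminf_geom[OF assms] by (simp add: nn_integral_count_space_nat pw_def)
  finally show ?thesis .
qed

text \<open>With S the weighted sum on the right, the term of index j is at most (2^(-d(j-k))
  S)^(1/g), and these bounds form a geometric series. An arbitrarily slow exponential weight thus
  replaces convexity or concavity of the power g.\<close>

lemma epow_isum_atLeast_le:
  assumes g: "0 < g" and d: "0 < d"
  shows "epow (\<integral>\<^sup>+j\<in>{k..}. n j \<partial>count_space (UNIV :: int set)) g
    \<le> ennreal (geom_const (d / g) powr g) * (\<integral>\<^sup>+j\<in>{k..}. pw d (j - k) * epow (n j) g \<partial>count_space (UNIV :: int set))"
proof -
  define S where "S = (\<integral>\<^sup>+j\<in>{k..}. pw d (j - k) * epow (n j) g \<partial>count_space (UNIV :: int set))"
  have c: "0 < geom_const (d / g)" using g d by (intro geom_const_pos) auto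
  have "n j \<le> pw (- (d / g)) (j - k) * epow S (1 / g)" if "k \<le> j" for j
  proof -
    have "pw d (j - k) * epow (n j) g \<le> S"
      using le_isum[of "\<lambda>j. pw d (j - k) * epow (n j) g * indicator {k..} j" j] that by (simp add: S_def)
    then have "pw (- d) (j - k) * (pw d (j - k) * epow (n j) g) \<le> pw (- d) (j - k) * S"
      by (rule mult_left_mono) simp
    then have "epow (n j) g \<le> pw (- d) (j - k) * S" by (simp add: pw_mult_assoc)
    then show ?thesis
      using g by (simp add: epow_le_iff epow_mult epow_pw)
  qed
  then have "(\<integral>\<^sup>+j\<in>{k..}. n j \<partial>count_space (UNIV :: int set))
    \<le> isum (\<lambda>j. epow S (1 / g) * (pw (- (d / g)) (j - k) * indicator {k..} j))"
    by (intro isum_mono) (auto split: split_indicator simp: mult.commute)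
  also have "\<dots> = epow S (1 / g) * ennreal (geom_const (d / g))"
    using g d by (simp add: isum_cmult isum_geom_atLeast)
  finally have "epow (\<integral>\<^sup>+j\<in>{k..}. n j \<partial>count_space (UNIV :: int set)) g \<le> epow (epow S (1 / g) * ennreal (geom_const (d / g))) g"
    using g by (intro epow_mono) auto
  also have "\<dots> = ennreal (geom_const (d / g) powr g) * S"
    using g c by (simp add: epow_mult epow_epow epow_ennreal mult.commute)
  finally show ?thesis unfolding S_def .
qed

text \<open>Discrete Hardy inequality for geometrically growing weights. Half of the exponent a pays
  for \<open>epow_isum_atLeast_le\<close>; after exchanging the sums the other half makes the inner
  sum a geometric series.\<close>

lemma isum_epow_atLeast_le:
  assumes a: "0 < a" and g: "0 < g"
  shows "isum (\<lambda>k. pw a k * epow (\<integral>\<^sup>+j\<in>{k..}. n j \<partial>count_space UNIV) g)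
    \<le> ennreal (geom_const (a / 2 / g) powr g * geom_const (a / 2)) * isum (\<lambda>j. pw a j * epow (n j) g)"
proof -
  let ?c = "ennreal (geom_const (a / 2 / g) powr g)"
  have "isum (\<lambda>k. pw a k * epow (\<integral>\<^sup>+j\<in>{k..}. n j \<partial>count_space UNIV) g)
    \<le> isum (\<lambda>k. pw a k * (?c * (\<integral>\<^sup>+j\<in>{k..}. pw (a / 2) (j - k) * epow (n j) g \<partial>count_space UNIV)))"
    using a g by (intro isum_mono mult_left_mono epow_isum_atLeast_le) auto
  also have "\<dots> = ?c * isum (\<lambda>k. isum (\<lambda>j. pw a k * (pw (a / 2) (j - k) * epow (n j) g * indicator {k..} j)))"
    by (simp add: isum_cmult[symmetric] mult.left_commute)
  also have "isum (\<lambda>k. isum (\<lambda>j. pw a k * (pw (a / 2) (j - k) * epow (n j) g * indicator {k..} j)))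
    = isum (\<lambda>k. isum (\<lambda>j. (pw a j * epow (n j) g) * (pw (- (a / 2)) (j - k) * indicator {..j} k)))"
  proof -
    have "pw a k * pw (a / 2) (j - k) = pw a j * pw (- (a / 2)) (j - k)" for j k
      by (simp add: pw_def ennreal_mult[symmetric] powr_add[symmetric] field_simps)
    then have "pw a k * (pw (a / 2) (j - k) * epow (n j) g * indicator {k..} j)
      = (pw a j * epow (n j) g) * (pw (- (a / 2)) (j - k) * indicator {..j} k)" for j k
      by (auto split: split_indicator simp: mult.assoc[symmetric]) (simp add: ac_simps)
    then show ?thesis by simp
  qed
  also have "\<dots> = isum (\<lambda>j. (pw a j * epow (n j) g) * ennreal (geom_const (a / 2)))"
    using a by (subst isum_swap) (simp add: isum_cmult isum_geom_atMost)
  also have "\<dots> = ennreal (geom_const (a / 2)) * isum (\<lambda>j. pw a j * epow (n j) g)"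
    by (simp add: isum_cmult[symmetric] mult.commute)
  finally show ?thesis
    using a geom_const_pos[of "a / 2"] by (simp add: ennreal_mult mult.assoc)
qed

text \<open>Converse of Hoelder's inequality for sequences. The extremal a = d^(1/(1-\<kappa>))
  satisfies a^\<kappa> d = a, so the hypothesis reads S \<le> K S^\<kappa> for its sum S.\<close>

lemma isum_duality:
  assumes k: "0 < \<kappa>" "\<kappa> < 1"
    and le: "\<And>a. isum (\<lambda>k. epow (a k) \<kappa> * d k) \<le> K * epow (isum a) \<kappa>"
  shows "isum (\<lambda>k. epow (d k) (1 / (1 - \<kappa>))) \<le> epow K (1 / (1 - \<kappa>))"
proof (cases "K = top")
  case True
  then show ?thesis using k by (simp add: epow_top)
next
  case False
  \<comment> \<open>Testing with unit sequences shows that every d_k is finite.\<close>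
  have dK: "d k \<le> K" for k
  proof -
    have "d k = epow (indicator {k} k) \<kappa> * d k" by simp
    also have "\<dots> \<le> isum (\<lambda>j. epow (indicator {k} j) \<kappa> * d j)"
      by (rule le_isum[of "\<lambda>j. epow (indicator {k} j) \<kappa> * d j"])
    also have "\<dots> \<le> K * epow (isum (indicator {k})) \<kappa>" by (rule le)
    finally show ?thesis by simp
  qed
  \<comment> \<open>truncations of the extremal sequence; their sums are finite and can be cancelled\<close>
  define D where "D n j = epow (d j) (1 / (1 - \<kappa>)) * indicator {- int n..int n} j" for n j
  have "isum (D n) \<le> epow K (1 / (1 - \<kappa>))" for n
  proof -
    define S where "S = isum (D n)"
    have "S = (\<Sum>j\<in>{- int n..int n}. epow (d j) (1 / (1 - \<kappa>)))"
      unfolding S_def D_def isum_set by (simp add: nn_integral_count_space_finite)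
    also have "\<dots> < top"
      using dK False k by (auto simp: less_top[symmetric] epow_eq_top_iff) (metis top_unique)
    finally have fin: "S < top" .
    have "D n j = epow (D n j) \<kappa> * d j" for j
    proof (cases "j \<in> {- int n..int n}")
      case True
      have "epow (d j) (1 / (1 - \<kappa>)) = epow (d j) (\<kappa> / (1 - \<kappa>) + 1)"
        using k by (intro arg_cong[where f = "epow (d j)"]) (simp add: field_simps)
      also have "\<dots> = epow (d j) (\<kappa> / (1 - \<kappa>)) * d j"
        using k by (subst epow_add) auto
      finally have eq: "epow (d j) (1 / (1 - \<kappa>)) = epow (d j) (\<kappa> / (1 - \<kappa>)) * d j" .
      have D1: "D n j = epow (d j) (1 / (1 - \<kappa>))" using True by (simp add: D_def)
      show ?thesis unfolding D1 epow_epow by (subst eq) simp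
    qed (use k in \<open>simp add: D_def epow_zero\<close>)
    then have "S = isum (\<lambda>j. epow (D n j) \<kappa> * d j)" unfolding S_def by simp
    also have "\<dots> \<le> K * epow S \<kappa>" unfolding S_def by (rule le)
    finally have S: "S \<le> K * epow S \<kappa>" .
    show ?thesis
    proof (cases "S = 0")
      case False
      then have E: "epow S \<kappa> \<noteq> 0" "epow S \<kappa> \<noteq> top"
        using fin k by (auto simp: epow_eq_0_iff epow_eq_top_iff)
      have "S = epow S (1 - \<kappa>) * epow S \<kappa>"
        using k epow_add[of "1 - \<kappa>" \<kappa> S] by simp
      then have "epow S \<kappa> * epow S (1 - \<kappa>) \<le> epow S \<kappa> * K"
        using S by (simp add: mult.commute)
      then have "epow S (1 - \<kappa>) \<le> K"
        using E by (simp add: ennreal_mult_le_mult_iff)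
      then show ?thesis
        using k by (simp add: epow_le_iff S_def)
    qed (simp add: S_def[symmetric])
  qed
  moreover have "isum (\<lambda>k. epow (d k) (1 / (1 - \<kappa>))) = (SUP n. isum (D n))"
  proof -
    have "epow (d k) (1 / (1 - \<kappa>)) = (SUP n. D n k)" for k
    proof (rule antisym)
      show "epow (d k) (1 / (1 - \<kappa>)) \<le> (SUP n. D n k)"
        by (rule SUP_upper2[of "nat \<bar>k\<bar>"]) (auto simp: D_def indicator_def)
      show "(SUP n. D n k) \<le> epow (d k) (1 / (1 - \<kappa>))"
        by (intro SUP_least) (auto simp: D_def split: split_indicator)
    qed
    then show ?thesis
      by (subst nn_integral_monotone_convergence_SUP[symmetric])
         (auto simp: incseq_def le_fun_def D_def split: split_indicator)
  qed
  ultimately show ?thesis by (simp add: SUP_least)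
qed

text \<open>Each supremum is the limit of an increasing sequence of values. Taking the n-th member
  in every coordinate gives an admissible choice, and monotone convergence lets n grow. In this way
  near-extremal functions are chosen in all blocks simultaneously.\<close>

lemma isum_SUP_le:
  assumes ne: "\<And>k. S k \<noteq> {}"
    and le: "\<And>g. (\<And>k. g k \<in> S k) \<Longrightarrow> isum (\<lambda>k. x k * \<phi> k (g k)) \<le> R"
  shows "isum (\<lambda>k. x k * (SUP g\<in>S k. \<phi> k g)) \<le> R"
proof -
  have "\<exists>f. incseq f \<and> range f \<subseteq> \<phi> k ` S k \<and> (SUP g\<in>S k. \<phi> k g) = (SUP n. f n)" for k
    using ne by (intro ennreal_Sup_countable_SUP) auto
  then obtain f where f: "\<And>k. incseq (f k)" "\<And>k. range (f k) \<subseteq> \<phi> k ` S k"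
    "\<And>k. (SUP g\<in>S k. \<phi> k g) = (SUP n::nat. f k n)"
    by metis
  have "\<exists>g\<in>S k. f k n = \<phi> k g" for k n using f(2)[of k] by auto
  then obtain G where G: "\<And>k n. G k n \<in> S k" "\<And>k n. f k n = \<phi> k (G k n)" by metis
  have "isum (\<lambda>k. x k * (SUP g\<in>S k. \<phi> k g)) = isum (\<lambda>k. SUP n. x k * f k n)"
    unfolding f(3) by (simp add: SUP_mult_left_ennreal)
  also have "\<dots> = (SUP n. isum (\<lambda>k. x k * f k n))"
    using f(1) by (intro nn_integral_monotone_convergence_SUP)
      (auto simp: incseq_def le_fun_def intro!: mult_left_mono)
  also have "\<dots> \<le> R"
    unfolding G(2) by (intro SUP_least le G(1))
  finally show ?thesis .
qed

section \<open>Restriction of one of the two measures to a subset\<close>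

context measure_pair
begin

lemma restrict_pair:
  assumes [measurable]: "F \<in> sets \<nu>"
  shows "measure_pair \<mu> (density \<nu> (indicator F))"
proof -
  interpret \<nu>: sigma_finite_measure \<nu> by (rule sf_\<nu>)
  have "sigma_finite_measure (density \<nu> (indicator F))"
    by (subst \<nu>.sigma_finite_iff_density_finite) (auto split: split_indicator)
  then show ?thesis
    using sf_\<mu> sets_eq borel by (simp add: measure_pair_def)
qed

text \<open>Only \<nu> is restricted to \<open>F\<close>; the tail of \<mu> and the outer integral
  stay global, since mass of g in \<open>F\<close> is felt at every later t.\<close>

definition char_on :: "real \<Rightarrow> real \<Rightarrow> 'a set \<Rightarrow> ennreal" where
  "char_on k th F = (\<integral>\<^sup>+t. epow (Uc t) (k / (1 - k)) * epow (emeasure \<nu> (F \<inter> {..<t})) th \<partial>\<mu>)"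

lemma hardy_char_restrict:
  assumes [measurable]: "F \<in> sets \<nu>"
  shows "measure_pair.hardy_char \<mu> (density \<nu> (indicator F)) k th = char_on k th F"
  unfolding measure_pair.hardy_char_def[OF restrict_pair[OF assms]] measure_pair.Uc_def[OF restrict_pair[OF assms]]
    measure_pair.No_def[OF restrict_pair[OF assms]] char_on_def
  by (simp add: emeasure_restricted Uc_def)

lemma integral_restrict:
  assumes [measurable]: "F \<in> sets \<nu>" "g \<in> borel_measurable \<nu>"
  shows "(\<integral>\<^sup>+y. g y \<partial>density \<nu> (indicator F)) = (\<integral>\<^sup>+y\<in>F. g y \<partial>\<nu>)"
    "E \<in> sets \<nu> \<Longrightarrow> (\<integral>\<^sup>+y\<in>E. g y \<partial>density \<nu> (indicator F)) = (\<integral>\<^sup>+y\<in>F \<inter> E. g y \<partial>\<nu>)"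
proof -
  show "(\<integral>\<^sup>+y. g y \<partial>density \<nu> (indicator F)) = (\<integral>\<^sup>+y\<in>F. g y \<partial>\<nu>)"
    by (subst nn_integral_density) (auto simp: mult.commute)
  assume [measurable]: "E \<in> sets \<nu>"
  show "(\<integral>\<^sup>+y\<in>E. g y \<partial>density \<nu> (indicator F)) = (\<integral>\<^sup>+y\<in>F \<inter> E. g y \<partial>\<nu>)"
    by (subst nn_integral_density) (auto intro!: nn_integral_cong split: split_indicator)
qed

lemma hardy_sufficient_on:
  assumes \<rho>: "0 < \<rho>" "\<rho> \<le> \<kappa>" "\<kappa> < 1" and th: "\<theta> = \<kappa> * (1 - \<rho>) / (\<rho> * (1 - \<kappa>))"
    and [measurable]: "F \<in> sets \<nu>" "g \<in> borel_measurable \<nu>"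
  shows "(\<integral>\<^sup>+t. epow (\<integral>\<^sup>+y\<in>F \<inter> {..<t}. epow (g y) \<rho> \<partial>\<nu>) (\<kappa> / \<rho>) \<partial>\<mu>)
    \<le> ennreal (hardy_const \<rho> \<kappa>) * epow (\<integral>\<^sup>+y\<in>F. g y \<partial>\<nu>) \<kappa> * epow (char_on \<kappa> \<theta> F) (1 - \<kappa>)"
proof -
  have 2: "(\<integral>\<^sup>+y\<in>{..<t}. epow (g y) \<rho> \<partial>density \<nu> (indicator F)) = (\<integral>\<^sup>+y\<in>F \<inter> {..<t}. epow (g y) \<rho> \<partial>\<nu>)" for t
    by (rule integral_restrict) auto
  have "g \<in> borel_measurable (density \<nu> (indicator F))" by simp
  from measure_pair.hardy_sufficient[OF restrict_pair \<rho> this th]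
  show ?thesis
    unfolding 2 by (simp add: hardy_char_restrict integral_restrict(1))
qed

lemma hardy_necessary_on:
  assumes \<rho>: "0 < \<rho>" "\<rho> \<le> \<kappa>" "\<kappa> < 1" and th: "\<theta> = \<kappa> * (1 - \<rho>) / (\<rho> * (1 - \<kappa>))"
    and F [measurable]: "F \<in> sets \<nu>"
    and K: "\<And>g. g \<in> borel_measurable \<nu> \<Longrightarrow> (\<integral>\<^sup>+y\<in>F. g y \<partial>\<nu>) < top \<Longrightarrow>
      (\<integral>\<^sup>+t. epow (\<integral>\<^sup>+y\<in>F \<inter> {..<t}. epow (g y) \<rho> \<partial>\<nu>) (\<kappa> / \<rho>) \<partial>\<mu>) \<le> K * epow (\<integral>\<^sup>+y\<in>F. g y \<partial>\<nu>) \<kappa>"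
  shows "epow (char_on \<kappa> \<theta> F) (1 - \<kappa>) \<le> ennreal (2 powr (\<theta> + \<kappa> / (1 - \<kappa>))) * K"
  unfolding hardy_char_restrict[OF F, symmetric]
proof (rule measure_pair.hardy_necessary[OF restrict_pair[OF F] \<rho> th])
  fix g assume "g \<in> borel_measurable (density \<nu> (indicator F))" and fin: "(\<integral>\<^sup>+y. g y \<partial>density \<nu> (indicator F)) < top"
  then have [measurable]: "g \<in> borel_measurable \<nu>" by simp
  show "(\<integral>\<^sup>+t. epow (\<integral>\<^sup>+y\<in>{..<t}. epow (g y) \<rho> \<partial>density \<nu> (indicator F)) (\<kappa> / \<rho>) \<partial>\<mu>)
    \<le> K * epow (\<integral>\<^sup>+y. g y \<partial>density \<nu> (indicator F)) \<kappa>"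
  proof -
    have 2: "(\<integral>\<^sup>+y\<in>{..<t}. epow (g y) \<rho> \<partial>density \<nu> (indicator F)) = (\<integral>\<^sup>+y\<in>F \<inter> {..<t}. epow (g y) \<rho> \<partial>\<nu>)" for t
      by (rule integral_restrict) auto
    show ?thesis unfolding 2 using K[of g] fin by (simp add: integral_restrict(1))
  qed
qed

text \<open>As \<nu>(F \<inter> {..<t}) increases with t, its power th times Uc(t)^(1/(1-k)) is
  bounded by a multiple of the functional, uniformly in t. The (g-1)-st power of this product is
  pulled out; a is the exponent for which the integrand of the functional remains.\<close>

lemma char_on_power_le:
  assumes k: "0 < k" "k < 1" and th: "0 < th" and g: "1 \<le> g" and F: "F \<in> sets \<nu>"
    and a: "a = g / (1 - k) - 1"
  shows "(\<integral>\<^sup>+t. epow (Uc t) a * epow (emeasure \<nu> (F \<inter> {..<t})) (th * g) \<partial>\<mu>)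
    \<le> ennreal (2 powr ((g - 1) / (1 - k))) * epow (char_on k th F) g"
proof -
  let ?N = "\<lambda>t. emeasure \<nu> (F \<inter> {..<t})"
  let ?h = "\<lambda>t. epow (Uc t) (k / (1 - k)) * epow (?N t) th"
  let ?c = "ennreal (2 powr (1 / (1 - k)))"
  define B where "B = char_on k th F"
  have "?N \<in> borel_measurable \<nu>"
    using F by (intro measurable_mono) (auto simp: mono_def intro!: emeasure_mono)
  then have N [measurable]: "?N \<in> borel_measurable \<mu>" by (rule measurable_change)
  have e: "1 / (1 - k) = k / (1 - k) + 1" using k by (simp add: field_simps)
  have H: "epow (?N t) th * epow (Uc t) (1 / (1 - k)) \<le> ?c * B" for t
  proof -
    have "epow (Uc t) (1 / (1 - k)) \<le> ?c * (\<integral>\<^sup>+y\<in>{t..}. epow (Uc y) (k / (1 - k)) \<partial>\<mu>)"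
      using dist_le_power[OF dist_le_Uc, of "k / (1 - k)" "{t..}"] k unfolding e by (simp add: Uc_def)
    then have "epow (?N t) th * epow (Uc t) (1 / (1 - k)) \<le> epow (?N t) th * (?c * (\<integral>\<^sup>+y\<in>{t..}. epow (Uc y) (k / (1 - k)) \<partial>\<mu>))"
      by (rule mult_left_mono) simp
    also have "\<dots> = ?c * (\<integral>\<^sup>+y. epow (?N t) th * (epow (Uc y) (k / (1 - k)) * indicator {t..} y) \<partial>\<mu>)"
      by (subst nn_integral_cmult) (auto simp: mult.left_commute)
    also have "(\<integral>\<^sup>+y. epow (?N t) th * (epow (Uc y) (k / (1 - k)) * indicator {t..} y) \<partial>\<mu>) \<le> B"
      unfolding B_def char_on_def
    proof (intro nn_integral_mono)
      fix y
      show "epow (?N t) th * (epow (Uc y) (k / (1 - k)) * indicator {t..} y) \<le> epow (Uc y) (k / (1 - k)) * epow (?N y) th"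
        using F th by (auto split: split_indicator simp: mult.commute intro!: mult_right_mono epow_mono emeasure_mono)
    qed
    finally show ?thesis by (simp add: mult_left_mono)
  qed
  have "(\<integral>\<^sup>+t. epow (Uc t) a * epow (?N t) (th * g) \<partial>\<mu>) \<le> (\<integral>\<^sup>+t. epow (?c * B) (g - 1) * ?h t \<partial>\<mu>)"
  proof (intro nn_integral_mono)
    fix t
    have "epow (Uc t) a = epow (epow (Uc t) (1 / (1 - k))) (g - 1) * epow (Uc t) (k / (1 - k))"
    proof -
      have "a = 1 / (1 - k) * (g - 1) + k / (1 - k)" using k by (simp add: a divide_simps)
      then show ?thesis using k g by (simp add: epow_epow epow_add)
    qed
    moreover have "epow (?N t) (th * g) = epow (epow (?N t) th) (g - 1) * epow (?N t) th"
    proof -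
      have "th * g = th * (g - 1) + th" by (simp add: algebra_simps)
      then show ?thesis using th g by (simp add: epow_epow epow_add)
    qed
    ultimately have "epow (Uc t) a * epow (?N t) (th * g) = epow (epow (?N t) th * epow (Uc t) (1 / (1 - k))) (g - 1) * ?h t"
      using g by (simp add: epow_mult ac_simps)
    also have "\<dots> \<le> epow (?c * B) (g - 1) * ?h t"
      using g H by (intro mult_right_mono epow_mono) auto
    finally show "epow (Uc t) a * epow (?N t) (th * g) \<le> epow (?c * B) (g - 1) * ?h t" .
  qed
  also have "\<dots> = epow (?c * B) (g - 1) * B"
    unfolding B_def char_on_def by (subst nn_integral_cmult) auto
  also have "\<dots> = ennreal (2 powr ((g - 1) / (1 - k))) * epow B g"
    using g k epow_add[of "g - 1" 1 B] by (simp add: epow_mult epow_ennreal powr_powr ac_simps)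
  finally show ?thesis unfolding B_def .
qed

end

section \<open>Discretised inequality: sufficiency\<close>

lemma isum_indicator_singleton: "isum (\<lambda>j. c j * indicator {k} j) = c k"
proof -
  have "isum (\<lambda>j. c j * indicator {k} j) = isum (\<lambda>j. c k * indicator {k} j)"
    by (intro nn_integral_cong) (auto split: split_indicator)
  then show ?thesis by (simp add: isum_cmult)
qed

lemma nn_integral_blocks:
  fixes A :: "int \<Rightarrow> 'a set"
  assumes [measurable]: "\<And>k. A k \<in> sets M" "f \<in> borel_measurable M"
    and disj: "\<And>x j k. x \<in> A j \<Longrightarrow> x \<in> A k \<Longrightarrow> j = k" and cover: "AE x in M. x \<in> (\<Union>k. A k)"
  shows "(\<integral>\<^sup>+x. f x \<partial>M) = isum (\<lambda>k. \<integral>\<^sup>+x\<in>A k. f x \<partial>M)"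
proof -
  have "(\<integral>\<^sup>+x. f x \<partial>M) = (\<integral>\<^sup>+x. isum (\<lambda>k. f x * indicator (A k) x) \<partial>M)"
  proof (intro nn_integral_cong_AE, use cover in eventually_elim)
    fix x assume "x \<in> (\<Union>k. A k)"
    then obtain k where k: "x \<in> A k" by blast
    have "isum (\<lambda>j. f x * indicator (A j) x) = isum (\<lambda>j. f x * indicator {k} j)"
    proof (intro nn_integral_cong)
      fix j
      have "x \<in> A j \<longleftrightarrow> j = k" using disj[OF k, of j] k by blast
      then show "f x * indicator (A j) x = f x * indicator {k} j" by (auto split: split_indicator)
    qed
    then show "f x = isum (\<lambda>j. f x * indicator (A j) x)"
      by (simp add: isum_cmult)
  qed
  also have "\<dots> = isum (\<lambda>k. \<integral>\<^sup>+x\<in>A k. f x \<partial>M)"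
    by (rule nn_integral_count_space_nn_integral) auto
  finally show ?thesis .
qed

section \<open>Point masses on the integers\<close>

lemma discrete_pair:
  fixes m s :: "int \<Rightarrow> ennreal"
  assumes "\<And>k. m k < top" "\<And>k. s k < top"
  shows "measure_pair (density (count_space UNIV) m) (density (count_space UNIV) s)"
proof -
  interpret sigma_finite_measure "count_space (UNIV :: int set)"
    by (rule sigma_finite_measure_count_space)
  have "sigma_finite_measure (density (count_space UNIV) m)" "sigma_finite_measure (density (count_space UNIV) s)"
    using assms by (subst sigma_finite_iff_density_finite; simp add: AE_count_space less_top)+
  then show ?thesis by (simp add: measure_pair_def)
qed

definition discrete_char :: "real \<Rightarrow> real \<Rightarrow> (int \<Rightarrow> ennreal) \<Rightarrow> (int \<Rightarrow> ennreal) \<Rightarrow> ennreal" where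
  "discrete_char k th m s = isum (\<lambda>i. m i * (epow (\<integral>\<^sup>+j\<in>{i..}. m j \<partial>count_space UNIV) (k / (1 - k))
     * epow (\<integral>\<^sup>+j\<in>{..<i}. s j \<partial>count_space UNIV) th))"

lemma nn_integral_density_count_space:
  "(\<integral>\<^sup>+k. f k \<partial>density (count_space UNIV) m) = (\<integral>\<^sup>+k. m k * f k \<partial>count_space UNIV)"
  by (simp add: nn_integral_density)

lemma nn_integral_density_count_space_set:
  "(\<integral>\<^sup>+k\<in>E. f k \<partial>density (count_space UNIV) m) = (\<integral>\<^sup>+k\<in>E. m k * f k \<partial>count_space UNIV)"
  by (simp add: nn_integral_density_count_space mult.assoc)

lemma hardy_char_discrete:
  fixes m s :: "int \<Rightarrow> ennreal"
  assumes "\<And>k. m k < top" "\<And>k. s k < top"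
  shows "measure_pair.hardy_char (density (count_space UNIV) m) (density (count_space UNIV) s) k th = discrete_char k th m s"
proof -
  note mp = discrete_pair[OF assms]
  show ?thesis
    unfolding measure_pair.hardy_char_def[OF mp] measure_pair.Uc_def[OF mp]
      measure_pair.No_def[OF mp] discrete_char_def nn_integral_density_count_space
    by (simp add: emeasure_density)
qed

lemma discrete_sufficient:
  fixes m s :: "int \<Rightarrow> ennreal"
  assumes fin: "\<And>k. m k < top" "\<And>k. s k < top"
    and \<rho>: "0 < \<rho>" "\<rho> \<le> \<kappa>" "\<kappa> < 1" and th: "\<theta> = \<kappa> * (1 - \<rho>) / (\<rho> * (1 - \<kappa>))"
  shows "isum (\<lambda>k. m k * epow (\<integral>\<^sup>+j\<in>{..<k}. s j * epow (g j) \<rho> \<partial>count_space UNIV) (\<kappa> / \<rho>))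
    \<le> ennreal (hardy_const \<rho> \<kappa>) * epow (isum (\<lambda>j. s j * g j)) \<kappa> * epow (discrete_char \<kappa> \<theta> m s) (1 - \<kappa>)"
proof -
  have "g \<in> borel_measurable (density (count_space UNIV) s)" by simp
  from measure_pair.hardy_sufficient[OF discrete_pair[OF fin] \<rho> this th]
  show ?thesis
    unfolding hardy_char_discrete[OF fin] nn_integral_density_count_space_set nn_integral_density_count_space .
qed

lemma discrete_necessary:
  fixes m s :: "int \<Rightarrow> ennreal"
  assumes fin: "\<And>k. m k < top" "\<And>k. s k < top"
    and \<rho>: "0 < \<rho>" "\<rho> \<le> \<kappa>" "\<kappa> < 1" and th: "\<theta> = \<kappa> * (1 - \<rho>) / (\<rho> * (1 - \<kappa>))"
    and K: "\<And>g. isum (\<lambda>k. m k * epow (\<integral>\<^sup>+j\<in>{..<k}. s j * epow (g j) \<rho> \<partial>count_space UNIV) (\<kappa> / \<rho>))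
      \<le> K * epow (isum (\<lambda>j. s j * g j)) \<kappa>"
  shows "epow (discrete_char \<kappa> \<theta> m s) (1 - \<kappa>) \<le> ennreal (2 powr (\<theta> + \<kappa> / (1 - \<kappa>))) * K"
  unfolding hardy_char_discrete[OF fin, symmetric]
proof (rule measure_pair.hardy_necessary[OF discrete_pair[OF fin] \<rho> th])
  show "(\<integral>\<^sup>+t. epow (\<integral>\<^sup>+y\<in>{..<t}. epow (g y) \<rho> \<partial>density (count_space UNIV) s) (\<kappa> / \<rho>) \<partial>density (count_space UNIV) m)
    \<le> K * epow (\<integral>\<^sup>+y. g y \<partial>density (count_space UNIV) s) \<kappa>" for g
    unfolding nn_integral_density_count_space_set nn_integral_density_count_space by (rule K)
qed

text \<open>Blocks may be empty. The index runs over all integers because the tail of w tends to 0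
  at b and may tend to \<infinity> at a.\<close>

locale blocks = measure_pair +
  fixes A :: "int \<Rightarrow> 'a set" and p q r :: real
  assumes A_sets [measurable, simp]: "\<And>k. A k \<in> sets \<nu>"
    and A_less: "\<And>x y j k. x \<in> A j \<Longrightarrow> y \<in> A k \<Longrightarrow> j < k \<Longrightarrow> x < y"
    and cover_\<mu>: "AE x in \<mu>. x \<in> (\<Union>k. A k)" and cover_\<nu>: "AE x in \<nu>. x \<in> (\<Union>k. A k)"
    and r: "0 < r" and rq: "r \<le> q" and qp: "q < p" and p: "p < 1"
begin

lemma A_sets' [measurable, simp]: "A k \<in> sets \<mu>" using A_sets sets_eq by simp

lemma A_disj: "x \<in> A j \<Longrightarrow> x \<in> A k \<Longrightarrow> j = k"
  using A_less[of x j x k] A_less[of x k x j] by (cases j k rule: linorder_cases) auto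

lemma params: "0 < q" "0 < p" "q < 1" "r < 1" "r < p"
  using r rq qp p by auto

definition T :: "int \<Rightarrow> 'a set" where "T k = (\<Union>j\<in>{k..}. A j)"

lemma T_sets [measurable, simp]: "T k \<in> sets \<nu>" "T k \<in> sets \<mu>"
  unfolding T_def by (auto intro!: sets.countable_UN')

text \<open>\<open>th\<close> and \<open>th'\<close> are the exponent \<theta> of the two-measure
  inequality for (r,q) and for (r/p,q/p). \<open>al\<close> and \<open>gm\<close> arise from
  2^(kq/p) and from the power 1-q of the functional by raising to p/(p-q), the exponent conjugate to
  p/q. \<open>al'\<close> and \<open>th2\<close> arise likewise, with r in place of q, from 2^(jr/p)
  and \<nu>(A j)^(1-r).\<close>

abbreviation "th \<equiv> q * (1 - r) / (r * (1 - q))"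
abbreviation "gm \<equiv> p * (1 - q) / (p - q)"
abbreviation "al \<equiv> q / (p - q)"
abbreviation "th' \<equiv> q * (p - r) / (r * (p - q))"
abbreviation "th2 \<equiv> (1 - r) * p / (p - r)"
abbreviation "al' \<equiv> r / (p - r)"

text \<open>\<open>L\<close> and \<open>R\<close> are the \<open>q\<close>-th and \<open>p\<close>-th powers of the two sides of the inequality, the right one in
  discretised form; \<open>S5\<close> and \<open>S6\<close> are the discrete counterparts of the powers \<open>p q / (p - q)\<close> of
  \<open>C5\<close> and \<open>C6\<close>, and \<open>S5'\<close> is the part of \<open>S5\<close> that sees \<open>\<nu>\<close> in one block only. An infinite
  \<open>\<mu>(A k)\<close>, which can occur for the first block, is replaced by 0 in \<open>m\<close> to keep the discrete measure
  \<open>\<sigma>\<close>-finite; under \<open>regular_blocks\<close> it only multiplies empty sums.\<close>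

definition "s j = pw al' j * epow (emeasure \<nu> (A j)) th2"
definition "m k = (if emeasure \<mu> (A k) = top then 0 else emeasure \<mu> (A k))"
definition "R g = isum (\<lambda>k. pw (- 1) k * epow (\<integral>\<^sup>+y\<in>A k. g y \<partial>\<nu>) p)"
definition "L g = (\<integral>\<^sup>+t. epow (\<integral>\<^sup>+y\<in>{..<t}. epow (g y) r \<partial>\<nu>) (q / r) \<partial>\<mu>)"
definition "S5 = isum (\<lambda>k. pw al k * epow (char_on q th (T k)) gm)"
definition "S5' = isum (\<lambda>k. pw al k * epow (char_on q th (A k)) gm)"
definition "S6 = discrete_char (q / p) th' m s"

text \<open>To be deduced from finiteness of \<open>S5'\<close> in \<open>regular_blocksI\<close>.
  The second clause says that beyond a block with \<nu>-mass no block has infinite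
  \<mu>-mass.\<close>

definition "regular_blocks \<longleftrightarrow> (\<forall>k. emeasure \<nu> (A k) < top) \<and>
  (\<forall>j k. j < k \<longrightarrow> emeasure \<nu> (A j) \<noteq> 0 \<longrightarrow> emeasure \<mu> (A k) < top)"

lemma exps: "0 < th" "1 \<le> gm" "0 < al" "0 < th'" "0 < th2" "0 < al'"
  using r rq qp p params by (auto simp: field_simps)

lemma emeasure_T:
  assumes "S \<in> sets \<nu>"
  shows "emeasure \<nu> (T k \<inter> S) = (\<integral>\<^sup>+j\<in>{k..}. emeasure \<nu> (A j \<inter> S) \<partial>count_space UNIV)"
    and "emeasure \<mu> (T k \<inter> S) = (\<integral>\<^sup>+j\<in>{k..}. emeasure \<mu> (A j \<inter> S) \<partial>count_space UNIV)"
proof -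
  note [measurable] = assms
  have [measurable]: "S \<in> sets \<mu>" using assms sets_eq by simp
  have ind: "indicator (T k \<inter> S) x * indicator (A j) x = indicator (A j \<inter> S) x * (indicator {k..} j :: ennreal)" for x j
    unfolding T_def by (auto split: split_indicator dest: A_disj)
  show "emeasure \<nu> (T k \<inter> S) = (\<integral>\<^sup>+j\<in>{k..}. emeasure \<nu> (A j \<inter> S) \<partial>count_space UNIV)"
    using nn_integral_blocks[of A \<nu> "indicator (T k \<inter> S)"] A_disj cover_\<nu> by (simp add: ind nn_integral_multc)
  show "emeasure \<mu> (T k \<inter> S) = (\<integral>\<^sup>+j\<in>{k..}. emeasure \<mu> (A j \<inter> S) \<partial>count_space UNIV)"
    using nn_integral_blocks[of A \<mu> "indicator (T k \<inter> S)"] A_disj cover_\<mu> by (simp add: ind nn_integral_multc)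
qed

text \<open>Earlier blocks enter whole, the block of t only up to t: the source of the global and of
  the local part.\<close>

lemma lessThan_split:
  assumes [measurable]: "h \<in> borel_measurable \<nu>" and t: "t \<in> A k"
  shows "(\<integral>\<^sup>+y\<in>{..<t}. h y \<partial>\<nu>) = (\<integral>\<^sup>+j\<in>{..<k}. (\<integral>\<^sup>+y\<in>A j. h y \<partial>\<nu>) \<partial>count_space UNIV) + (\<integral>\<^sup>+y\<in>A k \<inter> {..<t}. h y \<partial>\<nu>)"
proof -
  have "(\<integral>\<^sup>+y\<in>{..<t}. h y \<partial>\<nu>) = isum (\<lambda>j. \<integral>\<^sup>+y\<in>A j. h y * indicator {..<t} y \<partial>\<nu>)"
    using A_disj cover_\<nu> by (intro nn_integral_blocks) auto
  also have "\<dots> = isum (\<lambda>j. (\<integral>\<^sup>+y\<in>A j. h y \<partial>\<nu>) * indicator {..<k} j + (\<integral>\<^sup>+y\<in>A j \<inter> {..<t}. h y \<partial>\<nu>) * indicator {k} j)"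
  proof (intro nn_integral_cong)
    fix j
    show "(\<integral>\<^sup>+y\<in>A j. h y * indicator {..<t} y \<partial>\<nu>)
      = (\<integral>\<^sup>+y\<in>A j. h y \<partial>\<nu>) * indicator {..<k} j + (\<integral>\<^sup>+y\<in>A j \<inter> {..<t}. h y \<partial>\<nu>) * indicator {k} j"
    proof (cases j k rule: linorder_cases)
      case less
      then have "A j \<subseteq> {..<t}" using A_less[OF _ t] by auto
      then have "(\<integral>\<^sup>+y\<in>A j. h y * indicator {..<t} y \<partial>\<nu>) = (\<integral>\<^sup>+y\<in>A j. h y \<partial>\<nu>)"
        by (intro nn_integral_cong) (auto split: split_indicator)
      then show ?thesis using less by simp
    next
      case equal
      have "(\<integral>\<^sup>+y\<in>A j. h y * indicator {..<t} y \<partial>\<nu>) = (\<integral>\<^sup>+y\<in>A j \<inter> {..<t}. h y \<partial>\<nu>)"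
        by (intro nn_integral_cong) (auto split: split_indicator)
      then show ?thesis using equal by simp
    next
      case greater
      have "(\<integral>\<^sup>+y\<in>A j. h y * indicator {..<t} y \<partial>\<nu>) = (\<integral>\<^sup>+y. 0 \<partial>\<nu>)"
        using A_less[OF t _ greater] by (intro nn_integral_cong) (auto split: split_indicator dest: less_asym)
      then show ?thesis using greater by simp
    qed
  qed
  finally show ?thesis
    by (simp add: isum_add isum_indicator_singleton)
qed

lemma lessThan_int_ge:
  assumes [measurable]: "h \<in> borel_measurable \<nu>"
  shows "isum (\<lambda>j. \<integral>\<^sup>+y\<in>A j \<inter> {..<t}. h y \<partial>\<nu>) = (\<integral>\<^sup>+y\<in>{..<t}. h y \<partial>\<nu>)"
proof -
  have "(\<integral>\<^sup>+y\<in>{..<t}. h y \<partial>\<nu>) = isum (\<lambda>j. \<integral>\<^sup>+y\<in>A j. h y * indicator {..<t} y \<partial>\<nu>)"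
    using A_disj cover_\<nu> by (intro nn_integral_blocks) auto
  also have "\<dots> = isum (\<lambda>j. \<integral>\<^sup>+y\<in>A j \<inter> {..<t}. h y \<partial>\<nu>)"
    by (intro nn_integral_cong) (auto split: split_indicator)
  finally show ?thesis by simp
qed

lemma measurable_int_inter [measurable]:
  assumes "E \<in> sets \<nu>"
  shows "(\<lambda>t. \<integral>\<^sup>+y\<in>E \<inter> {..<t}. h y \<partial>\<nu>) \<in> borel_measurable \<nu>"
  by (intro measurable_mono) (auto simp: mono_def intro!: nn_integral_mono split: split_indicator)

lemma measurable_emeasure_inter [measurable]:
  assumes "E \<in> sets \<nu>"
  shows "(\<lambda>t. emeasure \<nu> (E \<inter> {..<t})) \<in> borel_measurable \<nu>"
  using assms by (intro measurable_mono) (auto simp: mono_def intro!: emeasure_mono)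

lemma s_fin: "regular_blocks \<Longrightarrow> s k < top" 
  using exps(5) by (auto simp: regular_blocks_def s_def ennreal_mult_less_top epow_less_top)

lemma m_fin: "m k < top" by (simp add: m_def less_top)

lemma Holder_block:
  assumes [measurable]: "g \<in> borel_measurable \<nu>"
  shows "(\<integral>\<^sup>+y\<in>A j. epow (g y) r \<partial>\<nu>) \<le> epow (\<integral>\<^sup>+y\<in>A j. g y \<partial>\<nu>) r * epow (emeasure \<nu> (A j)) (1 - r)"
proof -
  have "(\<integral>\<^sup>+y\<in>A j. epow (g y) r \<partial>\<nu>) = (\<integral>\<^sup>+y. epow (g y * indicator (A j) y) r * epow (indicator (A j) y) (1 - r) \<partial>\<nu>)"
    using r by (intro nn_integral_cong) (auto split: split_indicator simp: epow_zero)
  also have "\<dots> \<le> epow (\<integral>\<^sup>+y\<in>A j. g y \<partial>\<nu>) r * epow (\<integral>\<^sup>+y. indicator (A j) y \<partial>\<nu>) (1 - r)"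
    using r params by (intro nn_integral_Holder) auto
  finally show ?thesis by simp
qed

text \<open>This identity dictates the exponents in \<open>s\<close>: if s_j g_j = 2^(-j) G_j^p,
  then the Hoelder bound G_j^r \<nu>(A j)^(1-r) is exactly s_j g_j^(r/p).\<close>

lemma s_power: "epow (s j) (1 - r / p) = pw (r / p) j * epow (emeasure \<nu> (A j)) (1 - r)"
proof -
  have "al' * (1 - r / p) = r / p" "th2 * (1 - r / p) = 1 - r"
    using params r by (auto simp: divide_simps)
  then show ?thesis
    using params by (simp add: s_def epow_mult epow_pw epow_epow)
qed

lemma R_power: "epow (pw (- 1) j * epow x p) (r / p) = pw (- (r / p)) j * epow x r"
  using params r by (simp add: epow_mult epow_pw epow_epow)

lemma disc_th: "th' = q / p * (1 - r / p) / (r / p * (1 - q / p))"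
  using params r qp by (simp add: divide_simps)

text \<open>Separating the global from the local part costs 2^(q/r). The local bounds are summed by
  Hoelder's inequality for sequences with weights q/p and 1-q/p; the global part is an instance of
  \<open>discrete_sufficient\<close>.\<close>

lemma block_sufficient:
  assumes g [measurable]: "g \<in> borel_measurable \<nu>" and reg: regular_blocks
  shows "L g \<le> ennreal (2 powr (q / r) * (hardy_const r q + hardy_const (r / p) (q / p)))
     * epow (R g) (q / p) * (epow S5' (1 - q / p) + epow S6 (1 - q / p))"
proof -
  let ?h = "\<lambda>y. epow (g y) r"
  let ?G = "\<lambda>j. \<integral>\<^sup>+y\<in>A j. ?h y \<partial>\<nu>" and ?F = "\<lambda>j. \<integral>\<^sup>+y\<in>A j. g y \<partial>\<nu>"
  let ?P = "\<lambda>k. \<integral>\<^sup>+j\<in>{..<k}. ?G j \<partial>count_space UNIV"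
  let ?Q = "\<lambda>k t. \<integral>\<^sup>+y\<in>A k \<inter> {..<t}. ?h y \<partial>\<nu>"
  define e where "e = q / r"
  have e: "1 \<le> e" using r rq by (simp add: e_def)
  have mL: "(\<lambda>t. epow (\<integral>\<^sup>+y\<in>{..<t}. ?h y \<partial>\<nu>) e) \<in> borel_measurable \<mu>"
    by (intro measurable_epow measurable_change[OF measurable_int_lessThan])
  have mQ [measurable]: "?Q k \<in> borel_measurable \<mu>" for k
    by (rule measurable_change) measurable
  have "L g = isum (\<lambda>k. \<integral>\<^sup>+t\<in>A k. epow (\<integral>\<^sup>+y\<in>{..<t}. ?h y \<partial>\<nu>) e \<partial>\<mu>)"
    unfolding L_def e_def[symmetric] using mL A_disj cover_\<mu> by (intro nn_integral_blocks) auto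
  also have "\<dots> \<le> isum (\<lambda>k. ennreal (2 powr e) * (emeasure \<mu> (A k) * epow (?P k) e + (\<integral>\<^sup>+t\<in>A k. epow (?Q k t) e \<partial>\<mu>)))"
  proof (intro isum_mono)
    fix k
    have "(\<integral>\<^sup>+t\<in>A k. epow (\<integral>\<^sup>+y\<in>{..<t}. ?h y \<partial>\<nu>) e \<partial>\<mu>)
      \<le> (\<integral>\<^sup>+t. ennreal (2 powr e) * (epow (?P k) e * indicator (A k) t + epow (?Q k t) e * indicator (A k) t) \<partial>\<mu>)"
    proof (intro nn_integral_mono)
      fix t
      show "epow (\<integral>\<^sup>+y\<in>{..<t}. ?h y \<partial>\<nu>) e * indicator (A k) t
        \<le> ennreal (2 powr e) * (epow (?P k) e * indicator (A k) t + epow (?Q k t) e * indicator (A k) t)"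
        using e epow_add_le[of e "?P k" "?Q k t"] by (auto simp: lessThan_split split: split_indicator)
    qed
    also have "\<dots> = ennreal (2 powr e) * (emeasure \<mu> (A k) * epow (?P k) e + (\<integral>\<^sup>+t\<in>A k. epow (?Q k t) e \<partial>\<mu>))"
      by (simp add: nn_integral_cmult nn_integral_add nn_integral_cmult_indicator mult.commute[of "emeasure _ _"])
    finally show "(\<integral>\<^sup>+t\<in>A k. epow (\<integral>\<^sup>+y\<in>{..<t}. ?h y \<partial>\<nu>) e \<partial>\<mu>)
      \<le> ennreal (2 powr e) * (emeasure \<mu> (A k) * epow (?P k) e + (\<integral>\<^sup>+t\<in>A k. epow (?Q k t) e \<partial>\<mu>))" .
  qed
  also have "\<dots> = ennreal (2 powr e) * (isum (\<lambda>k. emeasure \<mu> (A k) * epow (?P k) e) + isum (\<lambda>k. \<integral>\<^sup>+t\<in>A k. epow (?Q k t) e \<partial>\<mu>))"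
    by (simp add: isum_cmult isum_add)
  also have "isum (\<lambda>k. \<integral>\<^sup>+t\<in>A k. epow (?Q k t) e \<partial>\<mu>)
    \<le> ennreal (hardy_const r q) * (epow (R g) (q / p) * epow S5' (1 - q / p))"
  proof -
    have "isum (\<lambda>k. \<integral>\<^sup>+t\<in>A k. epow (?Q k t) e \<partial>\<mu>)
      \<le> isum (\<lambda>k. ennreal (hardy_const r q) * (epow (pw (- 1) k * epow (?F k) p) (q / p) * epow (pw al k * epow (char_on q th (A k)) gm) (1 - q / p)))"
    proof (intro isum_mono)
      fix k
      have "(\<integral>\<^sup>+t\<in>A k. epow (?Q k t) e \<partial>\<mu>) \<le> (\<integral>\<^sup>+t. epow (?Q k t) (q / r) \<partial>\<mu>)"
        unfolding e_def by (intro nn_integral_mono) (auto split: split_indicator)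
      also have "\<dots> \<le> ennreal (hardy_const r q) * epow (?F k) q * epow (char_on q th (A k)) (1 - q)"
        using r rq params by (intro hardy_sufficient_on) auto
      \<comment> \<open>The factors 2^(-kq/p) and 2^(kq/p) cancel; they are inserted to split the
        bound into a term of \<open>R\<close> and one of \<open>S5'\<close>.\<close>
      also have "\<dots> = ennreal (hardy_const r q) * (epow (pw (- 1) k * epow (?F k) p) (q / p) * epow (pw al k * epow (char_on q th (A k)) gm) (1 - q / p))"
      proof -
        have nn: "0 \<le> 1 - q / p" using params qp by simp
        have 1: "al * (1 - q / p) = q / p" "gm * (1 - q / p) = 1 - q"
          using params qp by (auto simp: divide_simps)
        have "epow (pw al k * epow (char_on q th (A k)) gm) (1 - q / p) = pw (q / p) k * epow (char_on q th (A k)) (1 - q)"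
          by (simp only: epow_mult[OF nn] epow_pw epow_epow 1)
        moreover have "epow (pw (- 1) k * epow (?F k) p) (q / p) = pw (- (q / p)) k * epow (?F k) q"
          using params by (simp add: epow_mult epow_pw epow_epow)
        moreover have "(a * x) * (b * y) = (a * b) * (x * y)" for a b x y :: ennreal
          by (simp add: ac_simps)
        ultimately show ?thesis by (simp add: pw_mult pw_mult_assoc mult.assoc)
      qed
      finally show "(\<integral>\<^sup>+t\<in>A k. epow (?Q k t) e \<partial>\<mu>) \<le> ennreal (hardy_const r q) * (epow (pw (- 1) k * epow (?F k) p) (q / p) * epow (pw al k * epow (char_on q th (A k)) gm) (1 - q / p))" .
    qed
    also have "\<dots> \<le> ennreal (hardy_const r q) * (epow (R g) (q / p) * epow S5' (1 - q / p))"
      unfolding isum_cmult R_def S5'_def using params qp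
      by (intro mult_left_mono nn_integral_Holder) auto
    finally show ?thesis .
  qed
  also have "isum (\<lambda>k. emeasure \<mu> (A k) * epow (?P k) e)
    \<le> ennreal (hardy_const (r / p) (q / p)) * (epow (R g) (q / p) * epow S6 (1 - q / p))"
  proof -
    define a where "a j = pw (- 1) j * epow (?F j) p" for j
    \<comment> \<open>Solved from s_j g_j = a_j; where s_j = 0 the product s_j g_j is 0 by
      convention and stays below a_j.\<close>
    let ?g = "\<lambda>j. a j * epow (s j) (- 1)"
    have G: "?G j \<le> s j * epow (?g j) (r / p)" for j
    proof (cases "s j = 0")
      case True
      then have "emeasure \<nu> (A j) = 0" using exps by (simp add: s_def epow_eq_0_iff)
      then have "epow (emeasure \<nu> (A j)) (1 - r) = 0" using params by (simp add: epow_zero)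
      then show ?thesis using Holder_block[OF g, of j] by simp
    next
      case False
      then have s: "0 < s j" "s j < top" using s_fin[OF reg] by (auto simp: zero_less_iff_neq_zero)
      have "s j * epow (?g j) (r / p) = epow (a j) (r / p) * (epow (s j) 1 * epow (s j) (- (r / p)))"
        using params r by (simp add: epow_mult epow_epow ac_simps)
      also have "epow (s j) 1 * epow (s j) (- (r / p)) = epow (s j) (1 - r / p)"
        by (subst epow_add'[OF s, symmetric]) simp
      also have "epow (a j) (r / p) * epow (s j) (1 - r / p) = epow (?F j) r * epow (emeasure \<nu> (A j)) (1 - r)"
      proof -
        have "(b * x) * (c * y) = (b * c) * (x * y)" for b c x y :: ennreal
          by (simp add: ac_simps)
        then show ?thesis by (simp add: s_power a_def R_power pw_mult)
      qed
      finally show ?thesis using Holder_block[OF g, of j] by simp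
    qed
    \<comment> \<open>If \<mu>(A k) is infinite, no earlier block carries \<nu>-mass; then
      \<open>?P k\<close> is 0 and replacing the mass by 0 changes nothing.\<close>
    have "isum (\<lambda>k. emeasure \<mu> (A k) * epow (?P k) e) = isum (\<lambda>k. m k * epow (?P k) e)"
    proof (intro nn_integral_cong)
      fix k
      show "emeasure \<mu> (A k) * epow (?P k) e = m k * epow (?P k) e"
      proof (cases "emeasure \<mu> (A k) = top")
        case True
        then have z: "emeasure \<nu> (A j) = 0" if "j < k" for j
          using reg that by (force simp: regular_blocks_def)
        have "?G j * indicator {..<k} j = 0" for j
        proof (cases "j < k")
          case True
          then have "epow (emeasure \<nu> (A j)) (1 - r) = 0" using params z by (simp add: epow_zero)
          then show ?thesis using Holder_block[OF g, of j] by simp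
        qed simp
        then have "?P k = isum (\<lambda>j. 0)" by (intro nn_integral_cong) simp
        then have "?P k = 0" by simp
        then show ?thesis using e by (simp add: epow_zero)
      qed (simp add: m_def)
    qed
    also have "\<dots> \<le> isum (\<lambda>k. m k * epow (\<integral>\<^sup>+j\<in>{..<k}. s j * epow (?g j) (r / p) \<partial>count_space UNIV) e)"
      using e G by (intro isum_mono mult_left_mono epow_mono mult_right_mono) auto
    also have "\<dots> \<le> ennreal (hardy_const (r / p) (q / p)) * epow (isum (\<lambda>j. s j * ?g j)) (q / p) * epow S6 (1 - q / p)"
    proof -
      have e2: "e = (q / p) / (r / p)" using params by (simp add: e_def)
      show ?thesis unfolding S6_def e2 using params r rq qp
        by (intro discrete_sufficient m_fin s_fin reg disc_th) (auto simp: divide_right_mono)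
    qed
    also have "\<dots> \<le> ennreal (hardy_const (r / p) (q / p)) * epow (R g) (q / p) * epow S6 (1 - q / p)"
    proof -
      have "s j * ?g j \<le> a j" for j
      proof (cases "s j = 0")
        case False
        then have s: "0 < s j" "s j < top" using s_fin[OF reg] by (auto simp: zero_less_iff_neq_zero)
        have "s j * ?g j = a j * (epow (s j) 1 * epow (s j) (- 1))" by (simp add: ac_simps)
        also have "\<dots> = a j" by (subst epow_add'[OF s, symmetric]) simp
        finally show ?thesis by simp
      qed simp
      then have "isum (\<lambda>j. s j * ?g j) \<le> R g" unfolding R_def a_def[symmetric] by (rule isum_mono)
      then show ?thesis using params by (intro mult_right_mono mult_left_mono epow_mono) auto
    qed
    finally show ?thesis by (simp add: mult.assoc)
  qed
  finally have "L g \<le> ennreal (2 powr e) * (ennreal (hardy_const (r / p) (q / p)) * (epow (R g) (q / p) * epow S6 (1 - q / p))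
     + ennreal (hardy_const r q) * (epow (R g) (q / p) * epow S5' (1 - q / p)))"
    by (simp add: add_mono mult_left_mono)
  also have "\<dots> \<le> ennreal (2 powr e) * (ennreal (hardy_const r q + hardy_const (r / p) (q / p)) * (epow (R g) (q / p) * epow S6 (1 - q / p))
     + ennreal (hardy_const r q + hardy_const (r / p) (q / p)) * (epow (R g) (q / p) * epow S5' (1 - q / p)))"
    using hardy_const_pos[of r q] hardy_const_pos[of "r / p" "q / p"] params r
    by (intro mult_left_mono add_mono mult_right_mono ennreal_leI) auto
  also have "\<dots> = ennreal (2 powr (q / r) * (hardy_const r q + hardy_const (r / p) (q / p)))
     * epow (R g) (q / p) * (epow S5' (1 - q / p) + epow S6 (1 - q / p))"
    using hardy_const_pos[of r q] hardy_const_pos[of "r / p" "q / p"] params r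
    by (simp add: ennreal_mult e_def distrib_left ac_simps)
  finally show ?thesis .
qed

end

section \<open>Discretised inequality: necessity\<close>

context blocks
begin

definition "\<Phi> k g = (\<integral>\<^sup>+t. epow (\<integral>\<^sup>+y\<in>A k \<inter> {..<t}. epow (g y) r \<partial>\<nu>) (q / r) \<partial>\<mu>)"
text \<open>The best constant of the local inequality for block k, normalised through
  homogeneity.\<close>

definition "\<D> k = (SUP g\<in>{g \<in> borel_measurable \<nu>. (\<integral>\<^sup>+y\<in>A k. g y \<partial>\<nu>) \<le> 1}. \<Phi> k g)"

lemma \<Phi>_scale:
  assumes [measurable]: "g \<in> borel_measurable \<nu>"
  shows "\<Phi> k (\<lambda>y. c * g y) = epow c q * \<Phi> k g"
proof -
  have mQ: "(\<lambda>t. \<integral>\<^sup>+y\<in>A k \<inter> {..<t}. epow (g y) r \<partial>\<nu>) \<in> borel_measurable \<mu>"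
    by (rule measurable_change) measurable
  have "(\<integral>\<^sup>+y\<in>A k \<inter> {..<t}. epow (c * g y) r \<partial>\<nu>) = epow c r * (\<integral>\<^sup>+y\<in>A k \<inter> {..<t}. epow (g y) r \<partial>\<nu>)" for t
    using r by (subst nn_integral_cmult[symmetric]) (auto simp: epow_mult mult.assoc)
  then show ?thesis
    using r rq mQ unfolding \<Phi>_def by (simp add: epow_mult epow_epow nn_integral_cmult)
qed

text \<open>Normalising g requires a positive finite integral; this is why the necessity lemmas ask
  for \<open>K\<close> on functions with finite integral only.\<close>

lemma \<Phi>_le:
  assumes g [measurable]: "g \<in> borel_measurable \<nu>" and fin: "(\<integral>\<^sup>+y\<in>A k. g y \<partial>\<nu>) < top"
  shows "\<Phi> k g \<le> \<D> k * epow (\<integral>\<^sup>+y\<in>A k. g y \<partial>\<nu>) q"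
proof -
  define G where "G = (\<integral>\<^sup>+y\<in>A k. g y \<partial>\<nu>)"
  show ?thesis
  proof (cases "G = 0")
    case True
    then have ae: "AE y in \<nu>. g y * indicator (A k) y = 0"
      unfolding G_def by (subst (asm) nn_integral_0_iff_AE) auto
    have "(\<integral>\<^sup>+y\<in>A k \<inter> {..<t}. epow (g y) r \<partial>\<nu>) = 0" for t
      using ae r by (subst nn_integral_0_iff_AE) (auto simp: epow_zero elim!: eventually_mono split: split_indicator)
    then have "\<Phi> k g = 0" using r rq unfolding \<Phi>_def by (simp add: epow_zero)
    then show ?thesis by simp
  next
    case False
    then have G: "0 < G" "G < top" using fin by (auto simp: G_def zero_less_iff_neq_zero)
    let ?c = "epow G (- 1)"
    have c1: "?c * G = 1" using epow_add'[OF G, of "- 1" 1] by simp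
    have "(\<integral>\<^sup>+y\<in>A k. ?c * g y \<partial>\<nu>) = ?c * G"
      unfolding G_def by (subst nn_integral_cmult[symmetric]) (auto simp: mult.assoc)
    then have "\<Phi> k (\<lambda>y. ?c * g y) \<le> \<D> k"
      unfolding \<D>_def using c1 by (intro SUP_upper) auto
    then have "epow ?c q * \<Phi> k g \<le> \<D> k" by (simp add: \<Phi>_scale)
    then have "epow G q * (epow ?c q * \<Phi> k g) \<le> epow G q * \<D> k" by (rule mult_left_mono) simp
    then have le: "(epow G q * epow ?c q) * \<Phi> k g \<le> \<D> k * epow G q"
      by (simp only: mult.assoc mult.commute[of "\<D> k"])
    have eq: "epow G q * epow ?c q = 1"
      using c1 params by (simp add: epow_mult[symmetric] mult.commute)
    show ?thesis using le unfolding eq by (simp add: G_def)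
  qed
qed

lemma char_on_le_\<D>: "epow (char_on q th (A k)) (1 - q) \<le> ennreal (2 powr (th + q / (1 - q))) * \<D> k"
  using r rq params \<Phi>_le unfolding \<Phi>_def by (intro hardy_necessary_on) auto

text \<open>Pieces living on disjoint blocks are glued by a countable supremum, so measurability is
  immediate; off the blocks the result is 0.\<close>

lemma glue_measurable:
  fixes G :: "int \<Rightarrow> 'a \<Rightarrow> ennreal"
  assumes [measurable]: "\<And>k. G k \<in> borel_measurable \<nu>"
  shows "(\<lambda>y. SUP k. G k y * indicator (A k) y) \<in> borel_measurable \<nu>"
  by (intro borel_measurable_SUP) auto

lemma glue_eq:
  fixes G :: "int \<Rightarrow> 'a \<Rightarrow> ennreal"
  assumes y: "y \<in> A k"
  shows "(SUP k. G k y * indicator (A k) y) = G k y"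
proof (rule antisym)
  have "G j y * indicator (A j) y \<le> G k y" for j
    using A_disj[OF y, of j] by (cases "y \<in> A j") auto
  then show "(SUP k. G k y * indicator (A k) y) \<le> G k y" by (intro SUP_least)
  show "G k y \<le> (SUP k. G k y * indicator (A k) y)"
    using y by (intro SUP_upper2[of k]) auto
qed

text \<open>Near-extremal functions of all local inequalities are glued with amplitudes prescribed
  by \<open>a\<close>. As q/r \<ge> 1, superadditivity bounds the left side below by the sum of the
  local contributions.\<close>

lemma isum_\<D>_le:
  assumes K: "\<And>g. g \<in> borel_measurable \<nu> \<Longrightarrow> L g \<le> K * epow (R g) (q / p)"
  shows "isum (\<lambda>k. epow (a k) (q / p) * (pw (q / p) k * \<D> k)) \<le> K * epow (isum a) (q / p)"
proof -
  define x where "x k = epow (a k) (q / p) * pw (q / p) k" for k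
  have "isum (\<lambda>k. x k * \<D> k) \<le> K * epow (isum a) (q / p)"
    unfolding \<D>_def
  proof (rule isum_SUP_le)
    show "{g \<in> borel_measurable \<nu>. (\<integral>\<^sup>+y\<in>A k. g y \<partial>\<nu>) \<le> 1} \<noteq> {}" for k
      by (auto intro!: exI[of _ "\<lambda>_. 0"])
    fix G assume G: "\<And>k. G k \<in> {g \<in> borel_measurable \<nu>. (\<integral>\<^sup>+y\<in>A k. g y \<partial>\<nu>) \<le> 1}"
    then have [measurable]: "G k \<in> borel_measurable \<nu>" for k by auto
    \<comment> \<open>The amplitude for which block k contributes at most a_k to
      \<open>R\<close>.\<close>
    define c where "c k = epow (pw 1 k * a k) (1 / p)" for k
    define F where "F y = (SUP k. c k * G k y * indicator (A k) y)" for y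
    have F [measurable]: "F \<in> borel_measurable \<nu>" unfolding F_def[abs_def] by (rule glue_measurable) measurable
    have FA: "F y = c k * G k y" if "y \<in> A k" for y k unfolding F_def by (rule glue_eq[OF that])
    have "R F \<le> isum a"
      unfolding R_def
    proof (rule isum_mono)
      fix k
      have "(\<integral>\<^sup>+y\<in>A k. F y \<partial>\<nu>) = (\<integral>\<^sup>+y. c k * (G k y * indicator (A k) y) \<partial>\<nu>)"
        using FA by (intro nn_integral_cong) (auto split: split_indicator)
      also have "\<dots> = c k * (\<integral>\<^sup>+y\<in>A k. G k y \<partial>\<nu>)" by (rule nn_integral_cmult) measurable
      also have "\<dots> \<le> c k * 1" using G[of k] by (intro mult_left_mono) auto
      finally have "epow (\<integral>\<^sup>+y\<in>A k. F y \<partial>\<nu>) p \<le> epow (c k) p" using params by (intro epow_mono) auto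
      also have "\<dots> = pw 1 k * a k" using params by (simp add: c_def epow_epow)
      finally have "pw (- 1) k * epow (\<integral>\<^sup>+y\<in>A k. F y \<partial>\<nu>) p \<le> pw (- 1) k * (pw 1 k * a k)" by (rule mult_left_mono) simp
      then show "pw (- 1) k * epow (\<integral>\<^sup>+y\<in>A k. F y \<partial>\<nu>) p \<le> a k" by (simp add: pw_mult_assoc)
    qed
    have "isum (\<lambda>k. x k * \<Phi> k (G k)) = isum (\<lambda>k. epow (c k) q * \<Phi> k (G k))"
    proof -
      have "x k = epow (c k) q" for k
        using params by (simp add: x_def c_def epow_epow epow_mult epow_pw mult.commute)
      then show ?thesis by simp
    qed
    also have "\<dots> = isum (\<lambda>k. \<Phi> k (\<lambda>y. c k * G k y))" by (simp add: \<Phi>_scale)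
    also have "\<dots> = isum (\<lambda>k. \<Phi> k F)"
    proof -
      have "(\<integral>\<^sup>+y\<in>A k \<inter> {..<t}. epow (c k * G k y) r \<partial>\<nu>) = (\<integral>\<^sup>+y\<in>A k \<inter> {..<t}. epow (F y) r \<partial>\<nu>)" for k t
        using FA by (intro nn_integral_cong) (auto split: split_indicator)
      then show ?thesis unfolding \<Phi>_def by simp
    qed
    also have "\<dots> = (\<integral>\<^sup>+t. isum (\<lambda>k. epow (\<integral>\<^sup>+y\<in>A k \<inter> {..<t}. epow (F y) r \<partial>\<nu>) (q / r)) \<partial>\<mu>)"
      unfolding \<Phi>_def by (rule nn_integral_count_space_nn_integral[symmetric])
        (auto intro!: measurable_epow measurable_change[OF measurable_int_inter])
    also have "\<dots> \<le> L F"
      unfolding L_def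
    proof (rule nn_integral_mono)
      fix t
      have "isum (\<lambda>k. epow (\<integral>\<^sup>+y\<in>A k \<inter> {..<t}. epow (F y) r \<partial>\<nu>) (q / r))
        \<le> epow (isum (\<lambda>k. \<integral>\<^sup>+y\<in>A k \<inter> {..<t}. epow (F y) r \<partial>\<nu>)) (q / r)"
        using r rq by (intro epow_superadditive) auto
      then show "isum (\<lambda>k. epow (\<integral>\<^sup>+y\<in>A k \<inter> {..<t}. epow (F y) r \<partial>\<nu>) (q / r))
        \<le> epow (\<integral>\<^sup>+y\<in>{..<t}. epow (F y) r \<partial>\<nu>) (q / r)"
        by (simp add: lessThan_int_ge)
    qed
    also have "\<dots> \<le> K * epow (R F) (q / p)" by (rule K[OF F])
    also have "\<dots> \<le> K * epow (isum a) (q / p)"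
      using \<open>R F \<le> isum a\<close> params by (intro mult_left_mono epow_mono) auto
    finally show "isum (\<lambda>k. x k * \<Phi> k (G k)) \<le> K * epow (isum a) (q / p)" .
  qed
  then show ?thesis by (simp add: x_def mult.assoc)
qed

text \<open>The tests with all amplitude sequences are dualised by \<open>isum_duality\<close> at
  exponent q/p; its power 1/(1-q/p) = p/(p-q) turns 2^(kq/p) and the power 1-q of the functional
  into the weights of \<open>S5'\<close>.\<close>

lemma block_necessary_local:
  assumes K: "\<And>g. g \<in> borel_measurable \<nu> \<Longrightarrow> L g \<le> K * epow (R g) (q / p)"
  shows "S5' \<le> ennreal (2 powr ((th + q / (1 - q)) * (p / (p - q)))) * epow K (p / (p - q))"
proof -
  let ?E = "1 / (1 - q / p)"
  have qp1: "0 < q / p" "q / p < 1" using params qp by auto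
  have E: "?E = p / (p - q)" "0 \<le> ?E" using params qp by (auto simp: field_simps)
  have E1: "q / p * ?E = al" "(1 - q) * ?E = gm" using params qp by (auto simp: divide_simps)
  let ?c = "ennreal (2 powr (th + q / (1 - q)))"
  have "S5' \<le> isum (\<lambda>k. epow ?c ?E * epow (pw (q / p) k * \<D> k) ?E)"
    unfolding S5'_def
  proof (rule isum_mono)
    fix k
    have "pw al k * epow (char_on q th (A k)) gm = epow (pw (q / p) k) ?E * epow (epow (char_on q th (A k)) (1 - q)) ?E"
      by (simp only: epow_pw epow_epow E1)
    also have "\<dots> \<le> epow (pw (q / p) k) ?E * epow (?c * \<D> k) ?E"
      by (intro mult_left_mono epow_mono char_on_le_\<D> E) simp
    also have "\<dots> = epow ?c ?E * epow (pw (q / p) k * \<D> k) ?E"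
      by (simp only: epow_mult[OF E(2)] ac_simps)
    finally show "pw al k * epow (char_on q th (A k)) gm \<le> epow ?c ?E * epow (pw (q / p) k * \<D> k) ?E" .
  qed
  also have "\<dots> = epow ?c ?E * isum (\<lambda>k. epow (pw (q / p) k * \<D> k) ?E)" by (rule isum_cmult)
  also have "\<dots> \<le> epow ?c ?E * epow K ?E"
    by (intro mult_left_mono isum_duality qp1 isum_\<D>_le K) auto
  also have "epow ?c ?E = ennreal (2 powr ((th + q / (1 - q)) * (p / (p - q))))"
    unfolding E(1) by (subst epow_ennreal) (simp_all add: powr_powr)
  finally show ?thesis unfolding E(1) .
qed

text \<open>Functions constant on each block give equality in \<open>Holder_block\<close>, so every
  test sequence of the discrete inequality is realised by a function; the local part is
  discarded.\<close>

lemma block_necessary_discrete: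
  assumes K: "\<And>g. g \<in> borel_measurable \<nu> \<Longrightarrow> L g \<le> K * epow (R g) (q / p)" and reg: regular_blocks
  shows "S6 \<le> ennreal (2 powr ((th' + al) * (p / (p - q)))) * epow K (p / (p - q))"
proof -
  have qp1: "0 < q / p" "q / p < 1" using params qp by auto
  have e: "(q / p) / (r / p) = q / r" using params by simp
  have test: "isum (\<lambda>k. m k * epow (\<integral>\<^sup>+j\<in>{..<k}. s j * epow (g j) (r / p) \<partial>count_space UNIV) (q / p / (r / p)))
      \<le> K * epow (isum (\<lambda>j. s j * g j)) (q / p)" for g
  proof -
    \<comment> \<open>The height solves 2^(-j) (c_j \<nu>(A j))^p = s_j g_j. On null blocks it is
      set to 0, where \<nu>(A j)^(-1) would be \<infinity>.\<close>
    define c where "c j = (if emeasure \<nu> (A j) = 0 then 0 else epow (pw 1 j * (s j * g j)) (1 / p) * epow (emeasure \<nu> (A j)) (- 1))" for j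
    define F where "F y = (SUP k. c k * indicator (A k) y)" for y
    have F [measurable]: "F \<in> borel_measurable \<nu>" unfolding F_def[abs_def] by (rule glue_measurable) measurable
    have FA: "F y = c k" if "y \<in> A k" for y k unfolding F_def by (rule glue_eq[OF that])
    have fin: "emeasure \<nu> (A j) < top" for j using reg by (simp add: regular_blocks_def)
    have IF: "(\<integral>\<^sup>+y\<in>A k. epow (F y) z \<partial>\<nu>) = epow (c k) z * emeasure \<nu> (A k)" for k z
    proof -
      have "(\<integral>\<^sup>+y\<in>A k. epow (F y) z \<partial>\<nu>) = (\<integral>\<^sup>+y. epow (c k) z * indicator (A k) y \<partial>\<nu>)"
        using FA by (intro nn_integral_cong) (auto split: split_indicator)
      then show ?thesis by (simp add: nn_integral_cmult_indicator)
    qed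
    have RF: "R F \<le> isum (\<lambda>j. s j * g j)"
      unfolding R_def
    proof (rule isum_mono)
      fix k
      have "c k * emeasure \<nu> (A k) \<le> epow (pw 1 k * (s k * g k)) (1 / p)"
      proof (cases "emeasure \<nu> (A k) = 0")
        case False
        then have \<nu>: "0 < emeasure \<nu> (A k)" "emeasure \<nu> (A k) < top" using fin by (auto simp: zero_less_iff_neq_zero)
        have "epow (emeasure \<nu> (A k)) (- 1) * emeasure \<nu> (A k) = 1"
          using epow_add'[OF \<nu>, of "- 1" 1] by simp
        then show ?thesis using False by (simp add: c_def mult.assoc)
      qed simp
      then have "epow (\<integral>\<^sup>+y\<in>A k. F y \<partial>\<nu>) p \<le> epow (epow (pw 1 k * (s k * g k)) (1 / p)) p"
        using params IF[of 1 k] by (intro epow_mono) auto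
      also have "\<dots> = pw 1 k * (s k * g k)" using params by (simp add: epow_epow)
      finally have "pw (- 1) k * epow (\<integral>\<^sup>+y\<in>A k. F y \<partial>\<nu>) p \<le> pw (- 1) k * (pw 1 k * (s k * g k))" by (rule mult_left_mono) simp
      then show "pw (- 1) k * epow (\<integral>\<^sup>+y\<in>A k. F y \<partial>\<nu>) p \<le> s k * g k" by (simp add: pw_mult_assoc)
    qed
    have GF: "(\<integral>\<^sup>+y\<in>A j. epow (F y) r \<partial>\<nu>) = s j * epow (g j) (r / p)" for j
    proof (cases "emeasure \<nu> (A j) = 0")
      case True
      then show ?thesis using exps unfolding IF by (simp add: s_def epow_zero)
    next
      case False
      then have \<nu>: "0 < emeasure \<nu> (A j)" "emeasure \<nu> (A j) < top" using fin by (auto simp: zero_less_iff_neq_zero)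
      have rp: "0 \<le> r / p" "0 \<le> 1 - r / p" using params r by auto
      have "epow (c j) r * emeasure \<nu> (A j) = epow (pw 1 j * (s j * g j)) (r / p) * (epow (emeasure \<nu> (A j)) (- r) * epow (emeasure \<nu> (A j)) 1)"
        using r False by (simp add: c_def epow_mult epow_epow mult.assoc)
      also have "epow (emeasure \<nu> (A j)) (- r) * epow (emeasure \<nu> (A j)) 1 = epow (emeasure \<nu> (A j)) (1 - r)"
        by (subst epow_add'[OF \<nu>, symmetric]) simp
      also have "epow (pw 1 j * (s j * g j)) (r / p) * epow (emeasure \<nu> (A j)) (1 - r)
        = epow (g j) (r / p) * (epow (s j) (r / p) * (pw (r / p) j * epow (emeasure \<nu> (A j)) (1 - r)))"
        using rp by (simp add: epow_mult epow_pw ac_simps)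
      also have "\<dots> = epow (g j) (r / p) * s j"
        unfolding s_power[symmetric] epow_add[OF rp, symmetric] by simp
      finally show ?thesis unfolding IF by (simp add: mult.commute)
    qed
    have mL: "(\<lambda>t. epow (\<integral>\<^sup>+y\<in>{..<t}. epow (F y) r \<partial>\<nu>) (q / r)) \<in> borel_measurable \<mu>"
      by (intro measurable_epow measurable_change[OF measurable_int_lessThan])
    have "isum (\<lambda>k. m k * epow (\<integral>\<^sup>+j\<in>{..<k}. s j * epow (g j) (r / p) \<partial>count_space UNIV) (q / r))
      \<le> isum (\<lambda>k. \<integral>\<^sup>+t\<in>A k. epow (\<integral>\<^sup>+y\<in>{..<t}. epow (F y) r \<partial>\<nu>) (q / r) \<partial>\<mu>)"
    proof (rule isum_mono)
      fix k
      let ?P = "epow (\<integral>\<^sup>+j\<in>{..<k}. s j * epow (g j) (r / p) \<partial>count_space UNIV) (q / r)"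
      have "m k * ?P \<le> ?P * emeasure \<mu> (A k)" by (auto simp: m_def mult.commute)
      also have "\<dots> = (\<integral>\<^sup>+t\<in>A k. ?P \<partial>\<mu>)" by (simp add: nn_integral_cmult_indicator)
      also have "\<dots> \<le> (\<integral>\<^sup>+t\<in>A k. epow (\<integral>\<^sup>+y\<in>{..<t}. epow (F y) r \<partial>\<nu>) (q / r) \<partial>\<mu>)"
        using r rq params by (intro nn_integral_mono)
          (auto split: split_indicator simp: lessThan_split GF intro!: epow_mono)
      finally show "m k * ?P \<le> (\<integral>\<^sup>+t\<in>A k. epow (\<integral>\<^sup>+y\<in>{..<t}. epow (F y) r \<partial>\<nu>) (q / r) \<partial>\<mu>)" .
    qed
    also have "\<dots> = L F"
      unfolding L_def using mL A_disj cover_\<mu> by (intro nn_integral_blocks[symmetric]) auto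
    also have "\<dots> \<le> K * epow (R F) (q / p)" by (rule K[OF F])
    also have "\<dots> \<le> K * epow (isum (\<lambda>j. s j * g j)) (q / p)"
      using RF params by (intro mult_left_mono epow_mono) auto
    finally show ?thesis unfolding e .
  qed
  have "epow S6 (1 - q / p) \<le> ennreal (2 powr (th' + q / p / (1 - q / p))) * K"
    unfolding S6_def using params r rq qp1
    by (intro discrete_necessary[where \<rho> = "r / p"] m_fin s_fin reg disc_th test) (auto simp: divide_right_mono)
  then have S6: "S6 \<le> epow (ennreal (2 powr (th' + q / p / (1 - q / p))) * K) (1 / (1 - q / p))"
    using qp1 by (subst (asm) epow_le_iff) auto
  have E: "q / p / (1 - q / p) = al" "1 / (1 - q / p) = p / (p - q)" using params qp by (auto simp: divide_simps)
  have E0: "0 \<le> p / (p - q)" using params qp by simp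
  have "epow (ennreal (2 powr (th' + al))) (p / (p - q)) = ennreal (2 powr ((th' + al) * (p / (p - q))))"
    by (subst epow_ennreal) (simp_all add: powr_powr)
  then show ?thesis
    using S6 unfolding E epow_mult[OF E0] by simp
qed

text \<open>For t beyond block k the functional contains the full factor \<nu>(A k)^th, so \<nu>(A
  k)^th \<mu>(T (k+1))^(1/(1-q)) is finite. If one factor is nonzero the other is finite; read in
  both ways this gives the two clauses.\<close>

lemma regular_blocksI:
  assumes S: "S5' < top" and pos: "\<And>k. 0 < emeasure \<mu> (T k)"
  shows regular_blocks
proof -
  have fin: "epow (emeasure \<nu> (A k)) th * epow (emeasure \<mu> (T (k + 1))) (1 / (1 - q)) < top" for k
  proof -
    have "pw al k * epow (char_on q th (A k)) gm \<le> S5'"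
      unfolding S5'_def by (rule le_isum[of "\<lambda>k. pw al k * epow (char_on q th (A k)) gm"])
    then have c: "char_on q th (A k) < top"
      using S exps by (auto simp: less_top[symmetric] top_unique epow_top ennreal_mult_top)
    have e: "1 / (1 - q) = q / (1 - q) + 1" using params by (simp add: field_simps)
    have "epow (emeasure \<nu> (A k)) th * epow (emeasure \<mu> (T (k + 1))) (1 / (1 - q))
      \<le> epow (emeasure \<nu> (A k)) th * (ennreal (2 powr (1 / (1 - q))) * (\<integral>\<^sup>+t\<in>T (k + 1). epow (Uc t) (q / (1 - q)) \<partial>\<mu>))"
      using dist_le_power[OF dist_le_Uc, of "q / (1 - q)" "T (k + 1)"] params unfolding e
      by (intro mult_left_mono) auto
    also have "\<dots> = ennreal (2 powr (1 / (1 - q))) * (\<integral>\<^sup>+t. epow (emeasure \<nu> (A k)) th * (epow (Uc t) (q / (1 - q)) * indicator (T (k + 1)) t) \<partial>\<mu>)"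
      by (subst nn_integral_cmult) (auto simp: mult.left_commute)
    also have "(\<integral>\<^sup>+t. epow (emeasure \<nu> (A k)) th * (epow (Uc t) (q / (1 - q)) * indicator (T (k + 1)) t) \<partial>\<mu>) \<le> char_on q th (A k)"
      unfolding char_on_def
    proof (intro nn_integral_mono)
      fix t
      have "A k \<inter> {..<t} = A k" if "t \<in> T (k + 1)"
        using that A_less unfolding T_def by fastforce
      then show "epow (emeasure \<nu> (A k)) th * (epow (Uc t) (q / (1 - q)) * indicator (T (k + 1)) t)
        \<le> epow (Uc t) (q / (1 - q)) * epow (emeasure \<nu> (A k \<inter> {..<t})) th"
        by (auto split: split_indicator simp: mult.commute)
    qed
    also have "ennreal (2 powr (1 / (1 - q))) * char_on q th (A k) < top"
      using c by (simp add: ennreal_mult_less_top)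
    finally show ?thesis by (simp add: mult_left_mono)
  qed
  have q1: "0 < 1 / (1 - q)" using params by simp
  show ?thesis
    unfolding regular_blocks_def
  proof safe
    fix k
    have "epow (emeasure \<mu> (T (k + 1))) (1 / (1 - q)) \<noteq> 0"
      using pos[of "k + 1"] q1 by (simp add: epow_eq_0_iff)
    then show "emeasure \<nu> (A k) < top"
      using fin[of k] exps by (auto simp: less_top[symmetric] epow_top ennreal_top_mult)
  next
    fix j k :: int assume "j < k" "emeasure \<nu> (A j) \<noteq> 0"
    then have "epow (emeasure \<nu> (A j)) th \<noteq> 0" using exps by (simp add: epow_eq_0_iff)
    then have "emeasure \<mu> (T (j + 1)) < top"
      using fin[of j] q1 by (auto simp: less_top[symmetric] epow_top ennreal_mult_top)
    moreover have "emeasure \<mu> (A k) \<le> emeasure \<mu> (T (j + 1))"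
      using \<open>j < k\<close> by (intro emeasure_mono) (auto simp: T_def intro!: bexI[of _ k])
    ultimately show "emeasure \<mu> (A k) < top" by simp
  qed
qed

definition "geo_const = (geom_const (al / (2 * gm) / th) powr th) powr gm
  * (geom_const (al / 2 / 2 / gm) powr gm * geom_const (al / 2 / 2))"

text \<open>The powers th and gm act inside and outside the \<mu>-integral, so \<open>T k\<close> is
  reduced to single blocks twice, and the growth 2^(k al) is shared by both reductions.\<close>

lemma S5_le: "S5 \<le> ennreal geo_const * S5'"
proof -
  \<comment> \<open>Chosen so that d gm = al/2: half of the growth pays for the inner reduction, the
    rest for the outer one.\<close>
  define d where "d = al / (2 * gm)"
  have gm0: "0 \<le> gm" "0 < gm" using exps(2) by linarith+
  have dg: "d * gm = al / 2"
  proof -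
    have "x / (2 * y) * y = x / 2" if "0 < y" for x y :: real using that by simp
    from this[OF gm0(2)] show ?thesis unfolding d_def .
  qed
  have d: "0 < d"
  proof -
    have "0 < x / (2 * y)" if "0 < x" "0 < y" for x y :: real using that by simp
    from this[OF exps(3) gm0(2)] show ?thesis unfolding d_def .
  qed
  let ?c = "geom_const (d / th) powr th"
  let ?ch = "\<lambda>j. char_on q th (A j)"
  have "0 < geom_const (d / th)" using divide_pos_pos[OF d exps(1)] by (rule geom_const_pos)
  then have c: "0 < ?c" unfolding powr_gt_zero by (metis less_irrefl)
  have mN [measurable]: "(\<lambda>t. emeasure \<nu> (E \<inter> {..<t})) \<in> borel_measurable \<mu>" if "E \<in> sets \<nu>" for E
    using that by (intro measurable_change measurable_emeasure_inter)
  have ch: "char_on q th (T k) \<le> ennreal ?c * (pw (- d) k * (\<integral>\<^sup>+j\<in>{k..}. pw d j * ?ch j \<partial>count_space UNIV))" for k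
  proof -
    let ?N = "\<lambda>j t. emeasure \<nu> (A j \<inter> {..<t})"
    have "char_on q th (T k) \<le> (\<integral>\<^sup>+t. ennreal ?c * (isum (\<lambda>j. (pw d (j - k) * indicator {k..} j) * (epow (Uc t) (q / (1 - q)) * epow (?N j t) th))) \<partial>\<mu>)"
      unfolding char_on_def
    proof (intro nn_integral_mono)
      fix t
      have "epow (emeasure \<nu> (T k \<inter> {..<t})) th \<le> ennreal ?c * (\<integral>\<^sup>+j\<in>{k..}. pw d (j - k) * epow (?N j t) th \<partial>count_space UNIV)"
        by (subst emeasure_T, simp, rule epow_isum_atLeast_le[OF exps(1) d])
      then have "epow (Uc t) (q / (1 - q)) * epow (emeasure \<nu> (T k \<inter> {..<t})) th
        \<le> epow (Uc t) (q / (1 - q)) * (ennreal ?c * (\<integral>\<^sup>+j\<in>{k..}. pw d (j - k) * epow (?N j t) th \<partial>count_space UNIV))"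
        by (rule mult_left_mono) simp
      also have "\<dots> = ennreal ?c * isum (\<lambda>j. epow (Uc t) (q / (1 - q)) * (pw d (j - k) * epow (?N j t) th * indicator {k..} j))"
        by (simp add: isum_cmult mult.left_commute)
      also have "\<dots> = ennreal ?c * (isum (\<lambda>j. (pw d (j - k) * indicator {k..} j) * (epow (Uc t) (q / (1 - q)) * epow (?N j t) th)))"
        by (simp only: ac_simps)
      finally show "epow (Uc t) (q / (1 - q)) * epow (emeasure \<nu> (T k \<inter> {..<t})) th
        \<le> ennreal ?c * (isum (\<lambda>j. (pw d (j - k) * indicator {k..} j) * (epow (Uc t) (q / (1 - q)) * epow (?N j t) th)))" .
    qed
    also have "\<dots> = isum (\<lambda>j. \<integral>\<^sup>+t. ennreal ?c * ((pw d (j - k) * indicator {k..} j) * (epow (Uc t) (q / (1 - q)) * epow (?N j t) th)) \<partial>\<mu>)"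
      unfolding isum_cmult[symmetric] by (rule nn_integral_count_space_nn_integral) auto
    also have "\<dots> = isum (\<lambda>j. ennreal ?c * ((pw d (j - k) * indicator {k..} j) * ?ch j))"
      unfolding char_on_def by (simp add: nn_integral_cmult)
    also have "\<dots> = isum (\<lambda>j. ennreal ?c * (pw (- d) k * (pw d j * ?ch j * indicator {k..} j)))"
    proof -
      have "pw d (j - k) = pw (- d) k * pw d j" for j
        by (simp add: pw_def ennreal_mult[symmetric] powr_add[symmetric] algebra_simps)
      then show ?thesis by (simp only: ac_simps)
    qed
    finally show ?thesis by (simp only: isum_cmult)
  qed
  have "S5 \<le> isum (\<lambda>k. pw al k * epow (ennreal ?c * (pw (- d) k * (\<integral>\<^sup>+j\<in>{k..}. pw d j * ?ch j \<partial>count_space UNIV))) gm)"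
    unfolding S5_def by (intro isum_mono mult_left_mono epow_mono ch gm0) auto
  also have "\<dots> = isum (\<lambda>k. ennreal (?c powr gm) * (pw (al / 2) k * epow (\<integral>\<^sup>+j\<in>{k..}. pw d j * ?ch j \<partial>count_space UNIV) gm))"
  proof -
    have "- d * gm + al = al / 2" using dg by linarith
    then have "pw al k * (pw (- d * gm) k * x) = pw (al / 2) k * x" for k x
      by (simp only: pw_mult_assoc add.commute)
    moreover have "epow (ennreal ?c) gm = ennreal (?c powr gm)" using c by (rule epow_ennreal)
    ultimately show ?thesis
      by (simp only: epow_mult[OF gm0(1)] epow_pw mult.left_commute[of "pw al _"])
  qed
  also have "\<dots> = ennreal (?c powr gm) * isum (\<lambda>k. pw (al / 2) k * epow (\<integral>\<^sup>+j\<in>{k..}. pw d j * ?ch j \<partial>count_space UNIV) gm)"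
    by (rule isum_cmult)
  also have "\<dots> \<le> ennreal (?c powr gm) * (ennreal (geom_const (al / 2 / 2 / gm) powr gm * geom_const (al / 2 / 2))
     * isum (\<lambda>j. pw (al / 2) j * epow (pw d j * ?ch j) gm))"
    by (intro mult_left_mono isum_epow_atLeast_le half_gt_zero exps(3) gm0) simp
  also have "isum (\<lambda>j. pw (al / 2) j * epow (pw d j * ?ch j) gm) = S5'"
  proof -
    have "al / 2 + d * gm = al" using dg by linarith
    then have "pw (al / 2) j * (pw (d * gm) j * x) = pw al j * x" for j x
      by (simp only: pw_mult_assoc)
    then show ?thesis unfolding S5'_def by (simp only: epow_mult[OF gm0(1)] epow_pw)
  qed
  finally show ?thesis
    using geom_const_pos[OF half_gt_zero[OF half_gt_zero[OF exps(3)]]]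
    by (simp add: geo_const_def d_def ennreal_mult mult.assoc)
qed

end

section \<open>Comparison of discrete and continuous conditions\<close>

lemma pw_less_iff: "pw (- 1) j < pw (- 1) k \<longleftrightarrow> k < j"
  by (simp add: pw_def ennreal_less_iff)

lemma pw_le_iff: "pw (- 1) j \<le> pw (- 1) k \<longleftrightarrow> k \<le> j"
  by (simp add: pw_def)

lemma pw_Suc: "pw a (k + 1) = ennreal (2 powr a) * pw a k"
  by (simp add: pw_def ennreal_mult[symmetric] powr_add[symmetric] algebra_simps)

lemma ex_dyadic_int:
  assumes "0 < x" "x < top"
  shows "\<exists>k. pw (- 1) (k + 1) < x \<and> x \<le> pw (- 1) k"
proof -
  obtain z where z: "0 < z" "x = ennreal z" using assms by (cases x rule: ennreal_cases_epow) auto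
  define k where "k = \<lfloor>- log 2 z\<rfloor>"
  have "real_of_int k \<le> - log 2 z" "- log 2 z < real_of_int k + 1" unfolding k_def by linarith+
  then have "2 powr (- (real_of_int k + 1)) < z" "z \<le> 2 powr (- real_of_int k)"
    using z(1) by (simp_all add: less_log_iff[symmetric] log_le_iff[symmetric])
  then show ?thesis
    using z by (intro exI[of _ k]) (simp add: pw_def ennreal_less_iff)
qed

lemma isum_shift: "isum (\<lambda>k. f (k - 1)) = isum f"
  by (rule nn_integral_bij_count_space) (rule bij_betw_byWitness[where f' = "\<lambda>k. k + 1"]; auto)

text \<open>If \<open>B\<close> carries at least half of the total T, then N \<ge> T/2 on all of
  \<open>A\<close>. Otherwise N \<le> T/2 on \<open>B\<close>, and the part of \<open>A\<close> with
  N > T/2 has mass at least T/2. In use, \<open>A\<close> is a block and \<open>B\<close> everything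
  after it; unlike in \<open>dist_le_power\<close> the integral runs over \<open>A\<close>
  alone.\<close>

lemma dist_le_power_split:
  assumes d: "dist_le M N" and a: "0 \<le> a" and [measurable]: "A \<in> sets M" "B \<in> sets M"
    and fin: "emeasure M A < top" and disj: "A \<inter> B = {}"
    and B: "\<And>x. x \<in> B \<Longrightarrow> N x \<le> emeasure M B" and A: "\<And>x. x \<in> A \<Longrightarrow> emeasure M B \<le> N x"
  shows "emeasure M A * epow (emeasure M (A \<union> B)) a \<le> ennreal (2 powr (a + 1)) * (\<integral>\<^sup>+x\<in>A. epow (N x) a \<partial>M)"
proof -
  note [measurable] = dist_leD(1)[OF d]
  define T where "T = emeasure M (A \<union> B)"
  define I where "I = (\<integral>\<^sup>+x\<in>A. epow (N x) a \<partial>M)"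
  have T: "T = emeasure M A + emeasure M B" unfolding T_def using disj by (simp add: plus_emeasure)
  have half: "epow (T / 2) a * (emeasure M A / 2) \<le> I"
  proof (cases "T / 2 \<le> emeasure M B")
    case True
    have "epow (T / 2) a * (emeasure M A / 2) \<le> epow (T / 2) a * emeasure M A"
      using ennreal_half[of "emeasure M A"] by (intro mult_left_mono) (auto simp: le_iff_add intro: sym)
    also have "\<dots> = (\<integral>\<^sup>+x\<in>A. epow (T / 2) a \<partial>M)" by (simp add: nn_integral_cmult_indicator)
    also have "\<dots> \<le> I"
      unfolding I_def using True A a by (intro nn_integral_mono) (auto split: split_indicator intro!: epow_mono intro: order_trans)
    finally show ?thesis .
  next
    case False
    then have Bless: "emeasure M B < T / 2" by simp
    then have "emeasure M B < top" using less_trans[of "emeasure M B" "T / 2" top] by (cases "T / 2 = top") (auto simp: less_top)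
    then have Tfin: "T < top" using fin by (simp add: T less_top[symmetric])
    then have T2: "T / 2 < top" unfolding less_top[symmetric] by (simp add: ennreal_divide_eq_top_iff)
    let ?S = "{x \<in> space M. N x \<le> T / 2}"
    have "N x \<le> T / 2" if "x \<in> B" for x
      using B[OF that] Bless by (meson less_imp_le order_trans)
    then have "emeasure M (A \<union> B) \<le> emeasure M (?S \<union> (A - ?S))"
      using sets.sets_into_space[of A M] sets.sets_into_space[of B M]
      by (intro emeasure_mono) auto
    also have "\<dots> \<le> emeasure M ?S + emeasure M (A - ?S)" by (rule emeasure_subadditive) auto
    also have "\<dots> \<le> T / 2 + emeasure M (A - ?S)" by (intro add_right_mono dist_leD(2)[OF d])
    finally have "T / 2 + T / 2 \<le> T / 2 + emeasure M (A - ?S)" unfolding T_def[symmetric] ennreal_half .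
    then have D: "T / 2 \<le> emeasure M (A - ?S)" using T2 unfolding ennreal_add_left_cancel_le by auto
    have "emeasure M A / 2 \<le> T / 2" by (intro divide_right_mono_ennreal) (simp add: T)
    then have "epow (T / 2) a * (emeasure M A / 2) \<le> epow (T / 2) a * emeasure M (A - ?S)"
      using D by (intro mult_left_mono) auto
    also have "\<dots> = (\<integral>\<^sup>+x\<in>A - ?S. epow (T / 2) a \<partial>M)" by (simp add: nn_integral_cmult_indicator)
    also have "\<dots> \<le> I"
      unfolding I_def using a sets.sets_into_space[of A M]
      by (intro nn_integral_mono) (auto split: split_indicator intro!: epow_mono)
    finally show ?thesis .
  qed
  have "emeasure M A * epow T a = 2 * (emeasure M A / 2) * epow (2 * (T / 2)) a"
    by (simp add: mult_2 ennreal_half)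
  also have "\<dots> = ennreal (2 powr (a + 1)) * (epow (T / 2) a * (emeasure M A / 2))"
  proof -
    have "epow 2 a = ennreal (2 powr a)" using epow_ennreal[of 2 a] by simp
    moreover have "ennreal (2 powr (a + 1)) = 2 * ennreal (2 powr a)"
      by (simp add: powr_add ennreal_mult mult.commute)
    ultimately show ?thesis using a by (simp add: epow_mult ac_simps)
  qed
  also have "\<dots> \<le> ennreal (2 powr (a + 1)) * I" by (intro mult_left_mono half) simp
  finally show ?thesis unfolding T_def I_def .
qed

text \<open>Here \<open>d\<omega> = w dx\<close>, \<open>W\<close> is its tail function and \<open>Wa\<close> its total mass, possibly infinite. All blocks
  from the second non-empty one on have \<open>\<omega>\<close>-mass comparable to \<open>2\<^sup>-\<^sup>k\<close>; the first may be arbitrarily light,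
  which is why \<open>Wa\<close> enters below.\<close>

locale weighted_blocks = blocks +
  fixes \<omega> :: "'a measure" and W :: "'a \<Rightarrow> ennreal" and Wa :: ennreal
  assumes sets_\<omega> [measurable_cong]: "sets \<omega> = sets \<nu>"
    and W_measurable [measurable]: "W \<in> borel_measurable \<nu>"
    and W_bounds: "\<And>x k. x \<in> A k \<Longrightarrow> pw (- 1) (k + 1) < W x \<and> W x \<le> pw (- 1) k"
    and \<omega>_le: "\<And>k. emeasure \<omega> (A k) \<le> pw (- 1) k"
    and \<omega>_ge: "\<And>k. pw (- 1) k \<le> Wa \<Longrightarrow> pw (- 1) (k + 1) \<le> emeasure \<omega> (A k)"
    and Wa_pos: "0 < Wa" and W_le: "\<And>x k. x \<in> A k \<Longrightarrow> W x \<le> Wa"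
    and cover_\<omega>: "AE x in \<omega>. x \<in> (\<Union>k. A k)"
begin

lemma A_sets_\<omega> [measurable, simp]: "A k \<in> sets \<omega>" using A_sets sets_\<omega> by simp

lemma measurable_\<omega>: "f \<in> borel_measurable \<nu> \<Longrightarrow> f \<in> borel_measurable \<omega>"
  by (simp add: measurable_cong_sets[OF sets_\<omega> refl])

lemma integral_blocks_\<omega>: "f \<in> borel_measurable \<nu> \<Longrightarrow> (\<integral>\<^sup>+x. f x \<partial>\<omega>) = isum (\<lambda>k. \<integral>\<^sup>+x\<in>A k. f x \<partial>\<omega>)"
  using measurable_\<omega> A_disj cover_\<omega> by (intro nn_integral_blocks) auto

text \<open>\<open>Rw\<close> is the p-th power of the right-hand side, \<open>In\<close> the inner
  integral of \<open>C6\<close>; \<open>I1\<close>, \<open>I2\<close> and \<open>I6\<close> are the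
  powers p q/(p-q) of the two terms of \<open>C5\<close> and of \<open>C6\<close>.\<close>

definition "Rw g = (\<integral>\<^sup>+t. epow (\<integral>\<^sup>+y\<in>{..<t}. g y \<partial>\<nu>) p \<partial>\<omega>)"
definition "In x = (\<integral>\<^sup>+t. epow (W t) (- (al' + 1)) * epow (emeasure \<nu> ({t<..} \<inter> {..<x})) th2 \<partial>\<omega>)"
definition "I1 = (\<integral>\<^sup>+x. epow (W x) (- (al + 1)) * epow (char_on q th {x<..}) gm \<partial>\<omega>)"
definition "I2 = epow Wa (- al) * epow (char_on q th UNIV) gm"
definition "I6 = (\<integral>\<^sup>+x. epow (Uc x) al * epow (In x) th' \<partial>\<mu>)"

text \<open>Subadditivity of x^p distributes the running integral over the blocks j \<le> k. After
  exchanging sums, the mass bounds 2^(-k) for k \<ge> j add up to twice 2^(-j).\<close>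

lemma Rw_le:
  assumes [measurable]: "g \<in> borel_measurable \<nu>"
  shows "Rw g \<le> ennreal (geom_const 1) * R g"
proof -
  let ?G = "\<lambda>j. \<integral>\<^sup>+y\<in>A j. g y \<partial>\<nu>"
  have [measurable]: "(\<lambda>t. \<integral>\<^sup>+y\<in>{..<t}. g y \<partial>\<nu>) \<in> borel_measurable \<nu>" by (rule measurable_int_lessThan)
  have "Rw g = isum (\<lambda>k. \<integral>\<^sup>+t\<in>A k. epow (\<integral>\<^sup>+y\<in>{..<t}. g y \<partial>\<nu>) p \<partial>\<omega>)"
    unfolding Rw_def by (rule integral_blocks_\<omega>) measurable
  also have "\<dots> \<le> isum (\<lambda>k. isum (\<lambda>j. pw (- 1) k * (epow (?G j) p * indicator {..k} j)))"
  proof (rule isum_mono)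
    fix k
    let ?S = "isum (\<lambda>j. epow (?G j) p * indicator {..k} j)"
    have "(\<integral>\<^sup>+t\<in>A k. epow (\<integral>\<^sup>+y\<in>{..<t}. g y \<partial>\<nu>) p \<partial>\<omega>) \<le> (\<integral>\<^sup>+t\<in>A k. ?S \<partial>\<omega>)"
    proof (intro nn_integral_mono)
      fix t
      show "epow (\<integral>\<^sup>+y\<in>{..<t}. g y \<partial>\<nu>) p * indicator (A k) t \<le> ?S * indicator (A k) t"
      proof (cases "t \<in> A k")
        case True
        have "(\<integral>\<^sup>+y\<in>{..<t}. g y \<partial>\<nu>) \<le> (\<integral>\<^sup>+j\<in>{..<k}. ?G j \<partial>count_space UNIV) + ?G k"
          unfolding lessThan_split[OF assms True]
          by (intro add_left_mono nn_integral_mono) (auto split: split_indicator)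
        also have "\<dots> = isum (\<lambda>j. ?G j * indicator {..<k} j + ?G j * indicator {k} j)"
          by (simp add: isum_add isum_indicator_singleton)
        also have "\<dots> = isum (\<lambda>j. ?G j * indicator {..k} j)"
          by (intro nn_integral_cong) (auto split: split_indicator)
        finally have "epow (\<integral>\<^sup>+y\<in>{..<t}. g y \<partial>\<nu>) p \<le> epow (isum (\<lambda>j. ?G j * indicator {..k} j)) p"
          using params by (intro epow_mono) auto
        also have "\<dots> \<le> isum (\<lambda>j. epow (?G j * indicator {..k} j) p)"
          using params p by (intro epow_subadditive) auto
        also have "\<dots> = ?S"
          using params by (intro nn_integral_cong) (auto split: split_indicator simp: epow_zero)
        finally show ?thesis using True by simp
      qed simp
    qed
    also have "\<dots> = ?S * emeasure \<omega> (A k)" by (simp add: nn_integral_cmult_indicator)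
    also have "\<dots> \<le> ?S * pw (- 1) k" by (intro mult_left_mono \<omega>_le) simp
    finally show "(\<integral>\<^sup>+t\<in>A k. epow (\<integral>\<^sup>+y\<in>{..<t}. g y \<partial>\<nu>) p \<partial>\<omega>) \<le> isum (\<lambda>j. pw (- 1) k * (epow (?G j) p * indicator {..k} j))"
      by (simp add: isum_cmult mult.commute)
  qed
  also have "\<dots> = isum (\<lambda>j. isum (\<lambda>k. (pw (- 1) j * epow (?G j) p) * (pw (- 1) (k - j) * indicator {j..} k)))"
  proof (subst isum_swap, intro nn_integral_cong)
    fix j k :: int
    have "pw (- 1) k = pw (- 1) j * pw (- 1) (k - j)" by (simp add: pw_add[symmetric])
    then show "pw (- 1) k * (epow (?G j) p * indicator {..k} j) = (pw (- 1) j * epow (?G j) p) * (pw (- 1) (k - j) * indicator {j..} k)"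
      by (auto split: split_indicator simp: ac_simps)
  qed
  also have "\<dots> = isum (\<lambda>j. (pw (- 1) j * epow (?G j) p) * ennreal (geom_const 1))"
    using isum_geom_atLeast[of 1] by (simp add: isum_cmult)
  also have "\<dots> = ennreal (geom_const 1) * R g"
    unfolding R_def by (subst isum_cmult[symmetric]) (simp only: mult.commute)
  finally show ?thesis .
qed

text \<open>The integral over block k-1 is seen on the whole next block, of mass at least 2^(-k-1);
  the 4 is 2^(-(k-1)) / 2^(-(k+1)). A point in block k-1 forces Wa \<ge> 2^(-k), so the next block
  is not cut short by the total mass.\<close>

lemma R_le:
  assumes [measurable]: "g \<in> borel_measurable \<nu>"
  shows "R g \<le> 4 * Rw g"
proof -
  let ?G = "\<lambda>j. \<integral>\<^sup>+y\<in>A j. g y \<partial>\<nu>"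
  let ?F = "\<lambda>t. \<integral>\<^sup>+y\<in>{..<t}. g y \<partial>\<nu>"
  have [measurable]: "?F \<in> borel_measurable \<nu>" by (rule measurable_int_lessThan)
  have "pw (- 1) (k - 1) * epow (?G (k - 1)) p \<le> 4 * (\<integral>\<^sup>+t\<in>A k. epow (?F t) p \<partial>\<omega>)" for k
  proof (cases "A (k - 1) = {}")
    case True
    then show ?thesis using params by (simp add: epow_zero)
  next
    case False
    then obtain x where x: "x \<in> A (k - 1)" by blast
    then have "pw (- 1) k \<le> Wa" using W_bounds[OF x] W_le[OF x] by (metis diff_add_cancel less_imp_le order_trans)
    then have "4 * pw (- 1) (k + 1) \<le> 4 * emeasure \<omega> (A k)" by (intro mult_left_mono \<omega>_ge) auto
    moreover have "4 * pw (- 1) (k + 1) = pw (- 1) (k - 1)"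
    proof -
      have "4 * 2 powr (- 1 * real_of_int (k + 1)) = 2 powr (- 1 * real_of_int (k - 1))"
        using powr_add[of 2 2 "- real_of_int (k + 1)"] by simp
      then show ?thesis unfolding pw_def by (metis ennreal_mult ennreal_numeral powr_ge_zero zero_le_numeral)
    qed
    ultimately have 1: "pw (- 1) (k - 1) \<le> 4 * emeasure \<omega> (A k)" by simp
    have "pw (- 1) (k - 1) * epow (?G (k - 1)) p \<le> 4 * emeasure \<omega> (A k) * epow (?G (k - 1)) p"
      by (intro mult_right_mono 1) simp
    also have "\<dots> = 4 * (\<integral>\<^sup>+t\<in>A k. epow (?G (k - 1)) p \<partial>\<omega>)"
      by (simp add: nn_integral_cmult_indicator mult.assoc mult.commute[of "emeasure _ _"])
    also have "\<dots> \<le> 4 * (\<integral>\<^sup>+t\<in>A k. epow (?F t) p \<partial>\<omega>)"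
    proof (intro mult_left_mono nn_integral_mono)
      fix t
      have "?G (k - 1) \<le> ?F t" if "t \<in> A k"
        using A_less[OF _ that, of _ "k - 1"] by (intro nn_integral_mono) (auto split: split_indicator)
      then show "epow (?G (k - 1)) p * indicator (A k) t \<le> epow (?F t) p * indicator (A k) t"
        using params by (auto split: split_indicator intro!: epow_mono)
    qed simp
    finally show ?thesis .
  qed
  then have "isum (\<lambda>k. pw (- 1) (k - 1) * epow (?G (k - 1)) p) \<le> isum (\<lambda>k. 4 * (\<integral>\<^sup>+t\<in>A k. epow (?F t) p \<partial>\<omega>))"
    by (rule isum_mono)
  also have "\<dots> = 4 * Rw g"
    unfolding Rw_def isum_cmult by (subst integral_blocks_\<omega>) auto
  finally show ?thesis
    unfolding R_def using isum_shift[of "\<lambda>k. pw (- 1) k * epow (?G k) p"] by simp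
qed

text \<open>On block k the power W^(-(a+1)) is of order 2^(k(a+1)), and the \<omega>-mass is at most
  2^(-k).\<close>

lemma layer_upper:
  assumes a: "0 \<le> a" and [measurable]: "H \<in> borel_measurable \<nu>" and h: "\<And>t k. t \<in> A k \<Longrightarrow> H t \<le> h k"
  shows "(\<integral>\<^sup>+t. epow (W t) (- (a + 1)) * H t \<partial>\<omega>) \<le> ennreal (2 powr (a + 1)) * isum (\<lambda>k. pw a k * h k)"
proof -
  have "(\<integral>\<^sup>+t. epow (W t) (- (a + 1)) * H t \<partial>\<omega>) = isum (\<lambda>k. \<integral>\<^sup>+t\<in>A k. epow (W t) (- (a + 1)) * H t \<partial>\<omega>)"
    by (rule integral_blocks_\<omega>) measurable
  also have "\<dots> \<le> isum (\<lambda>k. ennreal (2 powr (a + 1)) * (pw a k * h k))"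
  proof (rule isum_mono)
    fix k
    have "(\<integral>\<^sup>+t\<in>A k. epow (W t) (- (a + 1)) * H t \<partial>\<omega>) \<le> (\<integral>\<^sup>+t\<in>A k. pw (a + 1) (k + 1) * h k \<partial>\<omega>)"
    proof (intro nn_integral_mono)
      fix t
      have "epow (W t) (- (a + 1)) * H t \<le> pw (a + 1) (k + 1) * h k" if t: "t \<in> A k"
      proof (rule mult_mono)
        have "epow (W t) (- (a + 1)) \<le> epow (pw (- 1) (k + 1)) (- (a + 1))"
          using W_bounds[OF t] a by (intro epow_antimono) auto
        then show "epow (W t) (- (a + 1)) \<le> pw (a + 1) (k + 1)" by (simp add: epow_pw algebra_simps)
      qed (use h[OF t] in auto)
      then show "epow (W t) (- (a + 1)) * H t * indicator (A k) t \<le> pw (a + 1) (k + 1) * h k * indicator (A k) t"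
        by (auto split: split_indicator)
    qed
    also have "\<dots> = pw (a + 1) (k + 1) * h k * emeasure \<omega> (A k)" by (simp add: nn_integral_cmult_indicator)
    also have "\<dots> \<le> pw (a + 1) (k + 1) * h k * pw (- 1) k" by (intro mult_left_mono \<omega>_le) simp
    also have "\<dots> = ennreal (2 powr (a + 1)) * (pw a k * h k)"
    proof -
      have 1: "pw (a + 1) (k + 1) * pw (- 1) k = ennreal (2 powr (a + 1)) * pw a k"
        by (simp add: pw_def ennreal_mult[symmetric] powr_add[symmetric] algebra_simps)
      have c: "x * y * z = (x * z) * y" for x y z :: ennreal by (simp add: ac_simps)
      show ?thesis by (subst c, subst 1) (simp only: mult.assoc)
    qed
    finally show "(\<integral>\<^sup>+t\<in>A k. epow (W t) (- (a + 1)) * H t \<partial>\<omega>) \<le> ennreal (2 powr (a + 1)) * (pw a k * h k)" .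
  qed
  finally show ?thesis by (simp add: isum_cmult)
qed

text \<open>Level k is charged to block k-1, which in the applications lies left of the set measured
  by \<open>h k\<close> and has mass at least 2^(-k) unless the total mass is too small. The
  exceptional levels are bounded above, and 2^(ka) sums over them to a multiple of Wa^(-a).\<close>

lemma layer_lower:
  assumes a: "0 < a" and [measurable]: "H \<in> borel_measurable \<nu>"
    and h: "\<And>t k. t \<in> A (k - 1) \<Longrightarrow> h k \<le> H t" and h0: "\<And>k. h k \<le> h0"
  shows "isum (\<lambda>k. pw a k * h k) \<le> ennreal (2 powr (a + 1)) * (\<integral>\<^sup>+t. epow (W t) (- (a + 1)) * H t \<partial>\<omega>)
    + ennreal (2 powr a * geom_const a) * (epow Wa (- a) * h0)"
proof -
  let ?c = "ennreal (2 powr (a + 1))"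
  let ?I = "\<lambda>k. \<integral>\<^sup>+t\<in>A k. epow (W t) (- (a + 1)) * H t \<partial>\<omega>"
  let ?B = "\<lambda>k. if Wa < pw (- 1) (k - 1) then pw a k else 0"
  have pt: "pw a k * h k \<le> ?c * ?I (k - 1) + ?B k * h0" for k
  proof (cases "Wa < pw (- 1) (k - 1)")
    case True
    have "pw a k * h k \<le> ?B k * h0" using True h0 by (simp add: mult_left_mono)
    then show ?thesis by (rule order_trans) simp
  next
    case False
    then have \<omega>: "pw (- 1) k \<le> emeasure \<omega> (A (k - 1))" using \<omega>_ge[of "k - 1"] by (simp add: not_less)
    have "pw a k = ?c * (pw (a + 1) (k - 1) * pw (- 1) k)"
      by (simp add: pw_def ennreal_mult[symmetric] powr_add[symmetric] algebra_simps)
    then have "pw a k * h k = ?c * (pw (a + 1) (k - 1) * h k * pw (- 1) k)" by (simp add: ac_simps)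
    also have "\<dots> \<le> ?c * (pw (a + 1) (k - 1) * h k * emeasure \<omega> (A (k - 1)))"
      using \<omega> by (intro mult_left_mono) auto
    also have "\<dots> = ?c * (\<integral>\<^sup>+t\<in>A (k - 1). pw (a + 1) (k - 1) * h k \<partial>\<omega>)"
      by (simp add: nn_integral_cmult_indicator)
    also have "\<dots> \<le> ?c * ?I (k - 1)"
    proof (intro mult_left_mono nn_integral_mono)
      fix t
      have "pw (a + 1) (k - 1) * h k \<le> epow (W t) (- (a + 1)) * H t" if t: "t \<in> A (k - 1)"
      proof (rule mult_mono)
        have "epow (pw (- 1) (k - 1)) (- (a + 1)) \<le> epow (W t) (- (a + 1))"
          using W_bounds[OF t] a by (intro epow_antimono) auto
        then show "pw (a + 1) (k - 1) \<le> epow (W t) (- (a + 1))" by (simp add: epow_pw algebra_simps)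
      qed (use h[OF t] in auto)
      then show "pw (a + 1) (k - 1) * h k * indicator (A (k - 1)) t \<le> epow (W t) (- (a + 1)) * H t * indicator (A (k - 1)) t"
        by (auto split: split_indicator)
    qed simp
    finally show ?thesis by (rule order_trans) simp
  qed
  have B: "isum ?B \<le> ennreal (2 powr a * geom_const a) * epow Wa (- a)"
  proof (cases "Wa = top")
    case True
    then show ?thesis by simp
  next
    case False
    \<comment> \<open>The dyadic position of the total mass: exceptional levels satisfy k \<le> k1 +
      1.\<close>
    then obtain k1 where k1: "pw (- 1) (k1 + 1) < Wa" "Wa \<le> pw (- 1) k1"
      using ex_dyadic_int[OF Wa_pos] by (auto simp: less_top)
    have "?B k \<le> pw a (k1 + 1) * (pw (- a) (k1 + 1 - k) * indicator {..k1 + 1} k)" for k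
    proof (cases "Wa < pw (- 1) (k - 1)")
      case True
      then have "k \<le> k1 + 1" using less_trans[OF k1(1) True] by (simp add: pw_less_iff)
      moreover have "pw a (k1 + 1) * pw (- a) (k1 + 1 - k) = pw a k"
        by (simp add: pw_def ennreal_mult[symmetric] powr_add[symmetric] algebra_simps)
      ultimately show ?thesis using True by simp
    qed simp
    then have "isum ?B \<le> isum (\<lambda>k. pw a (k1 + 1) * (pw (- a) (k1 + 1 - k) * indicator {..k1 + 1} k))"
      by (rule isum_mono)
    also have "\<dots> = pw a (k1 + 1) * ennreal (geom_const a)"
      unfolding isum_cmult isum_geom_atMost[OF a] ..
    also have "pw a (k1 + 1) = ennreal (2 powr a) * pw a k1"
      by (simp add: pw_def ennreal_mult[symmetric] powr_add[symmetric] algebra_simps)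
    also have "pw a k1 \<le> epow Wa (- a)"
      using epow_antimono[OF k1(2), of "- a"] a by (simp add: epow_pw)
    finally show ?thesis
      using geom_const_pos[OF a] by (simp add: ennreal_mult ac_simps mult_left_mono mult_right_mono)
  qed
  have "isum (\<lambda>k. pw a k * h k) \<le> isum (\<lambda>k. ?c * ?I (k - 1) + ?B k * h0)"
    using pt by (rule isum_mono)
  also have "\<dots> = ?c * isum (\<lambda>k. ?I (k - 1)) + isum ?B * h0"
    by (simp add: isum_add isum_cmult nn_integral_multc)
  also have "isum (\<lambda>k. ?I (k - 1)) = (\<integral>\<^sup>+t. epow (W t) (- (a + 1)) * H t \<partial>\<omega>)"
    unfolding isum_shift[of ?I] by (rule integral_blocks_\<omega>[symmetric]) measurable
  also have "isum ?B * h0 \<le> ennreal (2 powr a * geom_const a) * epow Wa (- a) * h0"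
    by (intro mult_right_mono B) simp
  finally show ?thesis by (simp add: mult.assoc add_left_mono)
qed

lemma emeasure_greaterThan_le:
  assumes "t \<in> A k" "S \<in> sets \<nu>"
  shows "emeasure \<nu> ({t<..} \<inter> S) \<le> emeasure \<nu> (T k \<inter> S)"
proof (rule emeasure_mono_AE)
  show "AE x in \<nu>. x \<in> {t<..} \<inter> S \<longrightarrow> x \<in> T k \<inter> S"
    using cover_\<nu>
  proof eventually_elim
    case (elim x)
    then obtain j where j: "x \<in> A j" by blast
    have "k \<le> j" if "t < x"
      using A_less[OF j assms(1)] that by (cases "j < k") auto
    then show ?case using j by (auto simp: T_def)
  qed
qed (use assms in auto)

lemma T_subset: "t \<in> A (k - 1) \<Longrightarrow> T k \<subseteq> {t<..}"
  using A_less[of t "k - 1"] by (fastforce simp: T_def)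

lemma char_on_mono:
  assumes "\<And>t. emeasure \<nu> (E \<inter> {..<t}) \<le> emeasure \<nu> (F \<inter> {..<t})"
  shows "char_on q th E \<le> char_on q th F"
  unfolding char_on_def using exps assms by (intro nn_integral_mono mult_left_mono epow_mono) auto

lemma measurable_char [measurable]: "(\<lambda>x. char_on q th {x<..}) \<in> borel_measurable \<nu>"
  by (rule measurable_antimono) (auto simp: antimono_def intro!: char_on_mono emeasure_mono)

lemma measurable_V [measurable]: "(\<lambda>t. emeasure \<nu> ({t<..} \<inter> {..<x})) \<in> borel_measurable \<nu>"
  by (rule measurable_antimono) (auto simp: antimono_def intro!: emeasure_mono)

lemma measurable_In [measurable]: "In \<in> borel_measurable \<nu>" "In \<in> borel_measurable \<mu>"
proof -
  have "mono In"
    unfolding In_def mono_def using exps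
    by (auto intro!: nn_integral_mono mult_left_mono epow_mono emeasure_mono)
  then show "In \<in> borel_measurable \<nu>" by (rule measurable_mono)
  then show "In \<in> borel_measurable \<mu>" by (rule measurable_change)
qed

text \<open>\<open>T k\<close> lies beyond every point of block k-1. Where that block may be too
  light, the comparison falls back on the whole line, which produces \<open>I2\<close>.\<close>

lemma S5_le_I: "S5 \<le> ennreal (2 powr (al + 1)) * I1 + ennreal (2 powr al * geom_const al) * I2"
  unfolding S5_def I1_def I2_def
proof (rule layer_lower[OF exps(3)])
  show "epow (char_on q th (T k)) gm \<le> epow (char_on q th {t<..}) gm" if "t \<in> A (k - 1)" for t k
    using exps T_subset[OF that] by (intro epow_mono char_on_mono emeasure_mono) auto
  show "epow (char_on q th (T k)) gm \<le> epow (char_on q th UNIV) gm" for k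
    using exps by (intro epow_mono char_on_mono emeasure_mono) auto
qed measurable

lemma I1_le: "I1 \<le> ennreal (2 powr (al + 1)) * S5"
  unfolding S5_def I1_def
proof (rule layer_upper)
  show "epow (char_on q th {t<..}) gm \<le> epow (char_on q th (T k)) gm" if "t \<in> A k" for t k
    using exps emeasure_greaterThan_le[OF that] by (intro epow_mono char_on_mono) auto
qed (use exps in auto)

text \<open>If 2^(-k-1) < Wa \<le> 2^(-k), no block before k contains a point, so \<open>T k\<close>
  is almost everything.\<close>

lemma I2_le: "I2 \<le> ennreal (2 powr al) * S5"
proof (cases "Wa = top")
  case True
  have "epow Wa (- al) = 0" unfolding True using exps(3) by (intro epow_top_neg) linarith
  then show ?thesis unfolding I2_def by simp
next
  case False
  then obtain k where k: "pw (- 1) (k + 1) < Wa" "Wa \<le> pw (- 1) k"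
    using ex_dyadic_int[OF Wa_pos] by (auto simp: less_top)
  have ge: "k \<le> j" if "x \<in> A j" for x j
  proof -
    have "pw (- 1) (j + 1) < pw (- 1) k"
      using W_bounds[OF that] W_le[OF that] k(2) by (meson less_le_trans)
    then show ?thesis by (simp add: pw_less_iff)
  qed
  have "char_on q th UNIV \<le> char_on q th (T k)"
  proof (rule char_on_mono, rule emeasure_mono_AE)
    fix t
    show "AE x in \<nu>. x \<in> UNIV \<inter> {..<t} \<longrightarrow> x \<in> T k \<inter> {..<t}"
      using cover_\<nu> by eventually_elim (use ge in \<open>auto simp: T_def\<close>)
  qed auto
  then have "epow (char_on q th UNIV) gm \<le> epow (char_on q th (T k)) gm"
    using exps by (intro epow_mono) auto
  moreover have "epow Wa (- al) \<le> pw al (k + 1)"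
    using epow_antimono[OF less_imp_le[OF k(1)], of "- al"] exps by (simp add: epow_pw)
  ultimately have "I2 \<le> pw al (k + 1) * epow (char_on q th (T k)) gm"
    unfolding I2_def by (intro mult_mono) auto
  also have "pw al (k + 1) = ennreal (2 powr al) * pw al k"
    by (rule pw_Suc)
  also have "\<dots> * epow (char_on q th (T k)) gm = ennreal (2 powr al) * (pw al k * epow (char_on q th (T k)) gm)"
    by (simp add: mult.assoc)
  also have "\<dots> \<le> ennreal (2 powr al) * S5"
    unfolding S5_def by (intro mult_left_mono le_isum[of "\<lambda>k. pw al k * epow (char_on q th (T k)) gm"]) simp
  finally show ?thesis .
qed

section \<open>Comparison of \<open>S6\<close> with \<open>I6\<close>\<close>

text \<open>The first two identities turn (2^(k al') \<nu>^th2)^th' into 2^(k al) \<nu>^(th gm); the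
  third is the exponent relation of \<open>char_on_power_le\<close>.\<close>

lemma al_eqs: "al' * th' = al" "th2 * th' = th * gm" "al = gm / (1 - q) - 1"
  using params qp r by (simp_all add: divide_simps)

lemma nonneg: "0 \<le> th" "0 \<le> gm" "0 \<le> al" "0 \<le> th'" "0 \<le> th2" "0 \<le> al'"
  using exps by linarith+

lemma Uc_le_T: "t \<in> A k \<Longrightarrow> Uc t \<le> emeasure \<mu> (T k)"
  unfolding Uc_def
proof (rule emeasure_mono_AE)
  assume t: "t \<in> A k"
  show "AE x in \<mu>. x \<in> {t..} \<longrightarrow> x \<in> T k"
    using cover_\<mu>
  proof eventually_elim
    case (elim x)
    then obtain j where j: "x \<in> A j" by blast
    have "k \<le> j" if "t \<le> x"
      using A_less[OF j t] that by (cases "j < k") auto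
    then show ?case using j by (auto simp: T_def)
  qed
qed simp

definition "In_const = 2 powr (al' + 1) * (geom_const (al' / 2 / th2) powr th2 * geom_const (al' / 2))"

lemma In_const_pos: "0 < In_const"
proof -
  have "0 < geom_const (al' / 2 / th2)" "0 < geom_const (al' / 2)"
    by (intro geom_const_pos divide_pos_pos exps; simp)+
  then show ?thesis unfolding In_const_def by (intro mult_pos_pos) auto
qed

text \<open>\<open>layer_upper\<close> gives a sum over levels of \<nu>(T j \<inter> {..<x}), and
  the geometric weights reduce each \<open>T j\<close> to single blocks. Blocks before that of x are
  complete and yield s_j, the block of x is cut at x, later ones are empty.\<close>

lemma In_le:
  assumes x: "x \<in> A k"
  shows "In x \<le> ennreal In_const * ((\<integral>\<^sup>+j\<in>{..<k}. s j \<partial>count_space UNIV) + pw al' k * epow (emeasure \<nu> (A k \<inter> {..<x})) th2)"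
proof -
  have "In x \<le> ennreal (2 powr (al' + 1)) * isum (\<lambda>j. pw al' j * epow (emeasure \<nu> (T j \<inter> {..<x})) th2)"
    unfolding In_def
    by (intro layer_upper nonneg measurable_epow measurable_V epow_mono emeasure_greaterThan_le) auto
  also have "\<dots> = ennreal (2 powr (al' + 1)) * isum (\<lambda>j. pw al' j * epow (\<integral>\<^sup>+i\<in>{j..}. emeasure \<nu> (A i \<inter> {..<x}) \<partial>count_space UNIV) th2)"
    by (simp only: emeasure_T sets_Iic)
  also have "\<dots> \<le> ennreal (2 powr (al' + 1)) * (ennreal (geom_const (al' / 2 / th2) powr th2 * geom_const (al' / 2))
      * isum (\<lambda>j. pw al' j * epow (emeasure \<nu> (A j \<inter> {..<x})) th2))"
    by (intro mult_left_mono isum_epow_atLeast_le exps) simp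
  also have "\<dots> = ennreal In_const * isum (\<lambda>j. pw al' j * epow (emeasure \<nu> (A j \<inter> {..<x})) th2)"
    unfolding In_const_def by (simp only: ennreal_mult' powr_ge_zero mult.assoc)
  also have "isum (\<lambda>j. pw al' j * epow (emeasure \<nu> (A j \<inter> {..<x})) th2)
    = isum (\<lambda>j. s j * indicator {..<k} j + (pw al' j * epow (emeasure \<nu> (A j \<inter> {..<x})) th2) * indicator {k} j)"
  proof (intro nn_integral_cong)
    fix j
    show "pw al' j * epow (emeasure \<nu> (A j \<inter> {..<x})) th2
      = s j * indicator {..<k} j + (pw al' j * epow (emeasure \<nu> (A j \<inter> {..<x})) th2) * indicator {k} j"
    proof (cases j k rule: linorder_cases)
      case less
      then have "A j \<inter> {..<x} = A j" using A_less[OF _ x] by auto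
      then show ?thesis using less by (simp add: s_def)
    next
      case greater
      then have "A j \<inter> {..<x} = {}" using A_less[OF x] by fastforce
      then show ?thesis using greater epow_zero[OF exps(5)] by simp
    qed simp
  qed
  finally show ?thesis by (simp add: isum_add isum_indicator_singleton)
qed

definition "PI_const = 2 powr ((gm - 1) / (1 - q))"

lemma PI:
  assumes "F \<in> sets \<nu>"
  shows "(\<integral>\<^sup>+t. epow (Uc t) al * epow (emeasure \<nu> (F \<inter> {..<t})) (th * gm) \<partial>\<mu>)
    \<le> ennreal PI_const * epow (char_on q th F) gm"
  unfolding PI_const_def using assms params by (intro char_on_power_le exps al_eqs) auto

lemma measurable_Q [measurable]:
  "E \<in> sets \<nu> \<Longrightarrow> (\<lambda>t. emeasure \<nu> (E \<inter> {..<t})) \<in> borel_measurable \<mu>"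
  by (intro measurable_change measurable_emeasure_inter)

text \<open>The complete blocks in \<open>In_le\<close> lead to \<open>S6\<close>; the cut block
  leads to a local integral, bounded by \<open>S5'\<close> through \<open>PI\<close>.\<close>

lemma I6_le:
  assumes reg: regular_blocks
  shows "I6 \<le> ennreal ((In_const * 2) powr th') * (S6 + ennreal PI_const * S5')"
proof -
  let ?P = "\<lambda>k. \<integral>\<^sup>+j\<in>{..<k}. s j \<partial>count_space UNIV"
  let ?M = "\<lambda>k. \<integral>\<^sup>+j\<in>{k..}. m j \<partial>count_space UNIV"
  let ?Q = "\<lambda>k x. emeasure \<nu> (A k \<inter> {..<x})"
  let ?c = "ennreal ((In_const * 2) powr th')"
  have "I6 = isum (\<lambda>k. \<integral>\<^sup>+x\<in>A k. epow (Uc x) al * epow (In x) th' \<partial>\<mu>)"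
    unfolding I6_def using A_disj cover_\<mu> by (intro nn_integral_blocks) auto
  also have "\<dots> \<le> isum (\<lambda>k. ?c * (m k * (epow (?M k) al * epow (?P k) th') + ennreal PI_const * (pw al k * epow (char_on q th (A k)) gm)))"
  proof (rule isum_mono)
    fix k
    have c: "epow (In x) th' \<le> ?c * (epow (?P k) th' + pw al k * epow (?Q k x) (th * gm))" if x: "x \<in> A k" for x
    proof -
      have "epow (In x) th' \<le> epow (ennreal In_const * (?P k + pw al' k * epow (?Q k x) th2)) th'"
        by (intro epow_mono In_le x nonneg)
      also have "\<dots> = ennreal (In_const powr th') * epow (?P k + pw al' k * epow (?Q k x) th2) th'"
        unfolding epow_mult[OF nonneg(4)] epow_ennreal[OF In_const_pos] ..
      also have "\<dots> \<le> ennreal (In_const powr th') * (ennreal (2 powr th') * (epow (?P k) th' + epow (pw al' k * epow (?Q k x) th2) th'))"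
        by (intro mult_left_mono epow_add_le nonneg) simp
      also have "epow (pw al' k * epow (?Q k x) th2) th' = pw al k * epow (?Q k x) (th * gm)"
        unfolding epow_mult[OF nonneg(4)] epow_pw epow_epow al_eqs(1,2) ..
      finally show ?thesis
        using In_const_pos by (simp add: powr_mult ennreal_mult mult.assoc)
    qed
    have "(\<integral>\<^sup>+x\<in>A k. epow (Uc x) al * epow (In x) th' \<partial>\<mu>)
      \<le> (\<integral>\<^sup>+x. ?c * (epow (Uc x) al * epow (?P k) th' * indicator (A k) x + pw al k * (epow (Uc x) al * epow (?Q k x) (th * gm))) \<partial>\<mu>)"
    proof (intro nn_integral_mono)
      fix x
      show "epow (Uc x) al * epow (In x) th' * indicator (A k) x
        \<le> ?c * (epow (Uc x) al * epow (?P k) th' * indicator (A k) x + pw al k * (epow (Uc x) al * epow (?Q k x) (th * gm)))"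
      proof (cases "x \<in> A k")
        case True
        have "epow (Uc x) al * epow (In x) th' \<le> epow (Uc x) al * (?c * (epow (?P k) th' + pw al k * epow (?Q k x) (th * gm)))"
          by (intro mult_left_mono c True) simp
        then show ?thesis using True by (simp add: distrib_left ac_simps)
      qed simp
    qed
    also have "\<dots> = ?c * ((\<integral>\<^sup>+x\<in>A k. epow (Uc x) al * epow (?P k) th' \<partial>\<mu>) + pw al k * (\<integral>\<^sup>+x. epow (Uc x) al * epow (?Q k x) (th * gm) \<partial>\<mu>))"
      by (simp add: nn_integral_cmult nn_integral_add)
    also have "\<dots> \<le> ?c * (m k * (epow (?M k) al * epow (?P k) th') + pw al k * (ennreal PI_const * epow (char_on q th (A k)) gm))"
    proof (intro mult_left_mono add_mono PI)
      show "(\<integral>\<^sup>+x\<in>A k. epow (Uc x) al * epow (?P k) th' \<partial>\<mu>) \<le> m k * (epow (?M k) al * epow (?P k) th')"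
      \<comment> \<open>Only where an earlier block carries \<nu>-mass do \<open>m\<close> and \<mu>
        have to agree; there \<open>regular_blocks\<close> makes all \<mu>-masses from block k on
        finite.\<close>
      proof (cases "?P k = 0")
        case True
        then show ?thesis using epow_zero[OF exps(4)] by simp
      next
        case False
        obtain j where j: "j < k" "s j \<noteq> 0"
        proof (rule ccontr)
          assume "\<not> thesis"
          then have "s j * indicator {..<k} j = 0" for j using that by (cases "j < k") auto
          then have "?P k = isum (\<lambda>j. 0)" by (intro nn_integral_cong) simp
          then show False using False by simp
        qed
        then have "emeasure \<nu> (A j) \<noteq> 0" using epow_zero[OF exps(5)] by (auto simp: s_def)
        then have fin: "emeasure \<mu> (A i) < top" if "k \<le> i" for i
        proof -
          have "j < i" using j(1) that by simp
          then show ?thesis using reg \<open>emeasure \<nu> (A j) \<noteq> 0\<close> by (auto simp: regular_blocks_def)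
        qed
        then have mi: "m i = emeasure \<mu> (A i)" if "k \<le> i" for i
          using that by (auto simp: m_def less_top)
        have "emeasure \<mu> (T k) = (\<integral>\<^sup>+i\<in>{k..}. emeasure \<mu> (A i) \<partial>count_space UNIV)"
          using emeasure_T(2)[of UNIV k] by simp
        also have "\<dots> = ?M k" using mi by (intro nn_integral_cong) (auto split: split_indicator)
        finally have T: "emeasure \<mu> (T k) = ?M k" .
        have "(\<integral>\<^sup>+x\<in>A k. epow (Uc x) al * epow (?P k) th' \<partial>\<mu>) \<le> (\<integral>\<^sup>+x\<in>A k. epow (?M k) al * epow (?P k) th' \<partial>\<mu>)"
        proof (intro nn_integral_mono)
          fix x
          have "epow (Uc x) al \<le> epow (?M k) al" if "x \<in> A k"
            unfolding T[symmetric] by (intro epow_mono Uc_le_T that nonneg)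
          then show "epow (Uc x) al * epow (?P k) th' * indicator (A k) x \<le> epow (?M k) al * epow (?P k) th' * indicator (A k) x"
            by (auto split: split_indicator intro: mult_right_mono)
        qed
        also have "\<dots> = m k * (epow (?M k) al * epow (?P k) th')"
          by (subst nn_integral_cmult_indicator) (simp, simp only: mi[OF order_refl] mult.commute)
        finally show ?thesis .
      qed
    qed auto
    finally show "(\<integral>\<^sup>+x\<in>A k. epow (Uc x) al * epow (In x) th' \<partial>\<mu>)
      \<le> ?c * (m k * (epow (?M k) al * epow (?P k) th') + ennreal PI_const * (pw al k * epow (char_on q th (A k)) gm))"
      by (simp add: mult.left_commute)
  qed
  also have "\<dots> = ?c * (S6 + ennreal PI_const * S5')"
  proof -
    have *: "q / p / (1 - q / p) = al" using params qp by (simp add: divide_simps)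
    show ?thesis
      unfolding isum_cmult isum_add S6_def S5'_def discrete_char_def * ..
  qed
  finally show ?thesis .
qed

definition "S6_const = 2 powr (al + 1) * 2 powr th'"

text \<open>Passing from sums to integrals charges each block to its predecessor. Levels without a
  heavy enough predecessor cost Wa^(-al') \<nu>{..<x}^th2 in \<open>layer_lower\<close>, which
  \<open>PI\<close> turns into \<open>I2\<close>.\<close>

lemma S6_le: "S6 \<le> ennreal S6_const * (ennreal ((2 powr (al' + 1)) powr th') * I6
    + ennreal ((2 powr al' * geom_const al') powr th' * PI_const) * I2)"
proof -
  let ?P = "\<lambda>k. \<integral>\<^sup>+j\<in>{..<k}. s j \<partial>count_space UNIV"
  let ?M = "\<lambda>k. \<integral>\<^sup>+j\<in>{k..}. m j \<partial>count_space UNIV"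
  let ?N = "\<lambda>x. emeasure \<nu> {..<x}"
  let ?c1 = "2 powr (al' + 1)" and ?c2 = "2 powr al' * geom_const al'"
  have c2: "0 < ?c2" using geom_const_pos[OF exps(6)] by simp
  let ?J = "\<lambda>x. ennreal (?c1 powr th') * epow (In x) th' + ennreal (?c2 powr th') * (epow Wa (- al) * epow (?N x) (th * gm))"
  have N [measurable]: "?N \<in> borel_measurable \<mu>" using measurable_Q[of UNIV] by simp
  have P: "epow (?P k) th' \<le> ennreal (2 powr th') * ?J x" if x: "x \<in> A k" for x k
  proof -
    have "?P k = isum (\<lambda>j. pw al' j * (epow (emeasure \<nu> (A j)) th2 * indicator {..<k} j))"
      by (simp add: s_def mult.assoc)
    also have "\<dots> \<le> ennreal ?c1 * In x + ennreal ?c2 * (epow Wa (- al') * epow (?N x) th2)"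
      unfolding In_def
    proof (rule layer_lower[OF exps(6)])
      have sub: "A j \<subseteq> {..<x}" if "j < k" for j using A_less[OF _ x that] by auto
      show "epow (emeasure \<nu> (A j)) th2 * indicator {..<k} j \<le> epow (emeasure \<nu> ({t<..} \<inter> {..<x})) th2" if t: "t \<in> A (j - 1)" for t j
      proof (cases "j < k")
        case True
        have "A j \<subseteq> {t<..}" using A_less[OF t, of _ j] by auto
        then show ?thesis using sub[OF True] True nonneg by (auto intro!: epow_mono emeasure_mono)
      qed simp
      show "epow (emeasure \<nu> (A j)) th2 * indicator {..<k} j \<le> epow (?N x) th2" for j
        using sub[of j] nonneg by (auto split: split_indicator intro!: epow_mono emeasure_mono)
    qed measurable
    finally have "epow (?P k) th' \<le> epow (ennreal ?c1 * In x + ennreal ?c2 * (epow Wa (- al') * epow (?N x) th2)) th'"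
      by (intro epow_mono nonneg)
    also have "\<dots> \<le> ennreal (2 powr th') * (epow (ennreal ?c1 * In x) th' + epow (ennreal ?c2 * (epow Wa (- al') * epow (?N x) th2)) th')"
      by (intro epow_add_le nonneg)
    also have "epow (ennreal ?c1 * In x) th' = ennreal (?c1 powr th') * epow (In x) th'"
      unfolding epow_mult[OF nonneg(4)] by (subst epow_ennreal) simp_all
    also have "epow (ennreal ?c2 * (epow Wa (- al') * epow (?N x) th2)) th' = ennreal (?c2 powr th') * (epow Wa (- al) * epow (?N x) (th * gm))"
      unfolding epow_mult[OF nonneg(4)] epow_ennreal[OF c2] epow_epow al_eqs(2) minus_mult_left[symmetric] al_eqs(1) ..
    finally show ?thesis .
  qed
  have "S6 = isum (\<lambda>k. m k * (epow (?M k) al * epow (?P k) th'))"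
  proof -
    have *: "q / p / (1 - q / p) = al" using params qp by (simp add: divide_simps)
    show ?thesis unfolding S6_def discrete_char_def * ..
  qed
  also have "\<dots> \<le> isum (\<lambda>k. ennreal S6_const * (\<integral>\<^sup>+x\<in>A k. epow (Uc x) al * ?J x \<partial>\<mu>))"
  proof (rule isum_mono)
    fix k
    show "m k * (epow (?M k) al * epow (?P k) th') \<le> ennreal S6_const * (\<integral>\<^sup>+x\<in>A k. epow (Uc x) al * ?J x \<partial>\<mu>)"
    proof (cases "emeasure \<mu> (A k) = top")
      case True
      then show ?thesis by (simp add: m_def)
    next
      case False
      have "?M k \<le> emeasure \<mu> (T k)"
        using emeasure_T(2)[of UNIV k] by (auto intro!: nn_integral_mono simp: m_def split: split_indicator)
      also have TU: "T k = A k \<union> T (k + 1)"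
        unfolding T_def by (auto simp: Bex_def) (metis add1_zle_eq order_le_less zless_imp_add1_zle)+
      finally have "m k * epow (?M k) al \<le> emeasure \<mu> (A k) * epow (emeasure \<mu> (A k \<union> T (k + 1))) al"
        using nonneg by (intro mult_mono epow_mono) (auto simp: m_def)
      \<comment> \<open>The tail sum includes block k itself, whereas \<open>Uc\<close> decreases
        across it; the split lemma still recovers the full power from this block.\<close>
      also have "\<dots> \<le> ennreal (2 powr (al + 1)) * (\<integral>\<^sup>+x\<in>A k. epow (Uc x) al \<partial>\<mu>)"
      proof (rule dist_le_power_split[OF dist_le_Uc])
        show "A k \<inter> T (k + 1) = {}" using A_less[of _ k _ k] A_disj by (fastforce simp: T_def)
        show "Uc x \<le> emeasure \<mu> (T (k + 1))" if x: "x \<in> T (k + 1)" for x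
        proof -
          obtain j where j: "k + 1 \<le> j" "x \<in> A j" using x by (auto simp: T_def)
          have "Uc x \<le> emeasure \<mu> (T j)" by (rule Uc_le_T[OF j(2)])
          also have "T j \<subseteq> T (k + 1)" unfolding T_def using j(1) by (intro UN_mono) auto
          then have "emeasure \<mu> (T j) \<le> emeasure \<mu> (T (k + 1))" by (rule emeasure_mono) simp
          finally show ?thesis .
        qed
        show "emeasure \<mu> (T (k + 1)) \<le> Uc x" if x: "x \<in> A k" for x
          unfolding Uc_def using T_subset[of x "k + 1"] x by (intro emeasure_mono) (auto intro: less_imp_le)
      qed (use False nonneg in \<open>auto simp: less_top\<close>)
      finally have "m k * epow (?M k) al * epow (?P k) th' \<le> ennreal (2 powr (al + 1)) * (\<integral>\<^sup>+x\<in>A k. epow (Uc x) al \<partial>\<mu>) * epow (?P k) th'"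
        by (rule mult_right_mono) simp
      also have "\<dots> = ennreal (2 powr (al + 1)) * (\<integral>\<^sup>+x\<in>A k. epow (Uc x) al * epow (?P k) th' \<partial>\<mu>)"
        by (subst mult.assoc, subst nn_integral_multc[symmetric]) (auto intro!: arg_cong2[where f = "(*)"] nn_integral_cong simp: ac_simps)
      also have "\<dots> \<le> ennreal (2 powr (al + 1)) * (\<integral>\<^sup>+x. ennreal (2 powr th') * (epow (Uc x) al * ?J x * indicator (A k) x) \<partial>\<mu>)"
      proof (intro mult_left_mono nn_integral_mono)
        fix x
        show "epow (Uc x) al * epow (?P k) th' * indicator (A k) x \<le> ennreal (2 powr th') * (epow (Uc x) al * ?J x * indicator (A k) x)"
        proof (cases "x \<in> A k")
          case True
          have "epow (Uc x) al * epow (?P k) th' \<le> epow (Uc x) al * (ennreal (2 powr th') * ?J x)"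
            by (intro mult_left_mono P True) simp
          then show ?thesis using True by (simp add: mult.left_commute)
        qed simp
      qed simp
      also have "\<dots> = ennreal S6_const * (\<integral>\<^sup>+x\<in>A k. epow (Uc x) al * ?J x \<partial>\<mu>)"
        by (subst nn_integral_cmult) (auto simp: S6_const_def ennreal_mult mult.assoc)
      finally show ?thesis by (simp add: mult.assoc)
    qed
  qed
  also have "\<dots> = ennreal S6_const * (\<integral>\<^sup>+x. epow (Uc x) al * ?J x \<partial>\<mu>)"
    unfolding isum_cmult using A_disj cover_\<mu> by (subst nn_integral_blocks[of A \<mu>]) auto
  also have "(\<integral>\<^sup>+x. epow (Uc x) al * ?J x \<partial>\<mu>)
    = (\<integral>\<^sup>+x. ennreal (?c1 powr th') * (epow (Uc x) al * epow (In x) th')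
       + ennreal (?c2 powr th') * (epow Wa (- al) * (epow (Uc x) al * epow (?N x) (th * gm))) \<partial>\<mu>)"
    by (simp only: distrib_left mult.left_commute)
  also have "\<dots> = ennreal (?c1 powr th') * I6 + ennreal (?c2 powr th') * (epow Wa (- al) * (\<integral>\<^sup>+x. epow (Uc x) al * epow (?N x) (th * gm) \<partial>\<mu>))"
    unfolding I6_def by (simp add: nn_integral_add nn_integral_cmult)
  also have "\<dots> \<le> ennreal (?c1 powr th') * I6 + ennreal (?c2 powr th') * (epow Wa (- al) * (ennreal PI_const * epow (char_on q th UNIV) gm))"
    using PI[of UNIV] by (intro add_left_mono mult_left_mono) auto
  also have "\<dots> = ennreal (?c1 powr th') * I6 + ennreal (?c2 powr th' * PI_const) * I2"
  proof -
    have "ennreal (?c2 powr th' * PI_const) = ennreal (?c2 powr th') * ennreal PI_const"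
      by (rule ennreal_mult) (simp_all add: PI_const_def)
    then show ?thesis unfolding I2_def by (simp only: ac_simps)
  qed
  finally show ?thesis by (simp add: mult_left_mono)
qed

text \<open>These depend on p, q, r alone, hence are uniform in the interval and the weights. The 4
  in \<open>suff_const\<close> comes from \<open>R_le\<close>, the powers of
  \<open>geom_const 1\<close> in \<open>nec5\<close> and \<open>nec6\<close> from
  \<open>Rw_le\<close>.\<close>

definition "S5_bound = 2 powr (al + 1) + 2 powr al * geom_const al"
definition "S6_bound = S6_const * ((2 powr (al' + 1)) powr th' + (2 powr al' * geom_const al') powr th' * PI_const)"
definition "suff_const = (2 powr (q / r) * (hardy_const r q + hardy_const (r / p) (q / p)) * 4 powr (q / p)
  * (S5_bound powr (1 - q / p) + S6_bound powr (1 - q / p))) powr (1 / q)"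
definition "nec5 = 2 powr ((th + q / (1 - q)) * (p / (p - q))) * geom_const 1 powr (q / (p - q))"
definition "nec6 = 2 powr ((th' + al) * (p / (p - q))) * geom_const 1 powr (q / (p - q))"
definition "nec_const = 2 powr (al + 1) * geo_const * nec5 + 2 powr al * geo_const * nec5
  + (In_const * 2) powr th' * (nec6 + PI_const * nec5)"

lemma bounds_pos: "0 < S5_bound" "0 < S6_bound" "0 < geo_const" "0 < nec5" "0 < nec6" "0 < PI_const"
  "0 < hardy_const r q" "0 < hardy_const (r / p) (q / p)" "0 < (In_const * 2) powr th'"
proof -
  show 1: "0 < S5_bound" unfolding S5_bound_def using geom_const_pos[OF exps(3)] by (intro add_pos_pos mult_pos_pos) auto
  show 2: "0 < PI_const" by (simp add: PI_const_def)
  show "0 < S6_bound" unfolding S6_bound_def S6_const_def using geom_const_pos[OF exps(6)] 2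
    by (intro mult_pos_pos add_pos_pos) auto
  have g: "0 < geom_const 1" by (rule geom_const_pos) simp
  show "0 < nec5" "0 < nec6" unfolding nec5_def nec6_def using g by (auto intro!: mult_pos_pos)
  have al2: "0 < al / 2 / 2" using exps(3) by (intro half_gt_zero)
  have gm0: "0 < gm" using exps(2) by linarith
  then have gm2: "0 < 2 * gm" by linarith
  have "0 < geom_const (al / (2 * gm) / th)" "0 < geom_const (al / 2 / 2 / gm)" "0 < geom_const (al / 2 / 2)"
    using geom_const_pos[OF divide_pos_pos[OF divide_pos_pos[OF exps(3) gm2] exps(1)]]
      geom_const_pos[OF divide_pos_pos[OF al2 gm0]] geom_const_pos[OF al2] by auto
  then show "0 < geo_const" unfolding geo_const_def by (intro mult_pos_pos) auto
  show "0 < hardy_const r q" "0 < hardy_const (r / p) (q / p)"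
    using r params by (auto intro!: hardy_const_pos)
  show "0 < (In_const * 2) powr th'" using In_const_pos by simp
qed

lemma S5'_le_S5: "S5' \<le> S5"
  unfolding S5'_def S5_def
proof (intro isum_mono mult_left_mono epow_mono char_on_mono nonneg emeasure_mono)
  show "A k \<inter> {..<t} \<subseteq> T k \<inter> {..<t}" for k t by (auto simp: T_def)
qed auto

lemma abstract_sufficient:
  assumes pos: "\<And>k. 0 < emeasure \<mu> (T k)" and Y: "I1 \<le> Y" "I2 \<le> Y" "I6 \<le> Y" "Y < top"
    and g: "g \<in> borel_measurable \<nu>"
  shows "epow (L g) (1 / q) \<le> ennreal suff_const * epow Y ((p - q) / (p * q)) * epow (Rw g) (1 / p)"
proof -
  let ?z = "1 - q / p"
  have z: "0 \<le> ?z" "0 \<le> q / p" "0 \<le> 1 / q" using params qp by auto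
  have S5: "S5 \<le> ennreal S5_bound * Y"
  proof -
    have "S5 \<le> ennreal (2 powr (al + 1)) * Y + ennreal (2 powr al * geom_const al) * Y"
      using S5_le_I Y(1,2) by (meson add_mono mult_left_mono order_trans zero_le)
    also have "\<dots> = ennreal S5_bound * Y"
      unfolding S5_bound_def using geom_const_pos[OF exps(3)] by (simp add: distrib_right)
    finally show ?thesis .
  qed
  then have S5': "S5' \<le> ennreal S5_bound * Y" using S5'_le_S5 by (rule order_trans[rotated])
  then have "S5' < top" using Y(4) by (auto intro: order_le_less_trans simp: ennreal_mult_less_top)
  then have reg: regular_blocks using pos by (rule regular_blocksI)
  have S6: "S6 \<le> ennreal S6_bound * Y"
  proof -
    let ?a = "(2 powr (al' + 1)) powr th'" and ?b = "(2 powr al' * geom_const al') powr th' * PI_const"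
    have b: "0 \<le> ?b" using bounds_pos by simp
    have "S6 \<le> ennreal S6_const * (ennreal ?a * Y + ennreal ?b * Y)"
      using S6_le Y(2,3) by (meson add_mono mult_left_mono order_trans zero_le)
    also have "\<dots> = ennreal S6_const * (ennreal (?a + ?b) * Y)"
      using b by (simp add: distrib_right)
    also have "\<dots> = ennreal S6_bound * Y"
      unfolding S6_bound_def using b by (subst ennreal_mult) (simp_all add: S6_const_def mult.assoc)
    finally show ?thesis .
  qed
  let ?h = "2 powr (q / r) * (hardy_const r q + hardy_const (r / p) (q / p))"
  let ?k = "S5_bound powr ?z + S6_bound powr ?z"
  have h: "0 < ?h" using bounds_pos by (intro mult_pos_pos) auto
  have k: "0 < ?k" using bounds_pos by (intro add_pos_pos) auto
  have "L g \<le> ennreal ?h * epow (R g) (q / p) * (epow S5' ?z + epow S6 ?z)"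
    by (rule block_sufficient[OF g reg])
  also have "\<dots> \<le> ennreal ?h * epow (4 * Rw g) (q / p) * (epow (ennreal S5_bound * Y) ?z + epow (ennreal S6_bound * Y) ?z)"
    by (intro mult_mono add_mono epow_mono R_le g S5' S6 z) auto
  also have "\<dots> = ennreal (?h * 4 powr (q / p) * ?k) * (epow Y ?z * epow (Rw g) (q / p))"
  proof -
    have "epow (ennreal S5_bound * Y) ?z + epow (ennreal S6_bound * Y) ?z = ennreal ?k * epow Y ?z"
      unfolding epow_mult[OF z(1)] epow_ennreal[OF bounds_pos(1)] epow_ennreal[OF bounds_pos(2)]
      by (simp add: distrib_right)
    moreover have "epow (4 * Rw g) (q / p) = ennreal (4 powr (q / p)) * epow (Rw g) (q / p)"
      unfolding epow_mult[OF z(2)] using epow_ennreal[of 4 "q / p"] by simp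
    moreover have "ennreal (?h * 4 powr (q / p) * ?k) = ennreal ?h * ennreal (4 powr (q / p)) * ennreal ?k"
      using h k by (subst ennreal_mult, simp, simp, subst ennreal_mult) auto
    ultimately show ?thesis by (simp only: ac_simps)
  qed
  finally have "epow (L g) (1 / q) \<le> epow (ennreal (?h * 4 powr (q / p) * ?k) * (epow Y ?z * epow (Rw g) (q / p))) (1 / q)"
    by (intro epow_mono z)
  also have "\<dots> = ennreal suff_const * (epow Y ((p - q) / (p * q)) * epow (Rw g) (1 / p))"
  proof -
    have 1: "?z * (1 / q) = (p - q) / (p * q)" "q / p * (1 / q) = 1 / p"
      using params by (auto simp: divide_simps)
    have "0 < ?h * 4 powr (q / p) * ?k" using h k by simp
    then have 2: "epow (ennreal (?h * 4 powr (q / p) * ?k)) (1 / q) = ennreal suff_const"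
      unfolding suff_const_def by (rule epow_ennreal)
    show ?thesis unfolding epow_mult[OF z(3)] 2 epow_epow 1 ..
  qed
  finally show ?thesis by (simp only: mult.assoc)
qed

text \<open>The order matters: the local test bounds \<open>S5'\<close> without regularity, its
  finiteness yields \<open>regular_blocks\<close>, and only then is the discrete test
  available.\<close>

lemma abstract_necessary:
  assumes pos: "\<And>k. 0 < emeasure \<mu> (T k)" and C: "C < top"
    and le: "\<And>g. g \<in> borel_measurable \<nu> \<Longrightarrow> epow (L g) (1 / q) \<le> C * epow (Rw g) (1 / p)"
  shows "I1 \<le> ennreal nec_const * epow C (p * q / (p - q))"
    and "I2 \<le> ennreal nec_const * epow C (p * q / (p - q))"
    and "I6 \<le> ennreal nec_const * epow C (p * q / (p - q))"
proof -
  define X where "X = epow C (p * q / (p - q))"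
  have X: "X < top" unfolding X_def using C params qp by (intro epow_less_top) auto
  define K where "K = epow C q * ennreal (geom_const 1 powr (q / p))"
  have g1: "0 < geom_const 1" by (rule geom_const_pos) simp
  have z: "0 \<le> q / p" "0 \<le> q" "0 \<le> p / (p - q)" using params qp by auto
  have K: "L g \<le> K * epow (R g) (q / p)" if g: "g \<in> borel_measurable \<nu>" for g
  proof -
    have "L g = epow (epow (L g) (1 / q)) q" using params by (simp add: epow_epow)
    also have "\<dots> \<le> epow (C * epow (Rw g) (1 / p)) q" by (intro epow_mono le g z)
    also have "\<dots> = epow C q * epow (Rw g) (q / p)"
      unfolding epow_mult[OF z(2)] epow_epow by simp
    also have "\<dots> \<le> epow C q * epow (ennreal (geom_const 1) * R g) (q / p)"
      by (intro mult_left_mono epow_mono Rw_le g z) simp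
    also have "\<dots> = K * epow (R g) (q / p)"
      unfolding epow_mult[OF z(1)] epow_ennreal[OF g1] K_def by (simp only: mult.assoc)
    finally show ?thesis .
  qed
  have KX: "epow K (p / (p - q)) = ennreal (geom_const 1 powr (q / (p - q))) * X"
  proof -
    have e1: "q * (p / (p - q)) = p * q / (p - q)" "q / p * (p / (p - q)) = q / (p - q)"
      using params by auto
    have "0 < geom_const 1 powr (q / p)" using g1 by simp
    then show ?thesis
      unfolding K_def X_def epow_mult[OF z(3)] epow_epow e1(1)
      by (simp only: epow_ennreal powr_powr e1(2) mult.commute)
  qed
  have S5': "S5' \<le> ennreal nec5 * X"
    using block_necessary_local[OF K] unfolding KX nec5_def by (simp add: ennreal_mult mult.assoc)
  then have fin: "S5' < top" using X by (auto intro: order_le_less_trans simp: ennreal_mult_less_top)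
  have reg: regular_blocks using fin pos by (rule regular_blocksI)
  have S6: "S6 \<le> ennreal nec6 * X"
    using block_necessary_discrete[OF K reg] unfolding KX nec6_def by (simp add: ennreal_mult mult.assoc)
  have S5: "S5 \<le> ennreal (geo_const * nec5) * X"
  proof -
    have "S5 \<le> ennreal geo_const * (ennreal nec5 * X)"
      by (rule order_trans[OF S5_le]) (intro mult_left_mono S5', simp)
    then show ?thesis using bounds_pos by (simp add: ennreal_mult mult.assoc)
  qed
  have parts: "0 \<le> 2 powr (al + 1) * geo_const * nec5" "0 \<le> 2 powr al * geo_const * nec5"
    "0 \<le> (In_const * 2) powr th' * (nec6 + PI_const * nec5)"
    using bounds_pos by (auto intro!: mult_nonneg_nonneg add_nonneg_nonneg less_imp_le)
  show "I1 \<le> ennreal nec_const * X"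
  proof -
    have "I1 \<le> ennreal (2 powr (al + 1)) * (ennreal (geo_const * nec5) * X)"
      by (rule order_trans[OF I1_le]) (intro mult_left_mono S5, simp)
    also have "\<dots> = ennreal (2 powr (al + 1) * (geo_const * nec5)) * X"
      by (simp only: ennreal_mult' powr_ge_zero mult.assoc)
    also have "\<dots> \<le> ennreal nec_const * X"
      unfolding nec_const_def using parts by (intro mult_right_mono ennreal_leI) (simp_all add: mult.assoc)
    finally show ?thesis .
  qed
  show "I2 \<le> ennreal nec_const * X"
  proof -
    have "I2 \<le> ennreal (2 powr al) * (ennreal (geo_const * nec5) * X)"
      by (rule order_trans[OF I2_le]) (intro mult_left_mono S5, simp)
    also have "\<dots> = ennreal (2 powr al * (geo_const * nec5)) * X"
      by (simp only: ennreal_mult' powr_ge_zero mult.assoc)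
    also have "\<dots> \<le> ennreal nec_const * X"
      unfolding nec_const_def using parts by (intro mult_right_mono ennreal_leI) (simp_all add: mult.assoc)
    finally show ?thesis .
  qed
  show "I6 \<le> ennreal nec_const * X"
  proof -
    have "I6 \<le> ennreal ((In_const * 2) powr th') * (S6 + ennreal PI_const * S5')" by (rule I6_le[OF reg])
    also have "\<dots> \<le> ennreal ((In_const * 2) powr th') * (ennreal nec6 * X + ennreal PI_const * (ennreal nec5 * X))"
      by (intro mult_left_mono add_mono S6 S5') auto
    also have "\<dots> = ennreal ((In_const * 2) powr th' * (nec6 + PI_const * nec5)) * X"
    proof -
      have "ennreal (nec6 + PI_const * nec5) = ennreal nec6 + ennreal PI_const * ennreal nec5"
        using bounds_pos by (simp add: ennreal_mult)
      moreover have "ennreal ((In_const * 2) powr th' * (nec6 + PI_const * nec5)) = ennreal ((In_const * 2) powr th') * ennreal (nec6 + PI_const * nec5)"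
        using bounds_pos by (intro ennreal_mult) auto
      ultimately show ?thesis by (simp only: distrib_right distrib_left mult.assoc)
    qed
    also have "\<dots> \<le> ennreal nec_const * X"
      unfolding nec_const_def using parts by (intro mult_right_mono ennreal_leI) simp_all
    finally show ?thesis .
  qed
qed

end

section \<open>Lebesgue densities and the main theorem\<close>

lemma sigma_finite_lebesgue: "sigma_finite_measure lebesgue"
proof
  obtain A :: "nat \<Rightarrow> 'a set" where A: "range A \<subseteq> sets lborel" "(\<Union>i. A i) = space lborel" "\<And>i. emeasure lborel (A i) \<noteq> \<infinity>"
    using lborel.sigma_finite by blast
  show "\<exists>A::'a set set. countable A \<and> A \<subseteq> sets lebesgue \<and> \<Union> A = space lebesgue \<and> (\<forall>a\<in>A. emeasure lebesgue a \<noteq> \<infinity>)"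
  proof (intro exI[of _ "range A"] conjI ballI)
    show "range A \<subseteq> sets lebesgue" using A(1) by auto
    show "\<Union> (range A) = space lebesgue" using A(2) by simp
    fix a assume "a \<in> range A"
    then obtain i where "a = A i" by auto
    then show "emeasure lebesgue a \<noteq> \<infinity>" using A(1) A(3)[of i] by auto
  qed auto
qed

locale interval_weight =
  fixes a b :: ereal and z :: "real \<Rightarrow> ennreal"
  assumes ab: "a < b" and weight: "weight_on a b z"
begin

abbreviation "J \<equiv> einterval a b"
text \<open>Extension by zero: a weight is measurable on J only, whereas the measures have to live
  on the whole line.\<close>

definition "dens x = z x * indicator J x"
definition "meas = density lebesgue dens"

lemma J_sets [measurable, simp]: "J \<in> sets lebesgue"
  using borel_einterval by auto

lemma dens_measurable [measurable]: "dens \<in> borel_measurable lebesgue"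
  using weight unfolding weight_on_def dens_def[abs_def]
  by (subst borel_measurable_restrict_space_iff_ennreal[symmetric]) auto

lemma AE_weight: "AE x in lebesgue. x \<in> J \<longrightarrow> 0 < z x \<and> z x < top"
  using weight unfolding weight_on_def by (subst (asm) AE_restrict_space_iff) auto

lemma sets_meas [measurable_cong, simp]: "sets meas = sets lebesgue"
  by (simp add: meas_def)

lemma space_meas [simp]: "space meas = UNIV"
  by (simp add: meas_def)

lemma sf: "sigma_finite_measure meas"
  unfolding meas_def
  by (subst sigma_finite_measure.sigma_finite_iff_density_finite[OF sigma_finite_lebesgue dens_measurable])
     (use AE_weight in \<open>eventually_elim, auto simp: dens_def split: split_indicator\<close>)

lemma AE_J: "AE x in meas. x \<in> J"
  unfolding meas_def by (subst AE_density) (auto simp: dens_def split: split_indicator)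

text \<open>The weight is positive a.e. on J, so a null set of \<open>meas\<close> meets J in a
  Lebesgue null set, which every density vanishing off J ignores.\<close>

lemma emeasure_pos:
  assumes [measurable]: "S \<in> sets lebesgue" and "emeasure (density lebesgue f) S \<noteq> 0"
    and [measurable]: "f \<in> borel_measurable lebesgue" and f: "\<And>x. x \<notin> J \<Longrightarrow> f x = 0"
  shows "0 < emeasure meas S"
proof (rule ccontr)
  assume "\<not> 0 < emeasure meas S"
  then have "(\<integral>\<^sup>+x. dens x * indicator S x \<partial>lebesgue) = 0"
    by (simp add: meas_def emeasure_density)
  then have "AE x in lebesgue. dens x * indicator S x = 0"
    by (subst (asm) nn_integral_0_iff_AE) auto
  with AE_weight have "AE x in lebesgue. f x * indicator S x = 0"
    by eventually_elim (auto simp: dens_def f split: split_indicator_asm split_indicator)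
  then have "emeasure (density lebesgue f) S = 0"
    by (simp add: emeasure_density nn_integral_0_iff_AE)
  then show False using assms(2) by simp
qed

lemma singleton_null: "emeasure meas {x..} = emeasure meas {x<..}"
proof (rule emeasure_eq_AE)
  have "AE t in lebesgue. t \<noteq> x"
    by (intro AE_completion AE_lborel_singleton)
  then show "AE t in meas. (t \<in> {x..}) = (t \<in> {x<..})"
    unfolding meas_def by (subst AE_density) (auto elim!: eventually_mono)
qed auto

text \<open>Agreement almost everywhere is what the substitution f = g \<sigma> can offer, since
  \<sigma> may be 0 or \<infinity> on a null set.\<close>

lemma eint_eq:
  assumes xy: "a \<le> x" "y \<le> b" and [measurable]: "F' \<in> borel_measurable lebesgue"
    and F: "AE t in lebesgue. t \<in> einterval x y \<longrightarrow> F t = F' t * z t"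
  shows "eint x y F = (\<integral>\<^sup>+t\<in>einterval x y. F' t \<partial>meas)"
proof -
  have S [measurable]: "einterval x y \<in> sets lebesgue" using borel_einterval by auto
  have sub: "t \<in> J" if "t \<in> einterval x y" for t
    using that xy by (auto simp: einterval_iff)
  have "(\<integral>\<^sup>+t\<in>einterval x y. F' t \<partial>meas) = (\<integral>\<^sup>+t. dens t * (F' t * indicator (einterval x y) t) \<partial>lebesgue)"
    unfolding meas_def by (rule nn_integral_density) measurable
  also have "\<dots> = (\<integral>\<^sup>+t\<in>einterval x y. F t \<partial>lebesgue)"
    by (intro nn_integral_cong_AE, use F in eventually_elim)
       (auto split: split_indicator simp: dens_def mult.commute dest: sub)
  finally show ?thesis by (simp add: eint_def)
qed

lemma eint_eq_emeasure:
  assumes xy: "a \<le> x" "y \<le> b"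
  shows "eint x y z = emeasure meas (einterval x y)"
proof -
  have S: "einterval x y \<in> sets lebesgue" using borel_einterval by auto
  have "eint x y z = (\<integral>\<^sup>+t\<in>einterval x y. 1 \<partial>meas)"
    by (rule eint_eq[OF xy]) auto
  then show ?thesis using S by simp
qed

lemma tail_eq:
  assumes "x \<in> J"
  shows "tail b z (ereal x) = emeasure meas {x<..}"
proof -
  have "tail b z (ereal x) = emeasure meas (einterval (ereal x) b)"
    unfolding tail_def using assms by (intro eint_eq_emeasure) (auto simp: einterval_iff)
  also have "\<dots> = emeasure meas {x<..}"
  proof (rule emeasure_eq_AE)
    show "AE t in meas. (t \<in> einterval (ereal x) b) = (t \<in> {x<..})"
      using AE_J by eventually_elim (auto simp: einterval_iff)
    show "einterval (ereal x) b \<in> sets meas" using borel_einterval by auto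
  qed auto
  finally show ?thesis .
qed

lemma tail_a: "tail b z a = emeasure meas UNIV"
proof -
  have "tail b z a = emeasure meas J"
    unfolding tail_def by (intro eint_eq_emeasure) auto
  also have "\<dots> = emeasure meas UNIV"
    using AE_J by (intro emeasure_eq_AE) auto
  finally show ?thesis .
qed

lemma eint_full:
  assumes [measurable]: "F' \<in> borel_measurable lebesgue"
    and F: "\<And>t. t \<in> J \<Longrightarrow> F t = F' t * z t"
  shows "eint a b F = (\<integral>\<^sup>+t. F' t \<partial>meas)"
proof -
  have "eint a b F = (\<integral>\<^sup>+t\<in>J. F' t \<partial>meas)"
    by (rule eint_eq) (auto simp: F)
  also have "\<dots> = (\<integral>\<^sup>+t. F' t \<partial>meas)"
    by (intro nn_integral_cong_AE, use AE_J in eventually_elim) auto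
  finally show ?thesis .
qed

lemma eint_left:
  assumes [measurable]: "F' \<in> borel_measurable lebesgue" and t: "t \<in> J"
    and F: "AE s in lebesgue. s \<in> J \<longrightarrow> F s = F' s * z s"
  shows "eint a (ereal t) F = (\<integral>\<^sup>+s\<in>{..<t}. F' s \<partial>meas)"
proof -
  have "eint a (ereal t) F = (\<integral>\<^sup>+s\<in>einterval a t. F' s \<partial>meas)"
  proof (rule eint_eq)
    show "ereal t \<le> b" using t by (auto simp: einterval_iff)
    show "AE s in lebesgue. s \<in> einterval a (ereal t) \<longrightarrow> F s = F' s * z s"
      using F
    proof eventually_elim
      case (elim s)
      have "s \<in> J" if "s \<in> einterval a (ereal t)"
        using that t unfolding einterval_iff by (meson less_trans)
      with elim show ?case by blast
    qed
  qed auto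
  also have "\<dots> = (\<integral>\<^sup>+s\<in>{..<t}. F' s \<partial>meas)"
    by (intro nn_integral_cong_AE, use AE_J in eventually_elim)
       (auto simp: einterval_iff split: split_indicator)
  finally show ?thesis .
qed

lemma eint_right:
  assumes [measurable]: "F' \<in> borel_measurable lebesgue" and t: "t \<in> J"
    and F: "\<And>s. s \<in> J \<Longrightarrow> t < s \<Longrightarrow> F s = F' s * z s" and 0: "\<And>s. s \<le> t \<Longrightarrow> F' s = 0"
  shows "eint (ereal t) b F = (\<integral>\<^sup>+s. F' s \<partial>meas)"
proof -
  have "eint (ereal t) b F = (\<integral>\<^sup>+s\<in>einterval t b. F' s \<partial>meas)"
  proof (rule eint_eq)
    show "a \<le> ereal t" using t by (auto simp: einterval_iff)
    show "AE s in lebesgue. s \<in> einterval (ereal t) b \<longrightarrow> F s = F' s * z s"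
    proof (rule AE_I2, rule impI)
      fix s assume s: "s \<in> einterval (ereal t) b"
      then have "s \<in> J" using t unfolding einterval_iff by (meson less_trans)
      moreover have "t < s" using s by (simp add: einterval_iff)
      ultimately show "F s = F' s * z s" by (rule F)
    qed
  qed auto
  also have "\<dots> = (\<integral>\<^sup>+s. F' s \<partial>meas)"
    by (intro nn_integral_cong_AE, use AE_J in eventually_elim)
       (auto simp: einterval_iff 0 split: split_indicator)
  finally show ?thesis .
qed

end

locale hardy_setup =
  fixes p q r :: real and a b :: ereal and u v w :: "real \<Rightarrow> ennreal"
  assumes r: "0 < r" and rq: "r \<le> q" and qp: "q < p" and p1: "p < 1"
    and ab: "a < b" and wu: "weight_on a b u" and wv: "weight_on a b v" and ww: "weight_on a b w"
    and tails: "\<And>x. x \<in> einterval a b \<Longrightarrow> 0 < tail b w x \<and> tail b w x < top"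
begin

abbreviation "J \<equiv> einterval a b"
definition "\<sigma> x = epow (v x) (1 / (1 - r))"

lemma v_weight: "interval_weight a b v" using ab wv by unfold_locales

lemma weight_\<sigma>: "weight_on a b \<sigma>"
  unfolding weight_on_def
proof
  show "\<sigma> \<in> borel_measurable (lebesgue_on J)"
    using wv unfolding weight_on_def \<sigma>_def[abs_def] by auto
  show "AE x in lebesgue_on J. 0 < \<sigma> x \<and> \<sigma> x < \<infinity>"
  proof -
    have "AE x in lebesgue_on J. 0 < v x \<and> v x < \<infinity>" using wv by (simp only: weight_on_def)
    then show ?thesis
      by eventually_elim (use epow_pos_finite in \<open>auto simp: \<sigma>_def\<close>)
  qed
qed

sublocale Um: interval_weight a b u using ab wu by unfold_locales
sublocale Vm: interval_weight a b \<sigma> using ab weight_\<sigma> by unfold_locales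
sublocale Wm: interval_weight a b w using ab ww by unfold_locales

abbreviation "\<mu> \<equiv> Um.meas"
abbreviation "\<nu> \<equiv> Vm.meas"
abbreviation "\<omega> \<equiv> Wm.meas"

section \<open>Level sets of the tail of w\<close>

definition "Wf x = emeasure \<omega> {x<..}"
definition "Wa = emeasure \<omega> UNIV"
definition "A k = {x \<in> J. pw (- 1) (k + 1) < Wf x \<and> Wf x \<le> pw (- 1) k}"

lemma borel_\<omega>: "sets borel \<subseteq> sets \<omega>" by auto

lemma Wf_measurable [measurable]: "Wf \<in> borel_measurable lebesgue"
proof -
  have "Wf \<in> borel_measurable \<omega>"
    unfolding Wf_def[abs_def]
    by (intro borel_measurable_subalgebra'[OF antimono_borel_measurable borel_\<omega>])
       (auto simp: antimono_def intro!: emeasure_mono)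
  then show ?thesis by simp
qed

lemma A_sets [measurable]: "A k \<in> sets lebesgue"
proof -
  have "A k = J \<inter> {x \<in> space lebesgue. pw (- 1) (k + 1) < Wf x \<and> Wf x \<le> pw (- 1) k}"
    by (auto simp: A_def)
  also have "\<dots> \<in> sets lebesgue" by measurable
  finally show ?thesis .
qed

lemma tail_W: "x \<in> J \<Longrightarrow> tail b w (ereal x) = Wf x"
  unfolding Wf_def by (rule Wm.tail_eq)

lemma Wf_bounds: "x \<in> J \<Longrightarrow> 0 < Wf x" "x \<in> J \<Longrightarrow> Wf x < top"
  using tails[of x] tail_W[of x] by auto

lemma Wf_le: "Wf x \<le> Wa"
  unfolding Wf_def Wa_def by (intro emeasure_mono) auto

lemma Wf_antimono: "x \<le> y \<Longrightarrow> Wf y \<le> Wf x"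
  unfolding Wf_def by (intro emeasure_mono) auto

lemma Wa_pos: "0 < Wa"
  using einterval_nonempty[OF ab] Wf_bounds(1) Wf_le by (meson less_le_trans)

lemma J_cover: 
  assumes "x \<in> J"
  shows "x \<in> (\<Union>k. A k)"
  using ex_dyadic_int[OF Wf_bounds[OF assms]] assms by (auto simp: A_def)

text \<open>Without atoms \<open>Wf\<close> is also the closed tail function, to which
  \<open>dist_le\<close> applies.\<close>

lemma level_le: "emeasure \<omega> {x \<in> J. Wf x \<le> y} \<le> y"
proof -
  have d: "dist_le \<omega> (\<lambda>x. emeasure \<omega> {x..})" by (rule dist_le_atLeast[OF borel_\<omega>])
  note [measurable] = dist_leD(1)[OF d]
  have "{x \<in> space \<omega>. emeasure \<omega> {x..} \<le> y} \<in> sets \<omega>" by measurable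
  then have "emeasure \<omega> {x \<in> J. Wf x \<le> y} \<le> emeasure \<omega> {x \<in> space \<omega>. emeasure \<omega> {x..} \<le> y}"
    by (intro emeasure_mono) (auto simp: Wf_def Wm.singleton_null)
  also have "\<dots> \<le> y" by (rule dist_leD(2)[OF d])
  finally show ?thesis .
qed

lemma level_sets [measurable]: "{x \<in> J. Wf x \<le> y} \<in> sets lebesgue"
proof -
  have "{x \<in> J. Wf x \<le> y} = J \<inter> {x \<in> space lebesgue. Wf x \<le> y}" by auto
  also have "\<dots> \<in> sets lebesgue" by measurable
  finally show ?thesis .
qed

text \<open>Points of J beyond all M_n lie in the level set, M_n being increasing and cofinal in the
  set where W > y. Each ray beyond M_n has mass above y, and finite tails give continuity from
  above.\<close>

lemma level_ge:
  assumes y: "y \<le> Wa"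
  shows "y \<le> emeasure \<omega> {x \<in> J. Wf x \<le> y}"
proof -
  let ?D = "{x \<in> J. y < Wf x}"
  obtain C where C: "C \<subseteq> ?D" "countable C" "?D \<subseteq> (\<Union>x\<in>C. {..x})"
    using ex_countable_cofinal[of ?D] by blast
  show ?thesis
  proof (cases "C = {}")
    case True
    then have "Wf x \<le> y" if "x \<in> J" for x using C(3) that by (auto simp: not_less)
    then have "{x \<in> J. Wf x \<le> y} = J" by auto
    moreover have "emeasure \<omega> J = Wa"
      unfolding Wa_def using Wm.AE_J by (intro emeasure_eq_AE) auto
    ultimately show ?thesis using y by simp
  next
    case False
    define c where "c = from_nat_into C"
    have c: "range c = C" unfolding c_def using False C(2) by (rule range_from_nat_into)
    define M where "M n = Max (c ` {..n})" for n :: nat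
    have M: "M n \<in> ?D" for n
    proof -
      have "M n \<in> c ` {..n}" unfolding M_def by (intro Max_in) auto
      then show ?thesis using c C(1) by auto
    qed
    have cM: "c n \<le> M n" for n unfolding M_def by (intro Max_ge) auto
    have decM: "M i \<le> M j" if "i \<le> j" for i j
      unfolding M_def using that by (intro Max_mono) auto
    have "y \<le> (INF n. emeasure \<omega> {M n<..})"
      using M by (intro INF_greatest) (auto simp: Wf_def intro: less_imp_le)
    also have "\<dots> = emeasure \<omega> (\<Inter>n. {M n<..})"
    proof (rule INF_emeasure_decseq)
      show "decseq (\<lambda>n. {M n<..})" using decM by (auto simp: decseq_def intro: le_less_trans)
      show "emeasure \<omega> {M n<..} \<noteq> \<infinity>" for n
        using Wf_bounds(2)[of "M n"] M[of n] by (auto simp: Wf_def)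
    qed auto
    also have "\<dots> \<le> emeasure \<omega> {x \<in> J. Wf x \<le> y}"
    proof (rule emeasure_mono_AE)
      show "AE x in \<omega>. x \<in> (\<Inter>n. {M n<..}) \<longrightarrow> x \<in> {x \<in> J. Wf x \<le> y}"
        using Wm.AE_J
      proof eventually_elim
        case (elim x)
        have "Wf x \<le> y" if x: "\<And>n. M n < x"
        proof (rule ccontr)
          assume "\<not> Wf x \<le> y"
          then have "x \<in> ?D" using elim by simp
          then obtain n where "x \<le> c n" using C(3) c by auto
          then show False using x[of n] cM[of n] by simp
        qed
        then show ?case using elim by auto
      qed
    qed simp
    finally show ?thesis .
  qed
qed

sublocale weighted_blocks \<mu> \<nu> A p q r \<omega> Wf Wa
proof unfold_locales
  show "sets \<mu> = sets \<nu>" "sets \<omega> = sets \<nu>" by simp_all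
  show "sets borel \<subseteq> sets \<nu>" by auto
  show "A k \<in> sets \<nu>" for k by simp
  show "x < y" if "x \<in> A j" "y \<in> A k" "j < k" for x y j k
  proof (rule ccontr)
    assume "\<not> x < y"
    then have "Wf x \<le> Wf y" by (intro Wf_antimono) simp
    also have "\<dots> \<le> pw (- 1) k" using that(2) by (simp add: A_def)
    also have "\<dots> \<le> pw (- 1) (j + 1)" using that(3) by (simp add: pw_le_iff)
    also have "\<dots> < Wf x" using that(1) by (simp add: A_def)
    finally show False by simp
  qed
  show "AE x in \<mu>. x \<in> (\<Union>k. A k)" "AE x in \<nu>. x \<in> (\<Union>k. A k)" "AE x in \<omega>. x \<in> (\<Union>k. A k)"
    using Um.AE_J Vm.AE_J Wm.AE_J J_cover by (auto elim!: eventually_mono)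
  show "0 < r" "r \<le> q" "q < p" "p < 1" by (fact r rq qp p1)+
  show "Wf \<in> borel_measurable \<nu>" by simp
  show "pw (- 1) (k + 1) < Wf x \<and> Wf x \<le> pw (- 1) k" if "x \<in> A k" for x k using that by (simp add: A_def)
  show le: "emeasure \<omega> (A k) \<le> pw (- 1) k" for k
  proof -
    have "emeasure \<omega> (A k) \<le> emeasure \<omega> {x \<in> J. Wf x \<le> pw (- 1) k}" by (intro emeasure_mono) (auto simp: A_def)
    then show ?thesis using level_le order_trans by blast
  qed
  show "pw (- 1) (k + 1) \<le> emeasure \<omega> (A k)" if "pw (- 1) k \<le> Wa" for k
  proof -
    let ?S = "{x \<in> J. Wf x \<le> pw (- 1) (k + 1)}"
    \<comment> \<open>The block is the level set at 2^(-k) without that at 2^(-k-1); a lower bound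
      for the former and an upper bound for the latter leave 2^(-k-1).\<close>
    have half: "pw (- 1) k = pw (- 1) (k + 1) + pw (- 1) (k + 1)"
    proof -
      have "2 powr (- 1 * real_of_int k) = 2 powr (- 1 * real_of_int (k + 1)) + 2 powr (- 1 * real_of_int (k + 1))"
        using powr_add[of 2 1 "- real_of_int (k + 1)"] by simp
      then show ?thesis unfolding pw_def by (simp only: ennreal_plus powr_ge_zero)
    qed
    have "pw (- 1) k \<le> emeasure \<omega> {x \<in> J. Wf x \<le> pw (- 1) k}" by (rule level_ge[OF that])
    also have "\<dots> \<le> emeasure \<omega> (?S \<union> A k)" by (intro emeasure_mono) (auto simp: A_def)
    also have "\<dots> \<le> emeasure \<omega> ?S + emeasure \<omega> (A k)" by (rule emeasure_subadditive) auto
    also have "\<dots> \<le> pw (- 1) (k + 1) + emeasure \<omega> (A k)" by (intro add_right_mono level_le)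
    finally show ?thesis unfolding half ennreal_add_left_cancel_le by auto
  qed
  show "0 < Wa" by (rule Wa_pos)
  show "Wf x \<le> Wa" for x by (rule Wf_le)
qed (use Um.sf Vm.sf in \<open>auto simp: sigma_finite_measure_def\<close>)

lemma T_lebesgue: "T k \<in> sets lebesgue"
  using T_sets(1)[of k] unfolding Vm.sets_meas .

text \<open>\<open>T k\<close> contains a level set of W of positive \<omega>-mass, and u is
  positive a.e. on J.\<close>

lemma T_pos: "0 < emeasure \<mu> (T k)"
proof (rule Um.emeasure_pos[where f = Wm.dens])
  let ?y = "pw (- 1) k"
  have sub: "{x \<in> J. Wf x \<le> ?y} \<subseteq> T k"
  proof
    fix x assume x: "x \<in> {x \<in> J. Wf x \<le> ?y}"
    then obtain j where j: "x \<in> A j" using J_cover by blast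
    then have "pw (- 1) (j + 1) < ?y" using x by (auto simp: A_def intro: less_le_trans)
    then have "k \<le> j" by (simp add: pw_less_iff)
    then show "x \<in> T k" using j by (auto simp: T_def)
  qed
  have "0 < emeasure \<omega> {x \<in> J. Wf x \<le> ?y}"
  proof (cases "?y \<le> Wa")
    case True
    show ?thesis using less_le_trans[OF pw_pos(1) level_ge[OF True]] .
  next
    case False
    then have "{x \<in> J. Wf x \<le> ?y} = J" using Wf_le by (auto simp: not_le intro: order_trans less_imp_le)
    moreover have "emeasure \<omega> J = Wa"
      unfolding Wa_def using Wm.AE_J by (intro emeasure_eq_AE) auto
    ultimately show ?thesis using Wa_pos by simp
  qed
  also have "\<dots> \<le> emeasure \<omega> (T k)" using sub T_lebesgue[of k] by (intro emeasure_mono) auto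
  finally show "emeasure (density lebesgue Wm.dens) (T k) \<noteq> 0" by (simp add: Wm.meas_def)
  show "T k \<in> sets lebesgue" by (rule T_lebesgue)
qed (auto simp: Wm.dens_def)

section \<open>The conditions and both sides of the inequality in terms of the measures\<close>

lemma tail_U: "t \<in> J \<Longrightarrow> tail b u (ereal t) = Uc t"
  using Um.tail_eq[of t] Um.singleton_null[of t] by (simp add: Uc_def)

lemma Vr_eq:
  assumes "x \<in> J" "t \<in> J"
  shows "Vr r v (ereal x) (ereal t) = epow (emeasure \<nu> ({x<..} \<inter> {..<t})) ((1 - r) / r)"
proof -
  have "eint (ereal x) (ereal t) \<sigma> = emeasure \<nu> (einterval (ereal x) (ereal t))"
    using assms by (intro Vm.eint_eq_emeasure) (auto simp: einterval_iff)
  then show ?thesis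
    unfolding Vr_def \<sigma>_def by (simp add: einterval_eq_Icc greaterThanLessThan_def)
qed

lemma Vr_a:
  assumes "t \<in> J"
  shows "Vr r v a (ereal t) = epow (emeasure \<nu> (UNIV \<inter> {..<t})) ((1 - r) / r)"
proof -
  have "eint a (ereal t) \<sigma> = emeasure \<nu> (einterval a (ereal t))"
    using assms by (intro Vm.eint_eq_emeasure) (auto simp: einterval_iff)
  also have "\<dots> = emeasure \<nu> (UNIV \<inter> {..<t})"
    using Vm.AE_J borel_einterval by (intro emeasure_eq_AE) (auto simp: einterval_iff elim!: eventually_mono)
  finally show ?thesis unfolding Vr_def \<sigma>_def by simp
qed

lemma V_exps: "(1 - r) / r * (q / (1 - q)) = th" "(1 - r) / r * (p * r / (p - r)) = th2"
  "- p / (p - q) = - (al + 1)" "- p / (p - r) = - (al' + 1)"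
  using params r qp by (simp_all add: divide_simps)

lemma measurable_char_integrand:
  assumes "F \<in> sets \<nu>"
  shows "(\<lambda>t. epow (Uc t) (q / (1 - q)) * epow (emeasure \<nu> (F \<inter> {..<t})) th) \<in> borel_measurable lebesgue"
proof -
  have "(\<lambda>t. emeasure \<nu> (F \<inter> {..<t})) \<in> borel_measurable \<nu>" "Uc \<in> borel_measurable \<nu>"
    using measurable_emeasure_inter[OF assms] by auto
  then have [measurable]: "(\<lambda>t. emeasure \<nu> (F \<inter> {..<t})) \<in> borel_measurable lebesgue" "Uc \<in> borel_measurable lebesgue"
    by simp_all
  show ?thesis by measurable
qed

lemma inner5:
  assumes x: "x \<in> J"
  shows "eint (ereal x) b (\<lambda>t. epow (tail b u t) (q / (1 - q)) * u t * epow (Vr r v x t) (q / (1 - q))) = char_on q th {x<..}"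
  unfolding char_on_def
proof (rule Um.eint_right[OF measurable_char_integrand x])
  fix s assume s: "s \<in> J"
  have "epow (Vr r v x s) (q / (1 - q)) = epow (emeasure \<nu> ({x<..} \<inter> {..<s})) th"
    unfolding Vr_eq[OF x s] epow_epow V_exps ..
  then show "epow (tail b u s) (q / (1 - q)) * u s * epow (Vr r v x s) (q / (1 - q))
    = epow (Uc s) (q / (1 - q)) * epow (emeasure \<nu> ({x<..} \<inter> {..<s})) th * u s"
    by (simp add: tail_U[OF s] ac_simps)
next
  fix s assume "s \<le> x"
  then have "{x<..} \<inter> {..<s} = {}" by auto
  then show "epow (Uc s) (q / (1 - q)) * epow (emeasure \<nu> ({x<..} \<inter> {..<s})) th = 0"
    using epow_zero[OF exps(1)] by simp
qed auto

lemma inner5_a: "eint a b (\<lambda>t. epow (tail b u t) (q / (1 - q)) * u t * epow (Vr r v a t) (q / (1 - q))) = char_on q th UNIV"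
  unfolding char_on_def
proof (rule Um.eint_full[OF measurable_char_integrand])
  fix s assume s: "s \<in> J"
  have "epow (Vr r v a s) (q / (1 - q)) = epow (emeasure \<nu> (UNIV \<inter> {..<s})) th"
    unfolding Vr_a[OF s] epow_epow V_exps ..
  then show "epow (tail b u s) (q / (1 - q)) * u s * epow (Vr r v a s) (q / (1 - q))
    = epow (Uc s) (q / (1 - q)) * epow (emeasure \<nu> (UNIV \<inter> {..<s})) th * u s"
    by (simp add: tail_U[OF s] ac_simps)
qed auto

lemma inner6:
  assumes x: "x \<in> J"
  shows "eint a (ereal x) (\<lambda>t. epow (tail b w t) (- p / (p - r)) * w t * epow (Vr r v t x) (p * r / (p - r))) = In x"
proof -
  have [measurable]: "(\<lambda>t. emeasure \<nu> ({t<..} \<inter> {..<x})) \<in> borel_measurable lebesgue"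
    using measurable_V[of x] by simp
  have "eint a (ereal x) (\<lambda>t. epow (tail b w t) (- p / (p - r)) * w t * epow (Vr r v t x) (p * r / (p - r)))
    = (\<integral>\<^sup>+t\<in>{..<x}. epow (Wf t) (- (al' + 1)) * epow (emeasure \<nu> ({t<..} \<inter> {..<x})) th2 \<partial>\<omega>)"
  proof (rule Wm.eint_left[OF _ x])
    have "epow (tail b w s) (- p / (p - r)) * w s * epow (Vr r v s x) (p * r / (p - r))
      = epow (Wf s) (- (al' + 1)) * epow (emeasure \<nu> ({s<..} \<inter> {..<x})) th2 * w s" if s: "s \<in> J" for s
    proof -
      have "epow (Vr r v s x) (p * r / (p - r)) = epow (emeasure \<nu> ({s<..} \<inter> {..<x})) th2"
        unfolding Vr_eq[OF s x] epow_epow V_exps ..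
      then show ?thesis unfolding tail_W[OF s] V_exps by (simp only: ac_simps)
    qed
    then show "AE s in lebesgue. s \<in> J \<longrightarrow> epow (tail b w s) (- p / (p - r)) * w s * epow (Vr r v s x) (p * r / (p - r))
      = epow (Wf s) (- (al' + 1)) * epow (emeasure \<nu> ({s<..} \<inter> {..<x})) th2 * w s" by simp
  qed measurable
  \<comment> \<open>For t \<ge> x the interval (t,x) is empty and the integrand vanishes, so the
    restriction to t < x may be dropped.\<close>
  also have "\<dots> = In x"
    unfolding In_def
  proof (intro nn_integral_cong)
    fix t
    have "{t<..} \<inter> {..<x} = {}" if "\<not> t < x" using that by auto
    then show "epow (Wf t) (- (al' + 1)) * epow (emeasure \<nu> ({t<..} \<inter> {..<x})) th2 * indicator {..<x} t
      = epow (Wf t) (- (al' + 1)) * epow (emeasure \<nu> ({t<..} \<inter> {..<x})) th2"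
      using epow_zero[OF exps(5)] by (cases "t < x") simp_all
  qed
  finally show ?thesis .
qed

lemma C5_eq: "C5 p q r a b u v w = epow I1 ((p - q) / (p * q)) + epow I2 ((p - q) / (p * q))"
proof -
  have [measurable]: "(\<lambda>x. char_on q th {x<..}) \<in> borel_measurable lebesgue"
    using measurable_char by simp
  have 1: "eint a b (\<lambda>x. epow (tail b w x) (- p / (p - q)) * w x *
         epow (eint x b (\<lambda>t. epow (tail b u t) (q / (1 - q)) * u t * epow (Vr r v x t) (q / (1 - q)))) gm) = I1"
    unfolding I1_def
  proof (rule Wm.eint_full)
    fix x assume x: "x \<in> J"
    show "epow (tail b w x) (- p / (p - q)) * w x *
         epow (eint x b (\<lambda>t. epow (tail b u t) (q / (1 - q)) * u t * epow (Vr r v x t) (q / (1 - q)))) gm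
      = epow (Wf x) (- (al + 1)) * epow (char_on q th {x<..}) gm * w x"
      unfolding inner5[OF x] tail_W[OF x] V_exps by (simp only: ac_simps)
  qed measurable
  have z: "0 \<le> (p - q) / (p * q)" using params qp by simp
  have e: "- al * ((p - q) / (p * q)) = - 1 / p" "gm * ((p - q) / (p * q)) = (1 - q) / q"
    using params qp by (auto simp: divide_simps)
  have 2: "epow (tail b w a) (- 1 / p) * epow (char_on q th UNIV) ((1 - q) / q) = epow I2 ((p - q) / (p * q))"
    unfolding I2_def epow_mult[OF z] epow_epow e by (simp add: Wm.tail_a Wa_def)
  show ?thesis unfolding C5_def 1 inner5_a 2 ..
qed

lemma C6_eq: "C6 p q r a b u v w = epow I6 ((p - q) / (p * q))"
proof -
  have [measurable]: "In \<in> borel_measurable lebesgue" "Uc \<in> borel_measurable lebesgue"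
    using measurable_In(1) measurable_NU(3) by simp_all
  have "eint a b (\<lambda>x. epow (tail b u x) (q / (p - q)) * u x *
         epow (eint a x (\<lambda>t. epow (tail b w t) (- p / (p - r)) * w t * epow (Vr r v t x) (p * r / (p - r)))) th') = I6"
    unfolding I6_def
  proof (rule Um.eint_full)
    fix x assume x: "x \<in> J"
    show "epow (tail b u x) (q / (p - q)) * u x *
         epow (eint a x (\<lambda>t. epow (tail b w t) (- p / (p - r)) * w t * epow (Vr r v t x) (p * r / (p - r)))) th'
      = epow (Uc x) al * epow (In x) th' * u x"
      unfolding inner6[OF x] tail_U[OF x] by (simp only: ac_simps)
  qed measurable
  then show ?thesis unfolding C6_def by simp
qed

lemma AE_\<sigma>: "AE x in lebesgue. x \<in> J \<longrightarrow> 0 < v x \<and> v x < top \<and> 0 < \<sigma> x \<and> \<sigma> x < top"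
  using interval_weight.AE_weight[OF v_weight] Vm.AE_weight by eventually_elim auto

lemma hardy_sides:
  fixes f g :: "real \<Rightarrow> ennreal"
  assumes g [measurable]: "g \<in> borel_measurable lebesgue" and f: "AE x in lebesgue. x \<in> J \<longrightarrow> f x = g x * \<sigma> x"
  shows "eint a b (\<lambda>t. epow (eint a t (\<lambda>s. epow (f s) r * v s)) (q / r) * u t) = L g"
    "eint a b (\<lambda>t. epow (eint a t f) p * w t) = Rw g"
proof -
  have m: "(\<lambda>t. \<integral>\<^sup>+y\<in>{..<t}. h y \<partial>\<nu>) \<in> borel_measurable lebesgue" for h
    using measurable_int_lessThan[of h] by simp
  have F: "eint a (ereal t) f = (\<integral>\<^sup>+y\<in>{..<t}. g y \<partial>\<nu>)" if t: "t \<in> J" for t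
    using f by (intro Vm.eint_left t g)
  have FR: "eint a (ereal t) (\<lambda>s. epow (f s) r * v s) = (\<integral>\<^sup>+y\<in>{..<t}. epow (g y) r \<partial>\<nu>)" if t: "t \<in> J" for t
  proof (rule Vm.eint_left[OF _ t])
    show "AE s in lebesgue. s \<in> J \<longrightarrow> epow (f s) r * v s = epow (g s) r * \<sigma> s"
      using f AE_\<sigma>
    proof eventually_elim
      case (elim s)
      show ?case
      proof
        assume s: "s \<in> J"
        then have \<sigma>: "0 < \<sigma> s" "\<sigma> s < top" and fs: "f s = g s * \<sigma> s" using elim by auto
        have "v s = epow (\<sigma> s) (1 - r)" using params by (simp add: \<sigma>_def epow_epow)
        then have "epow (f s) r * v s = epow (g s) r * (epow (\<sigma> s) r * epow (\<sigma> s) (1 - r))"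
          using r by (simp add: fs epow_mult mult.assoc)
        also have "epow (\<sigma> s) r * epow (\<sigma> s) (1 - r) = \<sigma> s"
          by (subst epow_add'[OF \<sigma>, symmetric]) simp
        finally show "epow (f s) r * v s = epow (g s) r * \<sigma> s" .
      qed
    qed
  qed measurable
  show "eint a b (\<lambda>t. epow (eint a t (\<lambda>s. epow (f s) r * v s)) (q / r) * u t) = L g"
    unfolding L_def by (rule Um.eint_full) (auto simp: FR intro!: measurable_epow m)
  show "eint a b (\<lambda>t. epow (eint a t f) p * w t) = Rw g"
    unfolding Rw_def by (rule Wm.eint_full) (auto simp: F intro!: measurable_epow m)
qed

text \<open>The substitution f = g \<sigma> is invertible up to null sets, because \<sigma> is
  positive and finite a.e. on J.\<close>

lemma hardy_ineq_iff:
  "hardy_ineq p q r a b u v w C \<longleftrightarrow> (\<forall>g\<in>borel_measurable \<nu>. epow (L g) (1 / q) \<le> C * epow (Rw g) (1 / p))"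
proof
  assume H: "hardy_ineq p q r a b u v w C"
  show "\<forall>g\<in>borel_measurable \<nu>. epow (L g) (1 / q) \<le> C * epow (Rw g) (1 / p)"
  proof
    fix g :: "real \<Rightarrow> ennreal" assume "g \<in> borel_measurable \<nu>"
    then have g [measurable]: "g \<in> borel_measurable lebesgue" by simp
    have f: "(\<lambda>x. g x * \<sigma> x) \<in> borel_measurable (lebesgue_on J)"
    proof -
      have "\<sigma> \<in> borel_measurable (lebesgue_on J)" using weight_\<sigma> by (simp add: weight_on_def)
      moreover have "g \<in> borel_measurable (lebesgue_on J)" using g by (rule measurable_restrict_space1)
      ultimately show ?thesis by simp
    qed
    have "AE x in lebesgue. x \<in> J \<longrightarrow> g x * \<sigma> x = g x * \<sigma> x" by simp
    note s = hardy_sides[OF g this]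
    show "epow (L g) (1 / q) \<le> C * epow (Rw g) (1 / p)"
      using H f unfolding hardy_ineq_def s[symmetric] by blast
  qed
next
  assume H: "\<forall>g\<in>borel_measurable \<nu>. epow (L g) (1 / q) \<le> C * epow (Rw g) (1 / p)"
  show "hardy_ineq p q r a b u v w C"
    unfolding hardy_ineq_def
  proof (intro allI impI)
    fix f :: "real \<Rightarrow> ennreal" assume f: "f \<in> borel_measurable (lebesgue_on J)"
    \<comment> \<open>The quotient of f by \<sigma> on J and 0 elsewhere; \<open>Vm.dens\<close> in
      place of \<sigma> makes it measurable on the whole line.\<close>
    define g where "g x = f x * indicator J x * epow (Vm.dens x) (- 1)" for x
    have "(\<lambda>x. f x * indicator J x) \<in> borel_measurable lebesgue"
      using f by (subst borel_measurable_restrict_space_iff_ennreal[symmetric]) auto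
    then have g: "g \<in> borel_measurable lebesgue" unfolding g_def[abs_def] by measurable
    have "AE x in lebesgue. x \<in> J \<longrightarrow> f x = g x * \<sigma> x"
      using AE_\<sigma>
    proof eventually_elim
      case (elim x)
      show ?case
      proof
        assume x: "x \<in> J"
        then have \<sigma>: "0 < \<sigma> x" "\<sigma> x < top" using elim by auto
        have "g x * \<sigma> x = f x * (epow (\<sigma> x) (- 1) * epow (\<sigma> x) 1)"
          using x by (simp add: g_def Vm.dens_def mult.assoc)
        also have "\<dots> = f x" by (subst epow_add'[OF \<sigma>, symmetric]) simp
        finally show "f x = g x * \<sigma> x" by simp
      qed
    qed
    note s = hardy_sides[OF g this]
    show "epow (eint a b (\<lambda>t. epow (eint a t (\<lambda>s. epow (f s) r * v s)) (q / r) * u t)) (1 / q)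
      \<le> C * epow (eint a b (\<lambda>t. epow (eint a t f) p * w t)) (1 / p)"
      unfolding s using H g by simp
  qed
qed

lemma hardy_if_finite:
  assumes fin: "C5 p q r a b u v w + C6 p q r a b u v w < top"
  shows "hardy_ineq p q r a b u v w (ennreal suff_const * (C5 p q r a b u v w + C6 p q r a b u v w))"
proof -
  define X where "X = C5 p q r a b u v w + C6 p q r a b u v w"
  define Y where "Y = epow X (p * q / (p - q))"
  have e: "0 < (p - q) / (p * q)" "1 / ((p - q) / (p * q)) = p * q / (p - q)" "p * q / (p - q) * ((p - q) / (p * q)) = 1"
    using params qp by auto
  have le: "I1 \<le> Y" "I2 \<le> Y" "I6 \<le> Y"
    unfolding Y_def e(2)[symmetric]
    by (subst epow_le_iff[OF e(1), symmetric], simp add: X_def C5_eq C6_eq add.assoc add_increasing add_increasing2)+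
  have "Y < top" unfolding Y_def using fin params qp by (intro epow_less_top) (auto simp: X_def)
  have "epow Y ((p - q) / (p * q)) = X" unfolding Y_def epow_epow e(3) by simp
  then show ?thesis
    unfolding hardy_ineq_iff X_def[symmetric]
    using abstract_sufficient[OF T_pos le \<open>Y < top\<close>] by simp
qed

text \<open>\<open>C5\<close> contributes two terms and \<open>C6\<close> one, each bounded by the
  same multiple of C; hence the 3.\<close>

lemma finite_if_hardy:
  assumes C: "C < top" and H: "hardy_ineq p q r a b u v w C"
  shows "C5 p q r a b u v w + C6 p q r a b u v w \<le> ennreal (3 * nec_const powr ((p - q) / (p * q))) * C"
proof -
  let ?z = "(p - q) / (p * q)"
  have z: "0 \<le> ?z" "p * q / (p - q) * ?z = 1" using params qp by auto
  have n: "0 < nec_const"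
    unfolding nec_const_def using bounds_pos by (intro add_pos_pos mult_pos_pos) auto
  have "epow I ?z \<le> ennreal (nec_const powr ?z) * C" if "I \<le> ennreal nec_const * epow C (p * q / (p - q))" for I
  proof -
    have "epow I ?z \<le> epow (ennreal nec_const * epow C (p * q / (p - q))) ?z"
      by (intro epow_mono that z)
    also have "\<dots> = ennreal (nec_const powr ?z) * C"
      unfolding epow_mult[OF z(1)] epow_ennreal[OF n] epow_epow z(2) by simp
    finally show ?thesis .
  qed
  note I = this[OF abstract_necessary(1)[OF T_pos C]] this[OF abstract_necessary(2)[OF T_pos C]] this[OF abstract_necessary(3)[OF T_pos C]]
  have H': "epow (L g) (1 / q) \<le> C * epow (Rw g) (1 / p)" if "g \<in> borel_measurable \<nu>" for g
    using H that unfolding hardy_ineq_iff by blast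
  let ?B = "ennreal (nec_const powr ?z) * C"
  have "C5 p q r a b u v w + C6 p q r a b u v w \<le> ?B + ?B + ?B"
    unfolding C5_eq C6_eq by (intro add_mono I H')
  also have "\<dots> = 3 * ?B"
  proof -
    have "(3::ennreal) = 1 + 1 + 1" by simp
    then show ?thesis by (simp only: distrib_right mult_1_left)
  qed
  also have "\<dots> = ennreal (3 * nec_const powr ?z) * C"
    by (simp add: ennreal_mult mult.assoc)
  finally show ?thesis .
qed

end

theorem theorem2p3:
  fixes p q r :: real
  assumes "0 < r" "r \<le> q" "q < p" "p < 1"
  shows "\<exists>c::real. 0 < c \<and>
    (\<forall>(a::ereal) (b::ereal) (u::real \<Rightarrow> ennreal) (v::real \<Rightarrow> ennreal) (w::real \<Rightarrow> ennreal).
       0 \<le> a \<longrightarrow> a < b \<longrightarrow> weight_on a b u \<longrightarrow> weight_on a b v \<longrightarrow> weight_on a b w \<longrightarrow>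
       (\<forall>x\<in>einterval a b. 0 < tail b w x \<and> tail b w x < \<infinity>) \<longrightarrow>
       ((\<exists>C. 0 < C \<and> C < \<infinity> \<and> hardy_ineq p q r a b u v w C)
          \<longleftrightarrow> max (C5 p q r a b u v w) (C6 p q r a b u v w) < \<infinity>) \<and>
       ennreal (inverse c) * (C5 p q r a b u v w + C6 p q r a b u v w) \<le> best_const p q r a b u v w \<and>
       best_const p q r a b u v w \<le> ennreal c * (C5 p q r a b u v w + C6 p q r a b u v w))"
proof -
  \<comment> \<open>Fixed before any interval or weight: outside the locale these constants take
    only p, q, r as arguments.\<close>
  define cs where "cs = weighted_blocks.suff_const p q r"
  define cn where "cn = 3 * weighted_blocks.nec_const p q r powr ((p - q) / (p * q))"
  define c where "c = 1 + \<bar>cs\<bar> + \<bar>cn\<bar>"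
  have c: "0 < c" "cs \<le> c" "cn \<le> c" by (auto simp: c_def)
  show ?thesis
  proof (intro exI[of _ c] conjI allI impI c(1))
    fix a b :: ereal and u v w :: "real \<Rightarrow> ennreal"
    assume "a < b" "weight_on a b u" "weight_on a b v" "weight_on a b w"
      "\<forall>x\<in>einterval a b. 0 < tail b w x \<and> tail b w x < \<infinity>"
    then interpret hardy_setup p q r a b u v w
      using assms by unfold_locales auto
    define X where "X = C5 p q r a b u v w + C6 p q r a b u v w"
    have fin_iff: "max (C5 p q r a b u v w) (C6 p q r a b u v w) < \<infinity> \<longleftrightarrow> X < top"
      by (auto simp: X_def)
    have N: "X \<le> ennreal c * C" if "C < top" "hardy_ineq p q r a b u v w C" for C
    proof -
      have "X \<le> ennreal cn * C"
        using finite_if_hardy[OF that] by (simp add: X_def cn_def)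
      also have "\<dots> \<le> ennreal c * C" using c by (intro mult_right_mono ennreal_leI) auto
      finally show ?thesis .
    qed
    have S: "hardy_ineq p q r a b u v w C" if "X < top" "ennreal cs * X \<le> C" for C
    proof -
      have "hardy_ineq p q r a b u v w (ennreal cs * X)"
        using hardy_if_finite that by (simp add: X_def cs_def)
      then show ?thesis
        unfolding hardy_ineq_def using that(2) by (meson mult_right_mono order_trans zero_le)
    qed
    show "(\<exists>C. 0 < C \<and> C < \<infinity> \<and> hardy_ineq p q r a b u v w C)
        \<longleftrightarrow> max (C5 p q r a b u v w) (C6 p q r a b u v w) < \<infinity>"
      unfolding fin_iff
    proof
      assume "\<exists>C. 0 < C \<and> C < \<infinity> \<and> hardy_ineq p q r a b u v w C"
      then obtain C where C: "C < top" "hardy_ineq p q r a b u v w C" by auto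
      have "ennreal c * C < top" using C(1) by (simp add: ennreal_mult_less_top)
      then show "X < top" using N[OF C] by (rule order_le_less_trans[rotated])
    next
      assume X: "X < top"
      show "\<exists>C. 0 < C \<and> C < \<infinity> \<and> hardy_ineq p q r a b u v w C"
        \<comment> \<open>Adding 1 keeps the constant positive when the product is 0.\<close>
        using X by (intro exI[of _ "ennreal cs * X + 1"]) (auto intro!: S simp: ennreal_mult_less_top add_nonneg_pos)
    qed
    show "ennreal (inverse c) * (C5 p q r a b u v w + C6 p q r a b u v w) \<le> best_const p q r a b u v w"
      unfolding best_const_def X_def[symmetric]
    proof (rule Inf_greatest)
      fix C assume "C \<in> {C. 0 < C \<and> C < \<infinity> \<and> hardy_ineq p q r a b u v w C}"
      then have "X \<le> ennreal c * C" by (intro N) auto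
      then have "ennreal (inverse c) * X \<le> ennreal (inverse c) * (ennreal c * C)" by (rule mult_left_mono) simp
      also have "\<dots> = C" using c by (simp add: mult.assoc[symmetric] ennreal_mult[symmetric])
      finally show "ennreal (inverse c) * X \<le> C" .
    qed
    show "best_const p q r a b u v w \<le> ennreal c * (C5 p q r a b u v w + C6 p q r a b u v w)"
      unfolding X_def[symmetric]
    proof (cases "X < top")
      case False
      then show "best_const p q r a b u v w \<le> ennreal c * X" using c by (simp add: less_top[symmetric] ennreal_mult_top)
    next
      case True
      show "best_const p q r a b u v w \<le> ennreal c * X"
      \<comment> \<open>Admissible constants have to be positive, so e is added in case
        \<open>ennreal cs * X\<close> is 0.\<close>
      proof (rule ennreal_le_epsilon)
        fix e :: real assume e: "0 < e"
        have "best_const p q r a b u v w \<le> ennreal cs * X + ennreal e"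
          unfolding best_const_def using True e
          by (intro Inf_lower) (auto intro!: S simp: ennreal_mult_less_top add_nonneg_pos)
        also have "\<dots> \<le> ennreal c * X + ennreal e"
          using c by (intro add_right_mono mult_right_mono ennreal_leI) auto
        finally show "best_const p q r a b u v w \<le> ennreal c * X + ennreal e" .
      qed
    qed
  qed
qed

end
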